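(* Assume that (A1) $\bar A_k$ is invertible for every $k\in[\![0,N-1]\!]$, and (A2) there exists $k_{\mathrm r}\in[\![1,N]\!]$ such that $\mathcal R(k,0)$ is invertible for every $k\in[\![k_{\mathrm r},N]\!]$ and $\mathcal R(N,k)$ is invertible for every $k\in[\![0,k_{\mathrm r}]\!]$. Let $\{H_{k,+}\}_{k=0}^N$ be the solution to $$H_k=\bar A_k^\top H_{k+1}\bar A_k-\bar A_k^\top H_{k+1}B_k(-I+B_k^\top H_{k+1}B_k)^{-1}B_k^\top H_{k+1}\bar A_k-\bar Q_k,\quad k\in[\![0,N-1]\!],$$ with terminal value $H_N=\bar\Sigma_N^{-1}-Y_{N,+}$. Then the unique optimal policy of the backward MaxEnt density control problem described in the context is given by $$\varpi_k^*(v|\xi_{k+1})=\mathcal N\bigl(v\,\big|\,B_k^\top H_{k+1,+}\xi_{k+1},\ I-B_k^\top H_{k+1,+}B_k\bigr)$$ for every $k\in[\![0,N-1]\!]$, $v\in\mathbb R^m$, $\xi_{k+1}\in\mathbb R^n$. Moreover, letting $\{\xi_k^*\}$ be the optimal backward state process driven by $\varpi^*$ and $\{x_k^*\}$ the optimal state process of the forward MaxEnt density control problem described in the context, one has $\xi_k^*\sim\mathcal N\bigl(0,\mathbb E[x_k^*(x_k^* )^\top]\bigr)$ for every $k\in[\![0,N]\!]$ (that is, $\xi_k^*$ has the same distribution as $x_k^*$).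
   Context: Notation: $n,m,N$ are positive integers; $[\![k,l]\!]=\{k,k+1,\dots,l\}$; $\mathcal S^n$ is the set of real symmetric $n\times n$ matrices; $\succ,\succeq$ denote the positive (semi)definite order; $X^{1/2}$ is the positive semidefinite square root of $X\succeq0$; $X^{-\top}$ is the transpose of the inverse; $\mathcal N(\cdot|\mu,\Sigma)$ is the Gaussian density with mean $\mu$ and covariance $\Sigma\succ0$; $\mathcal H(p)=-\int_{\mathbb R^m}p\log p$ is the entropy of a density $p$. Policies are conditional densities (as such determined only up to null sets). Data: for $k\in[\![0,N-1]\!]$, $A_k\in\mathbb R^{n\times n}$, $B_k\in\mathbb R^{n\times m}$, $S_k\in\mathbb R^{n\times m}$, $Q_k\in\mathcal S^n$ (and $R_k\equiv I$, $\varepsilon=1$); $\bar A_k:=A_k-B_kS_k^\top$, $\bar Q_k:=Q_k-S_kS_k^\top$, with $\bar Q_k\succeq0$, and $\bar Q_N:=0$; $G_k:=B_kB_k^\top$; $\bar\Sigma_0,\bar\Sigma_N\in\mathcal S^n$ are positive definite. Backward MaxEnt density control problem: find a policy $\varpi=\{\varpi_k\}_{k=N-1,\dots,0}$ minimizing $$\mathbb E\Bigl[\sum_{k=1}^{N}\Bigl(\tfrac12\xi_k^\top\bar Q_k\xi_k+\tfrac12\|v_{k-1}\|^2-\mathcal H(\varpi_{k-1}(\cdot|\xi_k))\Bigr)\Bigr]$$ subject to $\xi_k=\bar A_k^{-1}\xi_{k+1}-\bar A_k^{-1}B_kv_k$, $v_k\sim\varpi_k(\cdot|\xi_{k+1})$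 given $\xi_{k+1}$ ($k=N-1,\dots,0$), and $\xi_N\sim\mathcal N(0,\bar\Sigma_N)$, $\xi_0\sim\mathcal N(0,\bar\Sigma_0)$, where $\varpi_k(\cdot|\xi_{k+1})$ is the conditional density of $v_k$ given $\xi_{k+1}$. Forward MaxEnt density control problem: find a policy $\pi=\{\pi_k\}_{k=0}^{N-1}$ minimizing $$\mathbb E\Bigl[\sum_{k=0}^{N-1}\Bigl(\tfrac12\begin{bmatrix}x_k\\ u_k\end{bmatrix}^\top\begin{bmatrix}Q_k&S_k\\ S_k^\top&I\end{bmatrix}\begin{bmatrix}x_k\\ u_k\end{bmatrix}-\mathcal H(\pi_k(\cdot|h_k))\Bigr)\Bigr]$$ subject to $x_{k+1}=A_kx_k+B_ku_k$, $u_k\sim\pi_k(\cdot|h_k)$ given $h_k=\{x_0,u_0,\dots,x_{k-1},u_{k-1},x_k\}$, $x_0\sim\mathcal N(0,\bar\Sigma_0)$, $x_N\sim\mathcal N(0,\bar\Sigma_N)$. Its unique optimal policy under (A1), (A2) is $$\pi_k^*(u|x_k)=\mathcal N\bigl(u\,\big|\,-(I+B_k^\top\Pi_{k+1,+}B_k)^{-1}(B_k^\top\Pi_{k+1,+}A_k+S_k^\top)x_k,\ (I+B_k^\top\Pi_{k+1,+}B_k)^{-1}\bigr),$$ where $\{\Pi_{k,+}\}$ solves $\Pi_k=\bar A_k^\top\Pi_{k+1}\bar A_k-\bar A_k^\top\Pi_{k+1}B_k(I+B_k^\top\Pi_{k+1}B_k)^{-1}B_k^\top\Pi_{k+1}\bar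 A_k+\bar Q_k$ with $\Pi_N=Y_{N,+}$; $\{x_k^*\}$ is the state process under this policy. Transition matrices: $M_k:=\begin{bmatrix}\bar A_k+G_k\bar A_k^{-\top}\bar Q_k&-G_k\bar A_k^{-\top}\\ -\bar A_k^{-\top}\bar Q_k&\bar A_k^{-\top}\end{bmatrix}$ (invertible); $\Phi_M(k,l):=M_{k-1}\cdots M_l$ if $k>l$, $I$ if $k=l$, $M_k^{-1}M_{k+1}^{-1}\cdots M_{l-1}^{-1}$ if $k<l$; $\Phi_{ij}(k,l)$ are its $n\times n$ blocks and $\varphi_{ij}:=\Phi_{ij}(0,N)$. $\Phi_{\bar A}(k,l)$ is defined in the same way from $\{\bar A_k\}$, and $$Y_{N,+}:=-\varphi_{12}^{-1}\varphi_{11}+\bar\Sigma_N^{-1/2}\Bigl(\tfrac14I+\bar\Sigma_N^{1/2}\varphi_{12}^{-1}\bar\Sigma_0\varphi_{12}^{-\top}\bar\Sigma_N^{1/2}\Bigr)^{1/2}\bar\Sigma_N^{-1/2}+\tfrac12\bar\Sigma_N^{-1}.$$ Reachability Gramian: $\mathcal R(k_1,k_0):=\sum_{k=k_0}^{k_1-1}\Phi_{\bar A}(k_1,k+1)G_k\Phi_{\bar A}(k_1,k+1)^\top$ (empty sum $=0$ if $k_1=k_0$). Under (A1), (A2), $\varphi_{12}$ is invertible and the solutions $\{\Pi_{k,+}\}$, $\{H_{k,+}\}$ exist on $[\![0,N]\!]$. *)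

theory Defs
  imports "HOL-Probability.Probability"
begin

text \<open>Matrices with \<open>r\<close> rows and \<open>c\<close> columns have type \<open>real^'c^'r\<close>.\<close>

definition psd :: "real^'n^'n \<Rightarrow> bool" where
  "psd X \<longleftrightarrow> transpose X = X \<and> (\<forall>x. 0 \<le> x \<bullet> (X *v x))"

definition pos_def :: "real^'n^'n \<Rightarrow> bool" where
  "pos_def X \<longleftrightarrow> transpose X = X \<and> (\<forall>x. x \<noteq> 0 \<longrightarrow> 0 < x \<bullet> (X *v x))"

definition psd_sqrt :: "real^'n^'n \<Rightarrow> real^'n^'n" where
  "psd_sqrt X = (THE Y. psd Y \<and> Y ** Y = X)"

definition block_vec :: "real^'a \<Rightarrow> real^'b \<Rightarrow> real^('a + 'b)" where
  "block_vec x y = (\<chi> i. case i of Inl j \<Rightarrow> x $ j | Inr j \<Rightarrow> y $ j)"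

definition block_mat ::
  "real^'c^'a \<Rightarrow> real^'d^'a \<Rightarrow> real^'c^'b \<Rightarrow> real^'d^'b \<Rightarrow> real^('c + 'd)^('a + 'b)" where
  "block_mat X11 X12 X21 X22 =
     (\<chi> i. case i of Inl j \<Rightarrow> block_vec (X11 $ j) (X12 $ j) | Inr j \<Rightarrow> block_vec (X21 $ j) (X22 $ j))"

definition block11 :: "real^('n + 'n)^('n + 'n) \<Rightarrow> real^'n^'n" where
  "block11 X = (\<chi> i j. X $ Inl i $ Inl j)"

definition block12 :: "real^('n + 'n)^('n + 'n) \<Rightarrow> real^'n^'n" where
  "block12 X = (\<chi> i j. X $ Inl i $ Inr j)"

text \<open>\<open>desc_prod F l j\<close> is \<open>F (l+j-1) ** \<dots> ** F l\<close>, and \<open>inv_prod F k j\<close> is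
  \<open>matrix_inv (F k) ** \<dots> ** matrix_inv (F (k+j-1))\<close>.\<close>

primrec desc_prod :: "(nat \<Rightarrow> real^'d^'d) \<Rightarrow> nat \<Rightarrow> nat \<Rightarrow> real^'d^'d" where
  "desc_prod F l 0 = mat 1"
| "desc_prod F l (Suc j) = F (l + j) ** desc_prod F l j"

primrec inv_prod :: "(nat \<Rightarrow> real^'d^'d) \<Rightarrow> nat \<Rightarrow> nat \<Rightarrow> real^'d^'d" where
  "inv_prod F k 0 = mat 1"
| "inv_prod F k (Suc j) = inv_prod F k j ** matrix_inv (F (k + j))"

definition transition :: "(nat \<Rightarrow> real^'d^'d) \<Rightarrow> nat \<Rightarrow> nat \<Rightarrow> real^'d^'d" where
  "transition F k l = (if l \<le> k then desc_prod F l (k - l) else inv_prod F k (l - k))"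

definition Abar :: "(nat \<Rightarrow> real^'n^'n) \<Rightarrow> (nat \<Rightarrow> real^'m^'n) \<Rightarrow> (nat \<Rightarrow> real^'m^'n) \<Rightarrow> nat \<Rightarrow> real^'n^'n" where
  "Abar A B S k = A k - B k ** transpose (S k)"

definition Qbar :: "nat \<Rightarrow> (nat \<Rightarrow> real^'m^'n) \<Rightarrow> (nat \<Rightarrow> real^'n^'n) \<Rightarrow> nat \<Rightarrow> real^'n^'n" where
  "Qbar N S Q k = (if k < N then Q k - S k ** transpose (S k) else 0)"

definition Gmat :: "(nat \<Rightarrow> real^'m^'n) \<Rightarrow> nat \<Rightarrow> real^'n^'n" where
  "Gmat B k = B k ** transpose (B k)"

definition gramian ::
  "(nat \<Rightarrow> real^'n^'n) \<Rightarrow> (nat \<Rightarrow> real^'m^'n) \<Rightarrow> (nat \<Rightarrow> real^'m^'n) \<Rightarrow> nat \<Rightarrow> nat \<Rightarrow> real^'n^'n" where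
  "gramian A B S k1 k0 = (\<Sum>k = k0..<k1.
     transition (Abar A B S) k1 (k + 1) ** Gmat B k ** transpose (transition (Abar A B S) k1 (k + 1)))"

definition Mmat ::
  "nat \<Rightarrow> (nat \<Rightarrow> real^'n^'n) \<Rightarrow> (nat \<Rightarrow> real^'m^'n) \<Rightarrow> (nat \<Rightarrow> real^'m^'n) \<Rightarrow> (nat \<Rightarrow> real^'n^'n)
    \<Rightarrow> nat \<Rightarrow> real^('n + 'n)^('n + 'n)" where
  "Mmat N A B S Q k =
     (let AT = transpose (matrix_inv (Abar A B S k)); Qk = Qbar N S Q k; Gk = Gmat B k
      in block_mat (Abar A B S k + Gk ** AT ** Qk) (- (Gk ** AT))
                   (- (AT ** Qk))                  AT)"

definition Y_plus ::
  "nat \<Rightarrow> (nat \<Rightarrow> real^'n^'n) \<Rightarrow> (nat \<Rightarrow> real^'m^'n) \<Rightarrow> (nat \<Rightarrow> real^'m^'n) \<Rightarrow> (nat \<Rightarrow> real^'n^'n)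
    \<Rightarrow> real^'n^'n \<Rightarrow> real^'n^'n \<Rightarrow> real^'n^'n" where
  "Y_plus N A B S Q \<Sigma>0 \<Sigma>N =
     (let \<phi>11 = block11 (transition (Mmat N A B S Q) 0 N);
          \<phi>12 = block12 (transition (Mmat N A B S Q) 0 N);
          R = psd_sqrt \<Sigma>N
      in - (matrix_inv \<phi>12 ** \<phi>11)
         + matrix_inv R
             ** psd_sqrt ((1/4) *\<^sub>R mat 1
                  + R ** matrix_inv \<phi>12 ** \<Sigma>0 ** transpose (matrix_inv \<phi>12) ** R)
             ** matrix_inv R
         + (1/2) *\<^sub>R matrix_inv \<Sigma>N)"

definition gaussian_density :: "real^'d \<Rightarrow> real^'d^'d \<Rightarrow> real^'d \<Rightarrow> real" where
  "gaussian_density \<mu> \<Sigma> x =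
     exp (- (1/2) * ((x - \<mu>) \<bullet> (matrix_inv \<Sigma> *v (x - \<mu>)))) / sqrt ((2 * pi) ^ CARD('d) * det \<Sigma>)"

definition is_gaussian :: "'w measure \<Rightarrow> ('w \<Rightarrow> real^'d) \<Rightarrow> real^'d \<Rightarrow> real^'d^'d \<Rightarrow> bool" where
  "is_gaussian M X \<mu> \<Sigma> \<longleftrightarrow>
     pos_def \<Sigma> \<and> distributed M lborel X (\<lambda>x. ennreal (gaussian_density \<mu> \<Sigma> x))"

text \<open>Expectation of an extended-real random variable as the expectation of the positive part minus
  that of the negative part. In \<^typ>\<open>ereal\<close>, \<open>\<infinity> - \<infinity> = \<infinity>\<close>, so an undefined value counts as \<open>\<infinity>\<close>.
  (The Bochner integral would return 0 for every non-integrable function, which would make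
  policies of infinite cost look cheap.)\<close>

definition ext_integral :: "'a measure \<Rightarrow> ('a \<Rightarrow> ereal) \<Rightarrow> ereal" where
  "ext_integral M f =
     enn2ereal (\<integral>\<^sup>+ x. e2ennreal (f x) \<partial>M) - enn2ereal (\<integral>\<^sup>+ x. e2ennreal (- f x) \<partial>M)"

definition diff_entropy :: "(real^'m \<Rightarrow> real) \<Rightarrow> ereal" where
  "diff_entropy p = - ext_integral lborel (\<lambda>u. ereal (p u * ln (p u)))"

definition cond_density :: "'y measure \<Rightarrow> ('y \<Rightarrow> real^'m \<Rightarrow> real) \<Rightarrow> bool" where
  "cond_density Y p \<longleftrightarrow>
     case_prod p \<in> borel_measurable (Y \<Otimes>\<^sub>M borel) \<and>
     (\<forall>y \<in> space Y. (\<forall>u. 0 \<le> p y u) \<and> (\<integral>\<^sup>+ u. ennreal (p y u) \<partial>lborel) = 1)"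

text \<open>On the probability space \<open>M\<close>, \<open>p y\<close> is the conditional density of \<open>U\<close> given \<open>Z = y\<close>, where
  \<open>Z\<close> takes values in the measurable space \<open>Y\<close>.\<close>

definition has_cond_density ::
  "'w measure \<Rightarrow> 'y measure \<Rightarrow> ('w \<Rightarrow> 'y) \<Rightarrow> ('w \<Rightarrow> real^'m) \<Rightarrow> ('y \<Rightarrow> real^'m \<Rightarrow> real) \<Rightarrow> bool" where
  "has_cond_density M Y Z U p \<longleftrightarrow>
     distributed M (distr M Y Z \<Otimes>\<^sub>M lborel) (\<lambda>\<omega>. (Z \<omega>, U \<omega>)) (\<lambda>(y, u). ennreal (p y u))"

text \<open>The processes below may live on an arbitrary probability space. In an optimization problem
  competing realizations range over probability measures on the path type \<open>('n, 'm) path\<close>, on which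
  every pair of a state and a control process can be realized in law.\<close>

type_synonym ('n, 'm) path = "(nat \<Rightarrow> real^'n) \<times> (nat \<Rightarrow> real^'m)"

type_synonym ('n, 'm) backward_policy = "nat \<Rightarrow> real^'n \<Rightarrow> real^'m \<Rightarrow> real"

definition backward_process ::
  "nat \<Rightarrow> (nat \<Rightarrow> real^'n^'n) \<Rightarrow> (nat \<Rightarrow> real^'m^'n) \<Rightarrow> (nat \<Rightarrow> real^'m^'n) \<Rightarrow> real^'n^'n
    \<Rightarrow> ('n, 'm) backward_policy \<Rightarrow> 'w measure \<Rightarrow> (nat \<Rightarrow> 'w \<Rightarrow> real^'n) \<Rightarrow> (nat \<Rightarrow> 'w \<Rightarrow> real^'m) \<Rightarrow> bool" where
  "backward_process N A B S \<Sigma>N w M \<xi> v \<longleftrightarrow>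
     prob_space M \<and>
     (\<forall>k\<le>N. \<xi> k \<in> borel_measurable M) \<and> (\<forall>k<N. v k \<in> borel_measurable M) \<and>
     (\<forall>k<N. cond_density borel (w k)) \<and>
     is_gaussian M (\<xi> N) 0 \<Sigma>N \<and>
     (\<forall>k<N. AE \<omega> in M. \<xi> k \<omega> =
        matrix_inv (Abar A B S k) *v \<xi> (k + 1) \<omega> - (matrix_inv (Abar A B S k) ** B k) *v v k \<omega>) \<and>
     (\<forall>k<N. has_cond_density M borel (\<xi> (k + 1)) (v k) (w k))"

text \<open>The expectation of the sum is taken term by term, so that, by the above convention, an infinite
  quadratic term is never cancelled by an infinite entropy.\<close>

definition backward_cost ::
  "nat \<Rightarrow> (nat \<Rightarrow> real^'m^'n) \<Rightarrow> (nat \<Rightarrow> real^'n^'n)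
    \<Rightarrow> ('n, 'm) backward_policy \<Rightarrow> 'w measure \<Rightarrow> (nat \<Rightarrow> 'w \<Rightarrow> real^'n) \<Rightarrow> (nat \<Rightarrow> 'w \<Rightarrow> real^'m) \<Rightarrow> ereal" where
  "backward_cost N S Q w M \<xi> v = (\<Sum>k = 1..N.
     ext_integral M (\<lambda>\<omega>. ereal (1/2 * (\<xi> k \<omega> \<bullet> (Qbar N S Q k *v \<xi> k \<omega>))))
     + ext_integral M (\<lambda>\<omega>. ereal (1/2 * (norm (v (k - 1) \<omega>))\<^sup>2))
     + ext_integral M (\<lambda>\<omega>. - diff_entropy (w (k - 1) (\<xi> k \<omega>))))"

definition backward_feasible ::
  "nat \<Rightarrow> (nat \<Rightarrow> real^'n^'n) \<Rightarrow> (nat \<Rightarrow> real^'m^'n) \<Rightarrow> (nat \<Rightarrow> real^'m^'n) \<Rightarrow> real^'n^'n \<Rightarrow> real^'n^'n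
    \<Rightarrow> ('n, 'm) backward_policy \<Rightarrow> 'w measure \<Rightarrow> (nat \<Rightarrow> 'w \<Rightarrow> real^'n) \<Rightarrow> (nat \<Rightarrow> 'w \<Rightarrow> real^'m) \<Rightarrow> bool" where
  "backward_feasible N A B S \<Sigma>0 \<Sigma>N w M \<xi> v \<longleftrightarrow>
     backward_process N A B S \<Sigma>N w M \<xi> v \<and> is_gaussian M (\<xi> 0) 0 \<Sigma>0"

definition backward_optimal ::
  "nat \<Rightarrow> (nat \<Rightarrow> real^'n^'n) \<Rightarrow> (nat \<Rightarrow> real^'m^'n) \<Rightarrow> (nat \<Rightarrow> real^'m^'n) \<Rightarrow> (nat \<Rightarrow> real^'n^'n)
    \<Rightarrow> real^'n^'n \<Rightarrow> real^'n^'n \<Rightarrow> ('n, 'm) backward_policy \<Rightarrow> bool" where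
  "backward_optimal N A B S Q \<Sigma>0 \<Sigma>N w \<longleftrightarrow>
     (\<exists>(M :: ('n, 'm) path measure) \<xi> v. backward_feasible N A B S \<Sigma>0 \<Sigma>N w M \<xi> v \<and>
       (\<forall>w' (M' :: ('n, 'm) path measure) \<xi>' v'. backward_feasible N A B S \<Sigma>0 \<Sigma>N w' M' \<xi>' v' \<longrightarrow>
          backward_cost N S Q w M \<xi> v \<le> backward_cost N S Q w' M' \<xi>' v'))"

text \<open>Conditional densities are identified when they agree up to null sets.\<close>

definition backward_unique_optimal ::
  "nat \<Rightarrow> (nat \<Rightarrow> real^'n^'n) \<Rightarrow> (nat \<Rightarrow> real^'m^'n) \<Rightarrow> (nat \<Rightarrow> real^'m^'n) \<Rightarrow> (nat \<Rightarrow> real^'n^'n)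
    \<Rightarrow> real^'n^'n \<Rightarrow> real^'n^'n \<Rightarrow> ('n, 'm) backward_policy \<Rightarrow> bool" where
  "backward_unique_optimal N A B S Q \<Sigma>0 \<Sigma>N w \<longleftrightarrow>
     backward_optimal N A B S Q \<Sigma>0 \<Sigma>N w \<and>
     (\<forall>w'. backward_optimal N A B S Q \<Sigma>0 \<Sigma>N w' \<longrightarrow>
        (\<forall>k<N. AE y in lborel. AE u in lborel. w' k y u = w k y u))"

text \<open>The history \<open>h\<^sub>k\<close> consists of the states with index \<open>\<le> k\<close> and the controls with index \<open>< k\<close>.\<close>

definition hist_space :: "nat \<Rightarrow> ('n::finite, 'm::finite) path measure" where
  "hist_space k = (\<Pi>\<^sub>M i\<in>{..k}. borel) \<Otimes>\<^sub>M (\<Pi>\<^sub>M i\<in>{..<k}. borel)"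

definition hist :: "(nat \<Rightarrow> 'w \<Rightarrow> real^'n) \<Rightarrow> (nat \<Rightarrow> 'w \<Rightarrow> real^'m) \<Rightarrow> nat \<Rightarrow> 'w \<Rightarrow> ('n, 'm) path" where
  "hist x u k \<omega> = (\<lambda>i\<in>{..k}. x i \<omega>, \<lambda>i\<in>{..<k}. u i \<omega>)"

type_synonym ('n, 'm) forward_policy = "nat \<Rightarrow> ('n, 'm) path \<Rightarrow> real^'m \<Rightarrow> real"

definition forward_process ::
  "nat \<Rightarrow> (nat \<Rightarrow> real^'n^'n) \<Rightarrow> (nat \<Rightarrow> real^'m^'n) \<Rightarrow> real^'n^'n
    \<Rightarrow> ('n, 'm) forward_policy \<Rightarrow> 'w measure \<Rightarrow> (nat \<Rightarrow> 'w \<Rightarrow> real^'n) \<Rightarrow> (nat \<Rightarrow> 'w \<Rightarrow> real^'m) \<Rightarrow> bool" where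
  "forward_process N A B \<Sigma>0 p M x u \<longleftrightarrow>
     prob_space M \<and>
     (\<forall>k\<le>N. x k \<in> borel_measurable M) \<and> (\<forall>k<N. u k \<in> borel_measurable M) \<and>
     (\<forall>k<N. cond_density (hist_space k) (p k)) \<and>
     is_gaussian M (x 0) 0 \<Sigma>0 \<and>
     (\<forall>k<N. AE \<omega> in M. x (k + 1) \<omega> = A k *v x k \<omega> + B k *v u k \<omega>) \<and>
     (\<forall>k<N. has_cond_density M (hist_space k) (hist x u k) (u k) (p k))"

definition forward_cost ::
  "nat \<Rightarrow> (nat \<Rightarrow> real^'m^'n) \<Rightarrow> (nat \<Rightarrow> real^'n^'n)
    \<Rightarrow> ('n, 'm) forward_policy \<Rightarrow> 'w measure \<Rightarrow> (nat \<Rightarrow> 'w \<Rightarrow> real^'n) \<Rightarrow> (nat \<Rightarrow> 'w \<Rightarrow> real^'m) \<Rightarrow> ereal" where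
  "forward_cost N S Q p M x u = (\<Sum>k<N.
     ext_integral M (\<lambda>\<omega>. ereal (1/2 * (block_vec (x k \<omega>) (u k \<omega>) \<bullet>
       (block_mat (Q k) (S k) (transpose (S k)) (mat 1) *v block_vec (x k \<omega>) (u k \<omega>)))))
     + ext_integral M (\<lambda>\<omega>. - diff_entropy (p k (hist x u k \<omega>))))"

definition forward_feasible ::
  "nat \<Rightarrow> (nat \<Rightarrow> real^'n^'n) \<Rightarrow> (nat \<Rightarrow> real^'m^'n) \<Rightarrow> real^'n^'n \<Rightarrow> real^'n^'n
    \<Rightarrow> ('n, 'm) forward_policy \<Rightarrow> 'w measure \<Rightarrow> (nat \<Rightarrow> 'w \<Rightarrow> real^'n) \<Rightarrow> (nat \<Rightarrow> 'w \<Rightarrow> real^'m) \<Rightarrow> bool" where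
  "forward_feasible N A B \<Sigma>0 \<Sigma>N p M x u \<longleftrightarrow>
     forward_process N A B \<Sigma>0 p M x u \<and> is_gaussian M (x N) 0 \<Sigma>N"

definition forward_optimal ::
  "nat \<Rightarrow> (nat \<Rightarrow> real^'n^'n) \<Rightarrow> (nat \<Rightarrow> real^'m^'n) \<Rightarrow> (nat \<Rightarrow> real^'m^'n) \<Rightarrow> (nat \<Rightarrow> real^'n^'n)
    \<Rightarrow> real^'n^'n \<Rightarrow> real^'n^'n \<Rightarrow> ('n, 'm) forward_policy \<Rightarrow> bool" where
  "forward_optimal N A B S Q \<Sigma>0 \<Sigma>N p \<longleftrightarrow>
     (\<exists>(M :: ('n, 'm) path measure) x u. forward_feasible N A B \<Sigma>0 \<Sigma>N p M x u \<and>
       (\<forall>p' (M' :: ('n, 'm) path measure) x' u'. forward_feasible N A B \<Sigma>0 \<Sigma>N p' M' x' u' \<longrightarrow>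
          forward_cost N S Q p M x u \<le> forward_cost N S Q p' M' x' u'))"

text \<open>The closed-form optimal policy of the forward problem; \<open>fst h k\<close> is the current state.\<close>

definition forward_policy_star ::
  "(nat \<Rightarrow> real^'n^'n) \<Rightarrow> (nat \<Rightarrow> real^'m^'n) \<Rightarrow> (nat \<Rightarrow> real^'m^'n) \<Rightarrow> (nat \<Rightarrow> real^'n^'n)
    \<Rightarrow> ('n, 'm) forward_policy" where
  "forward_policy_star A B S P k h =
     (let W = matrix_inv (mat 1 + transpose (B k) ** P (k + 1) ** B k)
      in gaussian_density (- (W ** (transpose (B k) ** P (k + 1) ** A k + transpose (S k)) *v fst h k)) W)"

definition backward_policy_star ::
  "(nat \<Rightarrow> real^'m^'n) \<Rightarrow> (nat \<Rightarrow> real^'n^'n) \<Rightarrow> ('n, 'm) backward_policy" where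
  "backward_policy_star B H k y =
     gaussian_density (transpose (B k) ** H (k + 1) *v y) (mat 1 - transpose (B k) ** H (k + 1) ** B k)"

definition second_moment :: "'w measure \<Rightarrow> ('w \<Rightarrow> real^'n) \<Rightarrow> real^'n^'n" where
  "second_moment M X = (\<chi> i j. integral\<^sup>L M (\<lambda>\<omega>. X \<omega> $ i * X \<omega> $ j))"

end

theory Submission
  imports Defs
begin

text \<open>
  Two facts carry the proof.

  \<^item> \<^emph>\<open>The cost is a constant plus relative entropies.\<close> For a process of finite cost, completing the
    square in the Riccati equation of \<open>H\<close> writes the stage cost at \<open>k\<close> as a difference of expected
    quadratic forms of \<open>\<xi> (k + 1)\<close> and \<open>\<xi> k\<close>, minus a number, plus the relative entropy of the
    policy in use with respect to the Gaussian policy \<open>backward_policy_star B H\<close>, called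
    \<open>w_star\<close> below. The differences telescope, and what survives depends only on the prescribed laws of \<open>\<xi> 0\<close> and \<open>\<xi> N\<close>, hence is common to all competitors
    (\<open>backward_total_cost\<close>). So \<open>w_star\<close> is optimal as soon as it is feasible. Conversely, for an
    optimal policy all the relative entropies vanish; its process is then also driven by
    \<open>w_star\<close>, its states have positive Gaussian densities, and therefore "almost everywhere for the
    law of the state" means Lebesgue almost everywhere (\<open>backward_unique_optimal_star\<close>).

  \<^item> \<^emph>\<open>The two optimal processes are time reversals of each other.\<close> The sequence \<open>- H\<close> solves the same
    Riccati equation as \<open>P\<close>, with another terminal value. Adding the two completed squares gives an
    identity of quadratic forms (\<open>riccati_exchange_square\<close>) which says that the joint density of
    \<open>(\<xi> (k + 1), v k)\<close>, with \<open>\<xi> (k + 1)\<close> of covariance \<open>(P (k + 1) + H (k + 1))\<^sup>-\<^sup>1\<close> and \<open>v k\<close>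
    chosen by \<open>w_star\<close>, becomes after a linear substitution the joint density of the state \<open>x k\<close> of covariance
    \<open>(P k + H k)\<^sup>-\<^sup>1\<close> and of the shifted control \<open>u k + (S k)\<^sup>T x k\<close> chosen by the optimal forward policy.
    Both processes therefore have states of covariance \<open>(P k + H k)\<^sup>-\<^sup>1\<close>
    (\<open>backward_star_gaussian\<close>, \<open>forward_star_gaussian\<close>). This gives the equality of the laws, and
    also feasibility once \<open>(P 0 + H 0)\<^sup>-\<^sup>1\<close> is known to be the prescribed initial covariance.

  The matrix side has to supply that all conditional covariances are positive definite and that
  \<open>P 0 + H 0\<close> is the inverse of \<open>\<Sigma>0\<close>. Both come from the linear Hamiltonian system attached to the
  Riccati equation. Its trajectories with \<open>x 0 = 0\<close> end with \<open>p N = \<Theta> x N\<close> for a symmetric \<open>\<Theta>\<close>,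
  and \<open>P N\<close> and \<open>- H N\<close> both exceed \<open>\<Theta>\<close> by a positive definite matrix (\<open>boundary_weights\<close>).
  Subtracting such a trajectory from a controlled one shows that the quadratic cost with terminal
  weight \<open>P N\<close>, or \<open>- H N\<close>, is positive for every nonzero control started at zero
  (\<open>energy_positive\<close>), and testing this with a single impulse followed by optimal feedback gives
  positive definiteness of \<open>I + B\<^sup>T P B\<close> and \<open>I - B\<^sup>T H B\<close> (\<open>riccati_input_weight_pos_def\<close>). The invariance of the
  symplectic form along the flow transports the identity for the terminal values to time \<open>0\<close>
  (\<open>riccati_pairI\<close>).

  For an optimal forward policy the relative entropies are first seen to vanish on the realization that
  witnesses its optimality. Since a policy determines the law of the history, every process driven by it is
  also driven by the closed-form policy (\<open>forward_optimal_process\<close>).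
\<close>

section \<open>Symmetric matrices and square roots\<close>

text \<open>
  The normal form \<open>transpose A *v x\<close> is kept throughout, so that adjoints can be moved across inner
  products by \<open>inner_transpose\<close> without passing through row vectors.
\<close>
declare transpose_matrix_vector [simp del] vector_transpose_matrix [simp del]

lemma inner_transpose:
  fixes A :: "real^'n^'m"
  shows "(transpose A *v x) \<bullet> y = x \<bullet> (A *v y)"
  by (simp add: transpose_matrix_vector dot_lmul_matrix)

lemma inner_matrix_left:
  fixes A :: "real^'n^'m"
  shows "(A *v x) \<bullet> y = x \<bullet> (transpose A *v y)"
  by (metis inner_transpose transpose_transpose)

lemma matrix_eqI_inner:
  fixes A B :: "real^'n^'m"
  assumes "\<And>x y. x \<bullet> (A *v y) = x \<bullet> (B *v y)"
  shows "A = B"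
  by (simp add: matrix_eq) (metis assms inner_eq_zero_iff inner_diff_right right_minus_eq)

lemma matrix_inv_mult:
  fixes A :: "real^'n^'n"
  assumes "invertible A"
  shows "A ** matrix_inv A = mat 1" "matrix_inv A ** A = mat 1"
  using someI_ex[OF assms[unfolded invertible_def]] by (auto simp: matrix_inv_def)

lemma matrix_inv_vector:
  fixes A :: "real^'n^'n"
  assumes "invertible A"
  shows "A *v (matrix_inv A *v x) = x" "matrix_inv A *v (A *v x) = x"
  by (simp_all add: matrix_vector_mul_assoc matrix_inv_mult[OF assms])

lemma matrix_inv_eqI:
  fixes A B :: "real^'n^'n"
  assumes "A ** B = mat 1"
  shows "invertible A" "matrix_inv A = B"
proof -
  show i: "invertible A" using assms invertible_right_inverse by blast
  show "matrix_inv A = B"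
    by (metis assms i matrix_inv_mult(2) matrix_mul_assoc matrix_mul_lid matrix_mul_rid)
qed

lemma invertible_matrix_inv:
  fixes A :: "real^'n^'n"
  shows "invertible A \<Longrightarrow> invertible (matrix_inv A)"
  by (meson matrix_inv_eqI(1) matrix_inv_mult(2))

lemma matrix_inv_inv:
  fixes A :: "real^'n^'n"
  shows "invertible A \<Longrightarrow> matrix_inv (matrix_inv A) = A"
  by (meson matrix_inv_eqI(2) matrix_inv_mult(2))

lemma transpose_matrix_inv:
  fixes A :: "real^'n^'n"
  assumes "invertible A"
  shows "transpose (matrix_inv A) = matrix_inv (transpose A)"
  by (metis assms matrix_inv_eqI(2) matrix_inv_mult(2) matrix_transpose_mul transpose_mat)

lemma invertible_iff_ker:
  fixes A :: "real^'n^'n"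
  shows "invertible A \<longleftrightarrow> (\<forall>x. A *v x = 0 \<longrightarrow> x = 0)"
  using matrix_left_invertible_ker invertible_left_inverse by blast

lemma pos_def_invertible: "pos_def X \<Longrightarrow> invertible X"
  unfolding pos_def_def invertible_iff_ker by (metis inner_zero_right less_irrefl)

lemma pos_def_sym: "pos_def X \<Longrightarrow> transpose X = X" by (simp add: pos_def_def)

lemma pos_defD: "pos_def X \<Longrightarrow> x \<noteq> 0 \<Longrightarrow> 0 < x \<bullet> (X *v x)" by (simp add: pos_def_def)

lemma pos_def_nonneg: "pos_def X \<Longrightarrow> 0 \<le> x \<bullet> (X *v x)"
  by (metis pos_defD inner_zero_left less_eq_real_def)

lemma pos_def_psd: "pos_def X \<Longrightarrow> psd X"
  by (simp add: psd_def pos_def_sym pos_def_nonneg)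

lemma inner_sym_matrix:
  fixes X :: "real^'n^'n"
  assumes "transpose X = X"
  shows "x \<bullet> (X *v y) = y \<bullet> (X *v x)"
  by (metis assms inner_commute inner_transpose)

lemma pos_def_matrix_inv:
  assumes "pos_def X" shows "pos_def (matrix_inv X)"
  unfolding pos_def_def
proof (intro conjI allI impI)
  have i: "invertible X" using assms pos_def_invertible by blast
  show "transpose (matrix_inv X) = matrix_inv X"
    by (simp add: transpose_matrix_inv i pos_def_sym assms)
  fix x :: "real^'a" assume x: "x \<noteq> 0"
  let ?y = "matrix_inv X *v x"
  have "x = X *v ?y" by (simp add: matrix_inv_vector i)
  then have "?y \<noteq> 0" using x by auto
  from pos_defD[OF assms this] show "0 < x \<bullet> ?y"
    using \<open>x = X *v ?y\<close> by (simp add: inner_commute)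
qed

lemma pos_def_congruence:
  fixes C :: "real^'n^'n"
  assumes "pos_def X" "invertible C"
  shows "pos_def (transpose C ** X ** C)"
  unfolding pos_def_def
proof (intro conjI allI impI)
  show "transpose (transpose C ** X ** C) = transpose C ** X ** C"
    by (simp add: matrix_transpose_mul pos_def_sym assms matrix_mul_assoc)
  fix x :: "real^'n" assume "x \<noteq> 0"
  then have "C *v x \<noteq> 0" using assms(2) invertible_iff_ker by blast
  from pos_defD[OF assms(1) this] show "0 < x \<bullet> ((transpose C ** X ** C) *v x)"
    by (simp add: matrix_vector_mul_assoc[symmetric] inner_matrix_left)
qed

lemma nonneg_quadratic_imp_linear_zero:
  fixes b c :: real
  assumes "\<And>t. 0 \<le> 2 * t * b + t^2 * c"
  shows "b = 0"
proof (rule ccontr)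
  assume b: "b \<noteq> 0"
  \<comment> \<open>at \<open>t = - b / s\<close> the linear term outweighs the quadratic one as soon as \<open>s > c / 2\<close>\<close>
  define s where "s = \<bar>c\<bar> + 1"
  have s: "s > 0" "c < s" by (auto simp: s_def)
  have "0 \<le> 2 * (- b / s) * b + (- b / s)^2 * c" by (rule assms)
  also have "\<dots> = (b^2 / s^2) * (c - 2 * s)" using s by (simp add: field_simps power2_eq_square)
  also have "\<dots> < 0" using b s by (intro mult_pos_neg) auto
  finally show False by simp
qed

text \<open>
  A maximizer \<open>e\<close> of the quadratic form on the unit sphere of \<open>W\<close> is an eigenvector: with \<open>l\<close> the
  maximum, \<open>l |y|\<^sup>2 - y \<bullet> A y\<close> is a nonnegative form on \<open>W\<close> that vanishes at \<open>e\<close>, so its linear part at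
  \<open>e\<close> vanishes as well.
\<close>
lemma symmetric_eigenvector_in_subspace:
  fixes A :: "real^'n^'n"
  assumes sym: "transpose A = A" and W: "subspace W" and inv: "\<And>w. w \<in> W \<Longrightarrow> A *v w \<in> W"
    and ne: "W \<noteq> {0}"
  obtains e l where "e \<in> W" "norm e = 1" "A *v e = l *\<^sub>R e"
proof -
  let ?K = "W \<inter> sphere 0 1"
  obtain w where w: "w \<in> W" "w \<noteq> 0" using ne W subspace_0 by blast
  have "(1 / norm w) *\<^sub>R w \<in> ?K" using w W by (auto simp: subspace_scale)
  then have "?K \<noteq> {}" by blast
  moreover have "compact ?K" using W by (intro closed_Int_compact closed_subspace) auto
  moreover have "continuous_on ?K (\<lambda>x. x \<bullet> (A *v x))"
    by (intro continuous_intros matrix_vector_mult_linear_continuous_on)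
  ultimately have "\<exists>e\<in>?K. \<forall>y\<in>?K. y \<bullet> (A *v y) \<le> e \<bullet> (A *v e)"
    using continuous_attains_sup[of ?K "\<lambda>x. x \<bullet> (A *v x)"] by blast
  then obtain e where e: "e \<in> ?K" and max: "\<And>y. y \<in> ?K \<Longrightarrow> y \<bullet> (A *v y) \<le> e \<bullet> (A *v e)"
    by blast
  define l where "l = e \<bullet> (A *v e)"
  define q where "q y = l * (y \<bullet> y) - y \<bullet> (A *v y)" for y
  have ee: "e \<bullet> e = 1" "e \<in> W" using e by (auto simp: dot_square_norm)
  have q0: "0 \<le> q y" if "y \<in> W" for y
  proof (cases "y = 0")
    case False
    then have "(1 / norm y) *\<^sub>R y \<in> ?K" using that W by (auto simp: subspace_scale)
    from max[OF this] have "(y \<bullet> (A *v y)) / (norm y)^2 \<le> l"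
      by (simp add: l_def matrix_vector_mult_scaleR power2_eq_square)
    then show ?thesis using False by (simp add: q_def field_simps dot_square_norm)
  qed (simp add: q_def)
  have "(l *\<^sub>R e - A *v e) \<bullet> y = 0" if y: "y \<in> W" for y
  proof (rule nonneg_quadratic_imp_linear_zero[of _ "q y"])
    fix t :: real
    have "0 \<le> q (e + t *\<^sub>R y)" using y ee W by (intro q0) (auto intro: subspace_add subspace_scale)
    also have "\<dots> = 2 * t * ((l *\<^sub>R e - A *v e) \<bullet> y) + t^2 * q y"
      using inner_sym_matrix[OF sym, of e y] ee
      by (simp add: q_def algebra_simps inner_add inner_diff power2_eq_square l_def
          matrix_vector_mult_scaleR inner_commute)
    finally show "0 \<le> 2 * t * ((l *\<^sub>R e - A *v e) \<bullet> y) + t^2 * q y" .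
  qed
  moreover have "l *\<^sub>R e - A *v e \<in> W"
    using ee W inv by (auto intro!: subspace_diff subspace_scale)
  ultimately have "A *v e = l *\<^sub>R e" by (metis inner_eq_zero_iff right_minus_eq)
  moreover have "norm e = 1" using e by auto
  ultimately show ?thesis using that ee by blast
qed

definition diag :: "('n \<Rightarrow> real) \<Rightarrow> real^'n^'n" where
  "diag d = (\<chi> i j. if i = j then d i else 0)"

lemma diag_mult: "diag d *v x = (\<chi> i. d i * x $ i)"
  by (simp add: diag_def matrix_vector_mult_def if_distrib if_distribR cong: if_cong)

text \<open>
  An orthonormal set of eigenvectors of maximal size spans: its orthogonal complement is invariant
  under a symmetric matrix, so that otherwise one more eigenvector could be found there.
\<close>
lemma symmetric_orthonormal_eigenbasis:
  fixes A :: "real^'n^'n"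
  assumes sym: "transpose A = A"
  obtains E where "pairwise orthogonal E" "\<forall>e\<in>E. norm e = 1 \<and> (\<exists>l. A *v e = l *\<^sub>R e)"
    "independent E" "span E = UNIV" "card E = CARD('n)"
proof -
  define good where "good E \<longleftrightarrow> pairwise orthogonal E \<and> (\<forall>e\<in>E. norm e = 1 \<and> (\<exists>l. A *v e = l *\<^sub>R e))"
    for E :: "(real^'n) set"
  have ind: "independent E" if "good E" for E
    using that by (intro pairwise_orthogonal_independent) (auto simp: good_def)
  have bound: "card E \<le> CARD('n)" if "good E" for E
    using independent_bound[OF ind[OF that]] by simp
  have "good {}" by (simp add: good_def)
  then have "\<exists>E. good E \<and> (\<forall>F. good F \<longrightarrow> card F \<le> card E)"
    using bound by (intro ex_has_greatest_nat[of good "{}" card "CARD('n) + 1"]) (auto simp: less_Suc_eq_le)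
  then obtain E where E: "good E" and mx: "\<And>F. good F \<Longrightarrow> card F \<le> card E" by blast
  have fin: "finite E" using independent_bound[OF ind[OF E]] by simp
  have "span E = UNIV"
  proof (rule ccontr)
    assume ne: "span E \<noteq> UNIV"
    let ?W = "(span E)\<^sup>\<bottom>"
    have "?W \<noteq> {0}"
      using orthogonal_comp_self[of "span E"] orthogonal_comp_null ne by force
    moreover have "A *v w \<in> ?W" if "w \<in> ?W" for w
    proof -
      have "e \<bullet> (A *v w) = 0" if "e \<in> E" for e
        using that E \<open>w \<in> ?W\<close> inner_sym_matrix[OF sym, of e w]
        by (force simp: good_def orthogonal_comp_def orthogonal_def span_base inner_commute)
      then have "\<forall>y\<in>span E. y \<bullet> (A *v w) = 0"
        by (metis orthogonal_def orthogonal_commute orthogonal_to_span)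
      then show ?thesis by (auto simp: orthogonal_comp_def orthogonal_def)
    qed
    ultimately obtain e l where e: "e \<in> ?W" "norm e = 1" "A *v e = l *\<^sub>R e"
      using symmetric_eigenvector_in_subspace[OF sym subspace_orthogonal_comp[of "span E"]] by metis
    have orth: "orthogonal x e" if "x \<in> E" for x
      using e that span_base by (fastforce simp: orthogonal_comp_def)
    have "e \<notin> E" using orth[of e] e by (auto simp: orthogonal_def)
    moreover have "good (insert e E)"
      using E e orth by (auto simp: good_def pairwise_insert orthogonal_commute)
    ultimately show False using mx[of "insert e E"] fin by simp
  qed
  moreover have "card E = CARD('n)"
    using basis_card_eq_dim[of E UNIV] ind[OF E] \<open>span E = UNIV\<close> by simp
  ultimately show ?thesis using that E ind[OF E] by (auto simp: good_def)
qed

lemma spectral_theorem: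
  fixes A :: "real^'n^'n"
  assumes sym: "transpose A = A"
  obtains U d where "orthogonal_matrix U" "A = U ** diag d ** transpose U"
proof -
  obtain E where E: "pairwise orthogonal E" "\<forall>e\<in>E. norm e = 1 \<and> (\<exists>l. A *v e = l *\<^sub>R e)"
    "independent E" "span E = UNIV" "card E = CARD('n)"
    using symmetric_orthonormal_eigenbasis[OF sym] by blast
  have "finite E" using independent_bound[OF E(3)] by simp
  then obtain e where e: "bij_betw e (UNIV::'n set) E"
    using E(5) finite_same_card_bij[of "UNIV::'n set" E] by auto
  have eE: "e i \<in> E" for i using e by (auto simp: bij_betw_def)
  then have "\<forall>i. \<exists>l. A *v e i = l *\<^sub>R e i" using E(2) by blast
  from choice[OF this] obtain d where d: "\<And>i. A *v e i = d i *\<^sub>R e i" by blast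
  define U where "U = transpose (\<chi> i. e i)"
  have col: "column i U = e i" for i by (simp add: U_def row_def vec_eq_iff)
  have "orthogonal_matrix U"
    unfolding orthogonal_matrix_orthonormal_columns col
    using E(1,2) eE e by (auto simp: pairwise_def bij_betw_def inj_on_def) metis
  moreover have "A ** U = U ** diag d"
  proof -
    have "(A ** U) $ a $ i = (U ** diag d) $ a $ i" for a i
    proof -
      have "(A ** U) $ a $ i = (A *v e i) $ a"
        by (simp add: U_def matrix_matrix_mult_def matrix_vector_mult_def transpose_def)
      also have "\<dots> = d i * e i $ a" by (simp add: d)
      also have "\<dots> = (U ** diag d) $ a $ i"
        by (simp add: U_def matrix_matrix_mult_def diag_def transpose_def if_distrib cong: if_cong)
      finally show ?thesis .
    qed
    then show ?thesis by (simp add: vec_eq_iff)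
  qed
  then have "A = U ** diag d ** transpose U"
    using \<open>orthogonal_matrix U\<close> unfolding orthogonal_matrix_def
    by (metis matrix_mul_assoc matrix_mul_rid)
  ultimately show ?thesis using that by blast
qed


lemma orthogonal_column_inner:
  fixes U :: "real^'n^'n"
  assumes "orthogonal_matrix U"
  shows "column i U \<bullet> column i U = 1"
  using assms by (simp add: orthogonal_matrix_orthonormal_columns norm_eq_1)

lemma spectral_eigenvector:
  fixes U :: "real^'n^'n"
  assumes "orthogonal_matrix U"
  shows "(U ** diag d ** transpose U) *v column i U = d i *\<^sub>R column i U"
proof -
  have c: "column i U = U *v axis i 1" by (simp add: matrix_vector_mult_basis)
  have "diag d *v axis i 1 = d i *\<^sub>R axis i (1::real)"
    by (simp add: diag_mult vec_eq_iff axis_def)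
  then have "(U ** diag d ** transpose U ** U) *v axis i 1 = d i *\<^sub>R (U *v axis i 1)"
    using assms by (simp add: orthogonal_matrix_def matrix_mul_assoc[symmetric]
        matrix_vector_mul_assoc[symmetric] matrix_vector_mult_scaleR)
  then show ?thesis by (simp add: c matrix_vector_mul_assoc)
qed

lemma spectral_quadratic:
  fixes U :: "real^'n^'n"
  shows "x \<bullet> ((U ** diag d ** transpose U) *v x) = (\<Sum>i\<in>UNIV. d i * ((transpose U *v x) $ i)^2)"
  by (simp add: matrix_vector_mul_assoc[symmetric] inner_transpose[symmetric] diag_mult
      inner_vec_def[of "transpose U *v x"] power2_eq_square mult_ac)

lemma transpose_spectral:
  fixes U :: "real^'n^'n"
  shows "transpose (U ** diag d ** transpose U) = U ** diag d ** transpose U"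
proof -
  have "transpose (diag d) = diag d" by (auto simp: diag_def transpose_def vec_eq_iff)
  then show ?thesis by (simp add: matrix_transpose_mul matrix_mul_assoc)
qed

lemma spectral_psd:
  fixes U :: "real^'n^'n"
  assumes "\<And>i. 0 \<le> d i"
  shows "psd (U ** diag d ** transpose U)"
  using assms by (auto simp: psd_def transpose_spectral spectral_quadratic intro!: sum_nonneg)

lemma psd_kernel:
  assumes "psd Y" "x \<bullet> (Y *v x) = 0"
  shows "Y *v x = 0"
proof -
  have "y \<bullet> (Y *v x) = 0" for y
  proof (rule nonneg_quadratic_imp_linear_zero[of _ "y \<bullet> (Y *v y)"])
    fix t :: real
    have "0 \<le> (x + t *\<^sub>R y) \<bullet> (Y *v (x + t *\<^sub>R y))" using assms(1) by (simp add: psd_def)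
    also have "\<dots> = 2 * t * (y \<bullet> (Y *v x)) + t\<^sup>2 * (y \<bullet> (Y *v y))"
      using assms inner_sym_matrix[of Y x y]
      by (simp add: psd_def matrix_vector_right_distrib matrix_vector_mult_scaleR inner_add
          power2_eq_square algebra_simps)
    finally show "0 \<le> 2 * t * (y \<bullet> (Y *v x)) + t\<^sup>2 * (y \<bullet> (Y *v y))" .
  qed
  from this[of "Y *v x"] show ?thesis by simp
qed

lemma psd_invertible_pos_def: "psd Y \<Longrightarrow> invertible Y \<Longrightarrow> pos_def Y"
  unfolding pos_def_def using psd_kernel invertible_iff_ker psd_def by (metis less_eq_real_def)

text \<open>
  With \<open>D = Y - Z\<close> one has \<open>D Y + Z D = 0\<close>. Evaluated at a unit eigenvector of \<open>D\<close> with eigenvalue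
  \<open>d\<close>, this says that \<open>d\<close> times the sum of the two nonnegative quadratic forms is \<open>0\<close>, while their difference is
  \<open>d\<close>. Hence all eigenvalues of \<open>D\<close> are \<open>0\<close>.
\<close>
lemma psd_sqrt_unique:
  fixes Y Z :: "real^'n^'n"
  assumes Y: "psd Y" and Z: "psd Z" and eq: "Y ** Y = Z ** Z"
  shows "Y = Z"
proof -
  define D where "D = Y - Z"
  have symD: "transpose D = D"
    using Y Z by (simp add: D_def psd_def transpose_def vec_eq_iff)
  obtain U d where U: "orthogonal_matrix U" and D: "D = U ** diag d ** transpose U"
    using spectral_theorem[OF symD] by blast
  have "d i = 0" for i
  proof -
    let ?e = "column i U"
    have De: "D *v ?e = d i *\<^sub>R ?e" unfolding D by (rule spectral_eigenvector[OF U])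
    have "D *v (Y *v ?e) + Z *v (D *v ?e) = (Y ** Y) *v ?e - (Z ** Z) *v ?e"
      by (simp add: D_def matrix_vector_mult_diff_rdistrib matrix_vector_mult_diff_distrib
          matrix_vector_mul_assoc[symmetric])
    also have "\<dots> = 0" by (simp add: eq)
    finally have "?e \<bullet> (D *v (Y *v ?e)) + ?e \<bullet> (Z *v (D *v ?e)) = 0"
      by (metis inner_add_right inner_zero_right)
    then have *: "d i * (?e \<bullet> (Y *v ?e)) + d i * (?e \<bullet> (Z *v ?e)) = 0"
      using De symD by (simp add: inner_transpose[of D, unfolded symD, symmetric] matrix_vector_mult_scaleR)
    have "?e \<bullet> (Y *v ?e) - ?e \<bullet> (Z *v ?e) = d i"
      using De orthogonal_column_inner[OF U, of i]
      by (simp add: D_def matrix_vector_mult_diff_rdistrib flip: inner_diff_right)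
    moreover have "0 \<le> ?e \<bullet> (Y *v ?e)" "0 \<le> ?e \<bullet> (Z *v ?e)" using Y Z by (auto simp: psd_def)
    ultimately show ?thesis using *
      by (metis add_nonneg_eq_0_iff diff_self distrib_left mult_eq_0_iff)
  qed
  then have "diag d = 0" by (simp add: diag_def vec_eq_iff)
  then have "D = 0" by (simp add: D matrix_matrix_mult_def vec_eq_iff)
  then show ?thesis by (simp add: D_def)
qed

lemma psd_sqrt:
  fixes X :: "real^'n^'n"
  assumes "psd X"
  shows "psd (psd_sqrt X)" "psd_sqrt X ** psd_sqrt X = X"
proof -
  obtain U d where U: "orthogonal_matrix U" and X: "X = U ** diag d ** transpose U"
    using spectral_theorem assms unfolding psd_def by blast
  have d: "0 \<le> d i" for i
  proof -
    have "0 \<le> column i U \<bullet> (X *v column i U)" using assms by (simp add: psd_def)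
    also have "\<dots> = d i"
      unfolding X spectral_eigenvector[OF U] by (simp add: orthogonal_column_inner[OF U])
    finally show ?thesis .
  qed
  let ?Y = "U ** diag (\<lambda>i. sqrt (d i)) ** transpose U"
  have "diag (\<lambda>i. sqrt (d i)) ** diag (\<lambda>i. sqrt (d i)) = diag d"
    using d by (auto simp: matrix_eq diag_mult matrix_vector_mul_assoc[symmetric] vec_eq_iff)
  then have "?Y ** ?Y = X"
    using U by (metis X matrix_mul_assoc matrix_mul_rid orthogonal_matrix_def)
  moreover have "psd ?Y" using d by (intro spectral_psd) auto
  ultimately have "\<exists>!Y. psd Y \<and> Y ** Y = X" using psd_sqrt_unique by metis
  from theI'[OF this] show "psd (psd_sqrt X)" "psd_sqrt X ** psd_sqrt X = X"
    unfolding psd_sqrt_def by auto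
qed

lemma pos_def_psd_sqrt:
  fixes X :: "real^'n^'n"
  assumes "pos_def X"
  shows "pos_def (psd_sqrt X)"
proof (rule psd_invertible_pos_def)
  show "psd (psd_sqrt X)" using psd_sqrt pos_def_psd assms by blast
  show "invertible (psd_sqrt X)"
    unfolding invertible_iff_ker
    by (metis assms psd_sqrt(2) pos_def_psd matrix_vector_mul_assoc matrix_vector_mult_0_right pos_def_invertible invertible_iff_ker)
qed

text \<open>
  Each eigenvalue \<open>d\<close> of \<open>T\<close> is nonnegative and satisfies \<open>d\<^sup>2 > 1/4\<close>. This strict gap is what makes
  the smaller of the two boundary weights below positive definite.
\<close>
lemma sqrt_exceeds_half:
  fixes T E :: "real^'n^'n"
  assumes T: "psd T" and E: "pos_def E" and eq: "T ** T = (1/4) *\<^sub>R mat 1 + E"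
    and x: "x \<noteq> 0"
  shows "1/2 * (x \<bullet> x) < x \<bullet> (T *v x)"
proof -
  obtain U d where U: "orthogonal_matrix U" and Ts: "T = U ** diag d ** transpose U"
    using spectral_theorem T unfolding psd_def by blast
  have d: "1/2 < d i" for i
  proof -
    let ?e = "column i U"
    have e: "?e \<bullet> ?e = 1" by (rule orthogonal_column_inner[OF U])
    have Te: "T *v ?e = d i *\<^sub>R ?e" unfolding Ts by (rule spectral_eigenvector[OF U])
    have "0 \<le> d i" using T Te e by (auto simp: psd_def) (metis Te e inner_scaleR_right mult.right_neutral)
    have "(T ** T) *v ?e = (d i * d i) *\<^sub>R ?e"
      by (simp add: matrix_vector_mul_assoc[symmetric] Te matrix_vector_mult_scaleR)
    then have "d i * d i = ?e \<bullet> ((T ** T) *v ?e)" using e by simp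
    also have "\<dots> = 1/4 + ?e \<bullet> (E *v ?e)"
      unfolding eq by (simp add: matrix_vector_mult_add_rdistrib inner_add e
          flip: scaleR_matrix_vector_assoc)
    also have "\<dots> > (1/2) * (1/2)" using pos_defD[OF E, of ?e] e by force
    finally show ?thesis using \<open>0 \<le> d i\<close> by (smt (verit) mult_mono)
  qed
  let ?y = "transpose U *v x"
  have "x = U *v ?y" using U by (simp add: matrix_vector_mul_assoc orthogonal_matrix_def)
  then have "?y \<noteq> 0" using x by auto
  then obtain i where i: "?y $ i \<noteq> 0" by (auto simp: vec_eq_iff)
  have "x \<bullet> x = ?y \<bullet> ?y"
    using \<open>x = U *v ?y\<close> by (metis inner_transpose)
  also have "\<dots> = (\<Sum>i\<in>UNIV. (?y $ i)^2)" by (simp add: inner_vec_def power2_eq_square)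
  finally have "1/2 * (x \<bullet> x) = (\<Sum>i\<in>UNIV. 1/2 * (?y $ i)^2)" by (simp add: sum_distrib_left)
  also have "\<dots> < (\<Sum>i\<in>UNIV. d i * (?y $ i)^2)"
  proof (rule sum_strict_mono_ex1)
    show "\<forall>i\<in>UNIV. 1/2 * (?y $ i)^2 \<le> d i * (?y $ i)^2"
      by (intro ballI mult_right_mono[OF less_imp_le[OF d]]) simp
    show "\<exists>i\<in>UNIV. 1/2 * (?y $ i)^2 < d i * (?y $ i)^2"
      using d[of i] i by (intro bexI[of _ i] mult_strict_right_mono) simp_all
  qed simp
  also have "\<dots> = x \<bullet> (T *v x)" unfolding Ts spectral_quadratic ..
  finally show ?thesis .
qed

section \<open>The Riccati equation and Hamiltonian trajectories\<close>

definition riccati_map :: "real^'n^'n \<Rightarrow> real^'m^'n \<Rightarrow> real^'n^'n \<Rightarrow> real^'n^'n \<Rightarrow> real^'n^'n" where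
  "riccati_map Ab B Q P = transpose Ab ** P ** Ab
     - transpose Ab ** P ** B ** matrix_inv (mat 1 + transpose B ** P ** B) ** transpose B ** P ** Ab + Q"

text \<open>
  The control weight \<open>I + B\<^sup>T P B\<close> of the one-step problem with cost-to-go \<open>P\<close>. For \<open>P = - H\<close> it is the
  covariance \<open>I - B\<^sup>T H B\<close> of the backward policy.
\<close>
definition input_weight :: "real^'m^'n \<Rightarrow> real^'n^'n \<Rightarrow> real^'m^'m" where
  "input_weight B P = mat 1 + transpose B ** P ** B"

definition lq_gain :: "real^'n^'n \<Rightarrow> real^'m^'n \<Rightarrow> real^'n^'n \<Rightarrow> real^'n^'m" where
  "lq_gain Ab B P = - (matrix_inv (input_weight B P) ** transpose B ** P ** Ab)"

lemma transpose_add: "transpose (A + B) = transpose A + transpose B"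
  by (simp add: transpose_def vec_eq_iff)

lemma transpose_diff: "transpose (A - B) = transpose A - transpose (B :: real^'n^'m)"
  by (simp add: transpose_def vec_eq_iff)

lemma transpose_uminus: "transpose (- A) = - transpose (A :: real^'n^'m)"
  by (simp add: transpose_def vec_eq_iff)

lemma matrix_uminus_mult: "(- A) *v x = - (A *v (x :: real^'n))"
  by (metis diff_0 matrix_vector_mult_0 matrix_vector_mult_diff_rdistrib)

lemma matrix_mult_uminus_vec: "A *v (- x) = - (A *v (x :: real^'n))"
  by (metis diff_0 matrix_vector_mult_0_right matrix_vector_mult_diff_distrib)

lemma matrix_uminus_mult_left: "(- X) ** Y = - (X ** Y)" for X :: "real^'a^'b" and Y :: "real^'c^'a"
  by (simp add: matrix_eq matrix_vector_mul_assoc[symmetric] matrix_uminus_mult matrix_mult_uminus_vec)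

lemma matrix_uminus_mult_right: "Y ** (- X) = - (Y ** X)" for X :: "real^'a^'b" and Y :: "real^'b^'d"
  by (simp add: matrix_eq matrix_vector_mul_assoc[symmetric] matrix_uminus_mult matrix_mult_uminus_vec)

lemma transpose_input_weight:
  assumes "transpose P = P" shows "transpose (input_weight B P) = input_weight B P"
  by (simp add: input_weight_def transpose_add matrix_transpose_mul assms matrix_mul_assoc)

lemma transpose_riccati_map:
  assumes P: "transpose P = P" and Q: "transpose Q = Q" and V: "invertible (input_weight B P)"
  shows "transpose (riccati_map Ab B Q P) = riccati_map Ab B Q P"
  using transpose_matrix_inv[OF V] transpose_input_weight[OF P, of B]
  by (simp add: riccati_map_def transpose_add transpose_diff matrix_transpose_mul P Q matrix_mul_assoc
      input_weight_def)

text \<open>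
  One step of dynamic programming: control energy, cost-to-go of the next state and state cost add up
  to the previous cost-to-go plus a quadratic form in the deviation from the feedback control. All later
  identities about costs and densities are derived from this one.
\<close>
lemma riccati_completing_square:
  fixes Ab :: "real^'n^'n" and B :: "real^'m^'n"
  assumes P: "transpose P = P" and V: "invertible (input_weight B P)"
  shows "v \<bullet> v + (Ab *v x + B *v v) \<bullet> (P *v (Ab *v x + B *v v)) + x \<bullet> (Q *v x)
    = x \<bullet> (riccati_map Ab B Q P *v x)
      + (v - lq_gain Ab B P *v x) \<bullet> (input_weight B P *v (v - lq_gain Ab B P *v x))"
proof -
  let ?W = "input_weight B P"
  define y where "y = Ab *v x"
  define b where "b = transpose B *v (P *v y)"
  define c where "c = matrix_inv ?W *v b"
  have Wc: "?W *v c = b" by (simp add: c_def matrix_inv_vector V)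
  have W: "transpose ?W = ?W" by (rule transpose_input_weight[OF P])
  have g: "v - lq_gain Ab B P *v x = v + c"
    by (simp add: lq_gain_def matrix_uminus_mult c_def b_def y_def matrix_vector_mul_assoc[symmetric])
  have "x \<bullet> (riccati_map Ab B Q P *v x) = y \<bullet> (P *v y) - b \<bullet> c + x \<bullet> (Q *v x)"
    using P by (simp add: riccati_map_def matrix_vector_mult_add_rdistrib matrix_vector_mult_diff_rdistrib
        matrix_vector_mul_assoc[symmetric] inner_add inner_diff y_def b_def c_def input_weight_def
        inner_matrix_left)
  moreover have "(v + c) \<bullet> (?W *v (v + c)) = v \<bullet> (?W *v v) + 2 * (v \<bullet> b) + b \<bullet> c"
    using inner_sym_matrix[OF W, of c v]
    by (simp add: matrix_vector_right_distrib inner_add Wc inner_commute)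
  moreover have "v \<bullet> (?W *v v) = v \<bullet> v + (B *v v) \<bullet> (P *v (B *v v))"
    by (simp add: input_weight_def matrix_vector_mult_add_rdistrib inner_add
        matrix_vector_mul_assoc[symmetric] inner_matrix_left)
  moreover have "(y + B *v v) \<bullet> (P *v (y + B *v v))
      = y \<bullet> (P *v y) + 2 * (v \<bullet> b) + (B *v v) \<bullet> (P *v (B *v v))"
    using inner_sym_matrix[OF P, of "B *v v" y]
    by (simp add: matrix_vector_right_distrib inner_add b_def inner_matrix_left[of B])
  ultimately show ?thesis by (simp add: g y_def[symmetric])
qed

lemma downward_recursion_exists:
  "\<exists>z. z N = a \<and> (\<forall>k<N. z k = f k (z (Suc k)))"
proof (induction N arbitrary: f)
  case (Suc N)
  from Suc[of "\<lambda>k. f (Suc k)"] obtain z where z: "z N = a" "\<forall>k<N. z k = f (Suc k) (z (Suc k))" by blast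
  define y where "y k = (case k of 0 \<Rightarrow> f 0 (z 0) | Suc j \<Rightarrow> z j)" for k
  have "y (Suc N) = a" "\<forall>k<Suc N. y k = f k (y (Suc k))"
    using z by (auto simp: y_def split: nat.split)
  then show ?case by blast
qed auto

text \<open>
  The linear-quadratic data after the substitution \<open>v = u + S\<^sup>T x\<close> has removed the cross term, that is
  \<open>Ab\<close> and \<open>Qb\<close> stand for the matrices \<open>Abar\<close> and \<open>Qbar\<close> of the problem.
\<close>
locale lq_data =
  fixes N :: nat and Ab :: "nat \<Rightarrow> real^'n^'n" and B :: "nat \<Rightarrow> real^'m^'n" and Qb :: "nat \<Rightarrow> real^'n^'n"
  assumes Ab_inv: "k < N \<Longrightarrow> invertible (Ab k)" and Qb_psd: "k < N \<Longrightarrow> psd (Qb k)"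
begin

definition controlled :: "(nat \<Rightarrow> real^'n) \<Rightarrow> (nat \<Rightarrow> real^'m) \<Rightarrow> bool" where
  "controlled x u \<longleftrightarrow> (\<forall>k<N. x (Suc k) = Ab k *v x k + B k *v u k)"

text \<open>
  Stationarity conditions of the linear-quadratic problem with costate \<open>p\<close>, written backward in time
  because the boundary data of the problem are parametrized by their values at \<open>N\<close>.
\<close>
definition hamiltonian :: "(nat \<Rightarrow> real^'n) \<Rightarrow> (nat \<Rightarrow> real^'n) \<Rightarrow> bool" where
  "hamiltonian x p \<longleftrightarrow> (\<forall>k<N. x k = matrix_inv (Ab k) *v (x (Suc k) + Gmat B k *v p (Suc k)) \<and>
     p k = transpose (Ab k) *v p (Suc k) + Qb k *v x k)"

lemma Qb_sym: "k < N \<Longrightarrow> transpose (Qb k) = Qb k"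
  using Qb_psd by (simp add: psd_def)

lemma hamiltonian_exists:
  obtains x p where "hamiltonian x p" "x N = a" "p N = b"
proof -
  define f where "f k z = (let x = matrix_inv (Ab k) *v (fst z + Gmat B k *v snd z)
      in (x, transpose (Ab k) *v snd z + Qb k *v x))" for k z
  obtain z where z: "z N = (a, b)" "\<forall>k<N. z k = f k (z (Suc k))"
    using downward_recursion_exists[of N "(a, b)" f] by blast
  have "hamiltonian (\<lambda>k. fst (z k)) (\<lambda>k. snd (z k))"
    using z(2) by (simp add: hamiltonian_def f_def Let_def)
  then show ?thesis by (rule that) (simp_all add: z(1))
qed

lemma hamiltonian_controlled:
  assumes "hamiltonian x p"
  shows "controlled x (\<lambda>k. - (transpose (B k) *v p (Suc k)))"
  unfolding controlled_def
proof (intro allI impI)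
  fix k assume k: "k < N"
  have "Ab k *v x k = x (Suc k) + Gmat B k *v p (Suc k)"
    using assms k by (simp add: hamiltonian_def matrix_inv_vector Ab_inv)
  then show "x (Suc k) = Ab k *v x k + B k *v (- (transpose (B k) *v p (Suc k)))"
    by (simp add: Gmat_def matrix_vector_mul_assoc[symmetric] matrix_mult_uminus_vec)
qed

text \<open>
  Summation by parts of state against costate: the left side is the cost bilinear form between the Hamiltonian
  trajectory and a controlled one. In particular it vanishes on controlled trajectories with both ends at zero.
\<close>
lemma hamiltonian_duality:
  assumes h: "hamiltonian x p" and c: "controlled y u" and m: "m \<le> N"
  shows "(\<Sum>k<m. - ((transpose (B k) *v p (Suc k)) \<bullet> u k) + x k \<bullet> (Qb k *v y k)) = p 0 \<bullet> y 0 - p m \<bullet> y m"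
  using m
proof (induction m)
  case (Suc m)
  then have m: "m < N" by simp
  have "p m \<bullet> y m = p (Suc m) \<bullet> (Ab m *v y m) + x m \<bullet> (Qb m *v y m)"
    using h m by (simp add: hamiltonian_def inner_add inner_matrix_left Qb_sym)
  moreover have "y (Suc m) = Ab m *v y m + B m *v u m" using c m by (simp add: controlled_def)
  ultimately have "p m \<bullet> y m - p (Suc m) \<bullet> y (Suc m)
      = - ((transpose (B m) *v p (Suc m)) \<bullet> u m) + x m \<bullet> (Qb m *v y m)"
    by (simp add: inner_add inner_transpose)
  then show ?case using Suc by simp
qed simp

lemma hamiltonian_symplectic:
  assumes h: "hamiltonian x p" and h': "hamiltonian y q"
  shows "p 0 \<bullet> y 0 - q 0 \<bullet> x 0 = p N \<bullet> y N - q N \<bullet> x N"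
proof -
  have "(\<Sum>k<N. - ((transpose (B k) *v p (Suc k)) \<bullet> (- (transpose (B k) *v q (Suc k)))) + x k \<bullet> (Qb k *v y k))
    = (\<Sum>k<N. - ((transpose (B k) *v q (Suc k)) \<bullet> (- (transpose (B k) *v p (Suc k)))) + y k \<bullet> (Qb k *v x k))"
  proof (intro sum.cong refl)
    fix k assume "k \<in> {..<N}"
    then have "x k \<bullet> (Qb k *v y k) = y k \<bullet> (Qb k *v x k)"
      by (intro inner_sym_matrix Qb_sym) simp
    then show "- ((transpose (B k) *v p (Suc k)) \<bullet> (- (transpose (B k) *v q (Suc k)))) + x k \<bullet> (Qb k *v y k)
      = - ((transpose (B k) *v q (Suc k)) \<bullet> (- (transpose (B k) *v p (Suc k)))) + y k \<bullet> (Qb k *v x k)"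
      using inner_commute[of "transpose (B k) *v p (Suc k)"] by simp
  qed
  then show ?thesis
    using hamiltonian_duality[OF h hamiltonian_controlled[OF h'], of N]
      hamiltonian_duality[OF h' hamiltonian_controlled[OF h], of N] by simp
qed

text \<open>
  The terminal weight \<open>\<Theta>\<close> for which the states steered optimally from the origin satisfy \<open>p N = \<Theta> x N\<close>; \<open>- x \<bullet> \<Theta> x\<close> is the
  least control and state cost of reaching \<open>x\<close> from \<open>0\<close>, so \<open>\<Theta>\<close> is the borderline below which the total
  quadratic cost is unbounded from below.
\<close>
definition critical_terminal :: "real^'n^'n \<Rightarrow> bool" where
  "critical_terminal \<Theta> \<longleftrightarrow> (\<forall>a. \<exists>x p. hamiltonian x p \<and> x N = a \<and> p N = \<Theta> *v a \<and> x 0 = 0)"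

lemma critical_terminal_sym:
  assumes "critical_terminal \<Theta>"
  shows "transpose \<Theta> = \<Theta>"
proof (rule matrix_eqI_inner)
  fix a b
  obtain x p y q where *: "hamiltonian x p" "x N = a" "p N = \<Theta> *v a" "x 0 = 0"
    "hamiltonian y q" "y N = b" "q N = \<Theta> *v b" "y 0 = 0"
    using assms unfolding critical_terminal_def by meson
  then have "(\<Theta> *v a) \<bullet> b = (\<Theta> *v b) \<bullet> a" using hamiltonian_symplectic[of x p y q] by simp
  moreover have "a \<bullet> (transpose \<Theta> *v b) = (\<Theta> *v a) \<bullet> b" by (simp add: inner_matrix_left)
  ultimately show "a \<bullet> (transpose \<Theta> *v b) = a \<bullet> (\<Theta> *v b)" by (simp add: inner_commute)
qed

text \<open>
  Subtract from \<open>x\<close> the Hamiltonian trajectory \<open>y\<close> from \<open>0\<close> to the same end point. The difference \<open>z\<close> vanishes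
  at both ends, so the mixed terms cancel, and the cost of \<open>y\<close> is exactly compensated by the weight
  \<open>\<Theta>\<close>. What is left is the nonnegative cost of \<open>z\<close> plus the form \<open>D\<close> at \<open>x N\<close>.
\<close>
lemma energy_positive:
  assumes \<Theta>: "critical_terminal \<Theta>" and D: "pos_def D"
    and c: "controlled x u" and x0: "x 0 = 0" and u: "k < N" "u k \<noteq> 0"
  shows "0 < (\<Sum>k<N. u k \<bullet> u k + x k \<bullet> (Qb k *v x k)) + x N \<bullet> ((\<Theta> + D) *v x N)"
proof -
  obtain y p where h: "hamiltonian y p" and yN: "y N = x N" "p N = \<Theta> *v x N" and y0: "y 0 = 0"
    using \<Theta> unfolding critical_terminal_def by blast
  define w where "w k = - (transpose (B k) *v p (Suc k))" for k
  have cy: "controlled y w" using hamiltonian_controlled[OF h] by (simp add: w_def[abs_def])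
  define z where "z k = x k - y k" for k
  define s where "s k = u k - w k" for k
  have cz: "controlled z s"
    using c cy by (simp add: controlled_def z_def s_def matrix_vector_mult_diff_distrib)
  have z: "z 0 = 0" "z N = 0" using x0 y0 yN by (auto simp: z_def)
  have 1: "(\<Sum>k<N. w k \<bullet> s k + y k \<bullet> (Qb k *v z k)) = 0"
    using hamiltonian_duality[OF h cz, of N] z by (simp add: w_def)
  have 2: "(\<Sum>k<N. w k \<bullet> w k + y k \<bullet> (Qb k *v y k)) = - (x N \<bullet> (\<Theta> *v x N))"
    using hamiltonian_duality[OF h cy, of N] yN y0 by (simp add: w_def inner_commute)
  have "(\<Sum>k<N. u k \<bullet> u k + x k \<bullet> (Qb k *v x k))
      = (\<Sum>k<N. (w k \<bullet> w k + y k \<bullet> (Qb k *v y k)) + 2 * (w k \<bullet> s k + y k \<bullet> (Qb k *v z k))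
          + (s k \<bullet> s k + z k \<bullet> (Qb k *v z k)))"
  proof (intro sum.cong refl)
    fix k assume "k \<in> {..<N}"
    then have q: "z k \<bullet> (Qb k *v y k) = y k \<bullet> (Qb k *v z k)"
      by (intro inner_sym_matrix Qb_sym) simp
    have "u k = w k + s k" "x k = y k + z k" by (auto simp: s_def z_def)
    then show "u k \<bullet> u k + x k \<bullet> (Qb k *v x k)
      = (w k \<bullet> w k + y k \<bullet> (Qb k *v y k)) + 2 * (w k \<bullet> s k + y k \<bullet> (Qb k *v z k))
          + (s k \<bullet> s k + z k \<bullet> (Qb k *v z k))"
      using q by (simp add: inner_add matrix_vector_right_distrib inner_commute)
  qed
  also have "\<dots> = - (x N \<bullet> (\<Theta> *v x N)) + (\<Sum>k<N. s k \<bullet> s k + z k \<bullet> (Qb k *v z k))"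
    using 1 2 by (simp add: sum.distrib sum_distrib_left[symmetric])
  finally have total: "(\<Sum>k<N. u k \<bullet> u k + x k \<bullet> (Qb k *v x k)) + x N \<bullet> ((\<Theta> + D) *v x N)
      = (\<Sum>k<N. s k \<bullet> s k + z k \<bullet> (Qb k *v z k)) + x N \<bullet> (D *v x N)"
    by (simp add: matrix_vector_mult_add_rdistrib inner_add)
  have nn: "0 \<le> s k \<bullet> s k + z k \<bullet> (Qb k *v z k)" if "k < N" for k
    using Qb_psd[OF that] by (simp add: psd_def)
  then have S: "0 \<le> (\<Sum>k<N. s k \<bullet> s k + z k \<bullet> (Qb k *v z k))" by (intro sum_nonneg) auto
  show ?thesis
  proof (cases "x N = 0")
    case False
    then show ?thesis unfolding total using S pos_defD[OF D False] by linarith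
  next
    case True
    then have "(\<Sum>k<N. w k \<bullet> w k + y k \<bullet> (Qb k *v y k)) = 0" using 2 by simp
    then have "w k \<bullet> w k + y k \<bullet> (Qb k *v y k) = 0"
      using Qb_psd u by (subst (asm) sum_nonneg_eq_0_iff) (auto simp: psd_def)
    then have "w k = 0" using Qb_psd[OF u(1)] by (simp add: psd_def add_nonneg_eq_0_iff)
    then have "s k \<noteq> 0" using u by (simp add: s_def)
    then have "0 < s k \<bullet> s k + z k \<bullet> (Qb k *v z k)"
      using Qb_psd[OF u(1)] by (auto simp: psd_def intro: add_pos_nonneg)
    then have "0 < (\<Sum>k<N. s k \<bullet> s k + z k \<bullet> (Qb k *v z k))"
      using u nn by (intro sum_pos2[of _ k]) auto
    then show ?thesis unfolding total using True by simp
  qed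
qed

text \<open>
  Downward induction: apply no control before time \<open>n\<close>, the impulse \<open>v\<close> at time \<open>n\<close>, and the Riccati
  feedback afterwards, where the later weights are already known to be positive definite. The total
  energy of this control is \<open>v \<bullet> (I + B\<^sup>T P B) v\<close>, which is therefore positive. The Riccati step is only assumed where the weight is
  invertible, because only
  there does the change of sign from \<open>H\<close> to \<open>- H\<close> commute with the inverse in the equation.
\<close>
lemma riccati_input_weight_pos_def:
  assumes \<Theta>: "critical_terminal \<Theta>" and D: "pos_def D" and PN: "P N = \<Theta> + D"
    and step: "\<And>k. k < N \<Longrightarrow> invertible (input_weight (B k) (P (Suc k))) \<Longrightarrow>
        P k = riccati_map (Ab k) (B k) (Qb k) (P (Suc k))"
    and k: "k \<le> N"
  shows "transpose (P k) = P k \<and> (\<forall>j. k \<le> j \<and> j < N \<longrightarrow> pos_def (input_weight (B j) (P (Suc j))) \<and>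
            transpose (P (Suc j)) = P (Suc j))"
  using k
proof (induction k rule: inc_induct)
  case base
  then show ?case using critical_terminal_sym[OF \<Theta>] pos_def_sym[OF D] by (auto simp: PN transpose_add)
next
  case (step n)
  let ?V = "\<lambda>j. input_weight (B j) (P (Suc j))"
  have sym: "transpose (P (Suc n)) = P (Suc n)" using step by blast
  have IH: "pos_def (?V j)" "transpose (P (Suc j)) = P (Suc j)" if "n < j" "j < N" for j
    using step that by auto
  have pd: "pos_def (?V n)"
    unfolding pos_def_def
  proof (intro conjI allI impI)
    show "transpose (?V n) = ?V n" by (rule transpose_input_weight[OF sym])
    fix v :: "real^'m" assume v: "v \<noteq> 0"
    define c where "c j y = (if j < n then 0 else if j = n then v
        else lq_gain (Ab j) (B j) (P (Suc j)) *v y)" for j y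
    define x where "x = rec_nat 0 (\<lambda>j y. Ab j *v y + B j *v c j y)"
    define u where "u j = c j (x j)" for j
    have x0: "x 0 = 0" and xS: "x (Suc j) = Ab j *v x j + B j *v u j" for j
      by (auto simp: x_def u_def)
    have xz: "x j = 0" if "j \<le> n" for j
      using that
    proof (induction j)
      case (Suc j) then show ?case unfolding xS by (simp add: u_def c_def)
    qed (simp add: x0)
    let ?c = "\<lambda>k. u k \<bullet> u k + x k \<bullet> (Qb k *v x k)"
    have un: "u n = v" by (simp add: u_def c_def)
    have xn: "x (Suc n) = B n *v v" by (simp add: xS xz un)
    have "(\<Sum>k<n. ?c k) = 0" by (intro sum.neutral) (auto simp: xz u_def c_def)
    then have b: "(\<Sum>k<Suc n. ?c k) = v \<bullet> v" by (simp add: un xz)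
    have "(\<Sum>k<i. ?c k) + x i \<bullet> (P i *v x i) = v \<bullet> (?V n *v v)" if "Suc n \<le> i" "i \<le> N" for i
      using that
    proof (induction i rule: dec_induct)
      case base
      show ?case unfolding b xn
        by (simp add: input_weight_def matrix_vector_mult_add_rdistrib inner_add
            matrix_vector_mul_assoc[symmetric] inner_matrix_left)
    next
      case (step i)
      then have i: "n < i" "i < N" by auto
      have inv: "invertible (?V i)" using IH(1)[OF i] pos_def_invertible by blast
      have "u i = lq_gain (Ab i) (B i) (P (Suc i)) *v x i" using i by (simp add: u_def c_def)
      then have "?c i + x (Suc i) \<bullet> (P (Suc i) *v x (Suc i)) = x i \<bullet> (P i *v x i)"
        using riccati_completing_square[OF IH(2)[OF i] inv, of "u i" "Ab i" "x i" "Qb i"]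
          assms(4)[OF i(2) inv] by (simp add: xS)
      then show ?case using step by simp
    qed
    from this[of N] have "(\<Sum>k<N. ?c k) + x N \<bullet> (P N *v x N) = v \<bullet> (?V n *v v)"
      using step by simp
    moreover have "0 < (\<Sum>k<N. ?c k) + x N \<bullet> (P N *v x N)"
      unfolding PN
    proof (rule energy_positive[OF \<Theta> D])
      show "controlled x u" by (simp add: controlled_def xS)
      show "n < N" using step by simp
    qed (use v un x0 in auto)
    ultimately show "0 < v \<bullet> (?V n *v v)" by simp
  qed
  have inv: "invertible (?V n)" using pd pos_def_invertible by blast
  have "n < N" using step by simp
  from assms(4)[OF this inv] have "transpose (P n) = P n"
    using transpose_riccati_map[OF sym Qb_sym[OF \<open>n < N\<close>] inv] by simp
  moreover have "pos_def (?V j) \<and> transpose (P (Suc j)) = P (Suc j)" if "n \<le> j" "j < N" for j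
    using that pd IH sym by (cases "j = n") auto
  ultimately show ?case by blast
qed

end

section \<open>Time reversal of Riccati solutions and the Hamiltonian transition matrix\<close>

text \<open>
  The completed square for \<open>- H\<close>, rewritten around the next state \<open>a\<close> instead of the present state \<open>x\<close>: the residual
  of the feedback at \<open>x\<close>, multiplied by the weight, is \<open>v - B\<^sup>T H a\<close>.
\<close>
lemma riccati_dual_square:
  fixes Ab :: "real^'n^'n" and B :: "real^'m^'n"
  assumes H: "transpose H = H" and W: "invertible (input_weight B (- H))"
    and Hk: "- Hk = riccati_map Ab B Q (- H)"
    and a: "a = Ab *v x + B *v v" and r: "r = v - transpose B *v (H *v a)"
  shows "v \<bullet> v + x \<bullet> ((Hk + Q) *v x) = a \<bullet> (H *v a) + r \<bullet> (matrix_inv (input_weight B (- H)) *v r)"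
proof -
  let ?W = "input_weight B (- H)"
  have mH: "transpose (- H) = - H" by (simp add: transpose_uminus H)
  define s where "s = v - lq_gain Ab B (- H) *v x"
  have Ws: "?W *v s = r"
  proof -
    have "?W *v s = ?W *v v + transpose B *v (- H *v (Ab *v x))"
      by (simp add: s_def lq_gain_def matrix_uminus_mult matrix_vector_mult_diff_distrib
          matrix_vector_mul_assoc[symmetric] matrix_inv_vector[OF W] matrix_mult_uminus_vec)
    also have "\<dots> = r"
      by (simp add: r a input_weight_def matrix_vector_mult_add_rdistrib matrix_vector_mul_assoc[symmetric]
          matrix_uminus_mult matrix_mult_uminus_vec matrix_vector_right_distrib)
    finally show ?thesis .
  qed
  then have "s = matrix_inv ?W *v r" using matrix_inv_vector(2)[OF W] by metis
  then have "s \<bullet> (?W *v s) = r \<bullet> (matrix_inv ?W *v r)" using Ws by (metis inner_commute)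
  moreover have "v \<bullet> v + a \<bullet> (- H *v a) + x \<bullet> (Q *v x) = x \<bullet> (- Hk *v x) + s \<bullet> (?W *v s)"
    unfolding Hk a s_def by (rule riccati_completing_square[OF mH W])
  ultimately show ?thesis
    by (simp add: matrix_uminus_mult matrix_vector_mult_add_rdistrib inner_add)
qed

text \<open>
  The time-reversal identity. Up to normalization, the left side is minus twice the logarithm of the density of a state \<open>x\<close>
  followed by a forward control, the right side the same for the state \<open>a\<close> and a backward control.
\<close>
lemma riccati_exchange_square:
  fixes Ab :: "real^'n^'n" and B :: "real^'m^'n"
  assumes P: "transpose P = P" and V: "invertible (input_weight B P)" and Pk: "Pk = riccati_map Ab B Q P"
    and H: "transpose H = H" and W: "invertible (input_weight B (- H))"
    and Hk: "- Hk = riccati_map Ab B Q (- H)"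
    and a: "a = Ab *v x + B *v v" and r: "r = v - transpose B *v (H *v a)"
    and s: "s = v - lq_gain Ab B P *v x"
  shows "x \<bullet> ((Pk + Hk) *v x) + s \<bullet> (input_weight B P *v s)
       = a \<bullet> ((P + H) *v a) + r \<bullet> (matrix_inv (input_weight B (- H)) *v r)"
  using riccati_dual_square[OF H W Hk a r] riccati_completing_square[OF P V, of v Ab x Q]
  by (simp add: Pk a s matrix_vector_mult_add_rdistrib inner_add)

text \<open>
  In the time-reversal identity choose the control so that the square on the side of \<open>x\<close> vanishes.
\<close>
lemma pos_def_riccati_sum:
  fixes Ab :: "real^'n^'n" and B :: "real^'m^'n"
  assumes P: "transpose P = P" "transpose Pk = Pk" and V: "invertible (input_weight B P)"
    and Pk: "Pk = riccati_map Ab B Q P"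
    and H: "transpose H = H" "transpose Hk = Hk" and W: "pos_def (input_weight B (- H))"
    and Hk: "- Hk = riccati_map Ab B Q (- H)"
    and Ab: "invertible Ab" and PH: "pos_def (P + H)"
  shows "pos_def (Pk + Hk)"
  unfolding pos_def_def
proof (intro conjI allI impI)
  show "transpose (Pk + Hk) = Pk + Hk" by (simp add: transpose_add P H)
  fix x :: "real^'n" assume x: "x \<noteq> 0"
  define v where "v = lq_gain Ab B P *v x"
  define a where "a = Ab *v x + B *v v"
  define r where "r = v - transpose B *v (H *v a)"
  have eq: "x \<bullet> ((Pk + Hk) *v x) = a \<bullet> ((P + H) *v a) + r \<bullet> (matrix_inv (input_weight B (- H)) *v r)"
    using riccati_exchange_square[OF P(1) V Pk H(1) pos_def_invertible[OF W] Hk a_def r_def refl]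
    by (simp add: v_def)
  have Wi: "pos_def (matrix_inv (input_weight B (- H)))" by (rule pos_def_matrix_inv[OF W])
  have "a \<noteq> 0 \<or> r \<noteq> 0"
  proof (rule ccontr)
    assume "\<not> ?thesis"
    then have "a = 0" "v = 0" by (auto simp: r_def)
    then have "Ab *v x = 0" by (simp add: a_def)
    then show False using x Ab invertible_iff_ker by blast
  qed
  then show "0 < x \<bullet> ((Pk + Hk) *v x)"
    unfolding eq using pos_defD[OF PH, of a] pos_defD[OF Wi, of r] pos_def_nonneg[OF PH, of a]
      pos_def_nonneg[OF Wi, of r] by fastforce
qed

lemma block_vec_nth [simp]: "block_vec x y $ Inl i = x $ i" "block_vec x y $ Inr j = y $ j"
  by (simp_all add: block_vec_def)

lemma sum_sum_type:
  fixes f :: "'a::finite + 'b::finite \<Rightarrow> 'c::comm_monoid_add"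
  shows "(\<Sum>i\<in>UNIV. f i) = (\<Sum>i\<in>UNIV. f (Inl i)) + (\<Sum>j\<in>UNIV. f (Inr j))"
  by (simp add: UNIV_Plus_UNIV[symmetric] sum.Plus del: UNIV_Plus_UNIV)

lemma block_vec_eqI:
  assumes "\<And>i. z $ Inl i = x $ i" "\<And>j. z $ Inr j = y $ j"
  shows "z = block_vec x y"
  unfolding vec_eq_iff
proof
  fix i show "z $ i = block_vec x y $ i" by (cases i) (simp_all add: assms)
qed

lemma block_vec_cases: obtains x y where "z = block_vec x y"
  by (rule that[of "\<chi> i. z $ Inl i" "\<chi> i. z $ Inr i"]) (rule block_vec_eqI, simp_all)

lemma block_mat_mult_block_vec:
  "block_mat X11 X12 X21 X22 *v block_vec x y
     = block_vec (X11 *v x + X12 *v y) (X21 *v x + X22 *v y)"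
  by (rule block_vec_eqI) (simp_all add: matrix_vector_mult_def block_mat_def sum_sum_type)

lemma block_mult_fst: "(X *v block_vec x y) $ Inl i = (block11 X *v x + block12 X *v y) $ i"
  by (simp add: matrix_vector_mult_def block11_def block12_def sum_sum_type)

lemma inner_block_vec: "block_vec x y \<bullet> block_vec x' y' = x \<bullet> x' + y \<bullet> y'"
  by (simp add: inner_vec_def sum_sum_type)

lemma inv_prod_trajectory:
  assumes "\<And>k. k < n \<Longrightarrow> z k = matrix_inv (F k) *v z (Suc k)"
  shows "z 0 = inv_prod F 0 n *v z n"
  using assms by (induction n) (simp_all add: matrix_vector_mul_assoc[symmetric])

lemma desc_prod_Suc_right: "desc_prod F l (Suc j) = desc_prod F (Suc l) j ** F l"
  by (induction j) (simp_all add: matrix_mul_assoc)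

text \<open>
  With vanishing states the costates obey the adjoint free dynamics, whose transition matrices are those in the
  reachability Gramian.
\<close>
lemma desc_prod_adjoint_trajectory:
  assumes "\<And>j. k \<le> j \<Longrightarrow> j < k + n \<Longrightarrow> p j = transpose (F j) *v p (Suc j)"
  shows "p k = transpose (desc_prod F k n) *v p (k + n)"
  using assms
proof (induction n arbitrary: k)
  case (Suc n)
  have "p (Suc k) = transpose (desc_prod F (Suc k) n) *v p (Suc k + n)"
    by (intro Suc.IH Suc.prems) auto
  moreover have "p k = transpose (F k) *v p (Suc k)" by (intro Suc.prems) auto
  ultimately show ?case
    by (simp add: desc_prod_Suc_right matrix_transpose_mul matrix_vector_mul_assoc del: desc_prod.simps)
qed simp

context lq_data
begin

text \<open>
  The one-step matrix of the Hamiltonian system, acting forward in time on the stacked vector of state and costate.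
\<close>
definition ham_mat :: "nat \<Rightarrow> real^('n + 'n)^('n + 'n)" where
  "ham_mat k = (let AT = transpose (matrix_inv (Ab k)) in
     block_mat (Ab k + Gmat B k ** AT ** Qb k) (- (Gmat B k ** AT)) (- (AT ** Qb k)) AT)"

lemma ham_mat_step:
  assumes k: "k < N" and x: "x = matrix_inv (Ab k) *v (x' + Gmat B k *v p')"
    and p: "p = transpose (Ab k) *v p' + Qb k *v x"
  shows "ham_mat k *v block_vec x p = block_vec x' p'"
proof -
  let ?AT = "transpose (matrix_inv (Ab k))"
  have AT: "?AT *v (transpose (Ab k) *v y) = y" for y
    using Ab_inv[OF k] by (simp add: matrix_vector_mul_assoc matrix_inv_mult flip: matrix_transpose_mul)
  have A: "Ab k *v x = x' + Gmat B k *v p'" by (simp add: x matrix_inv_vector Ab_inv[OF k])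
  show ?thesis
    by (simp add: ham_mat_def Let_def block_mat_mult_block_vec p matrix_vector_right_distrib AT A
        matrix_vector_mult_add_rdistrib matrix_uminus_mult matrix_vector_mul_assoc[symmetric])
qed

lemma ham_mat_invertible: "k < N \<Longrightarrow> invertible (ham_mat k)"
  unfolding invertible_right_inverse matrix_right_invertible_surjective surj_def
  using ham_mat_step by (metis block_vec_cases)

text \<open>
  The initial state as a function of the terminal data. The upper blocks of the backward transition
  matrix are the only part of it that enters the boundary conditions.
\<close>
lemma hamiltonian_initial:
  assumes "hamiltonian x p"
  shows "x 0 = block11 (inv_prod ham_mat 0 N) *v x N + block12 (inv_prod ham_mat 0 N) *v p N"
proof -
  have "block_vec (x k) (p k) = matrix_inv (ham_mat k) *v block_vec (x (Suc k)) (p (Suc k))" if "k < N" for k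
    using ham_mat_step[OF that, of "x k" "x (Suc k)" "p (Suc k)" "p k"] assms that
      matrix_inv_vector(2)[OF ham_mat_invertible[OF that], of "block_vec (x k) (p k)"]
    by (simp add: hamiltonian_def)
  then have "block_vec (x 0) (p 0) = inv_prod ham_mat 0 N *v block_vec (x N) (p N)"
    by (rule inv_prod_trajectory)
  then show ?thesis
    by (metis block_mult_fst block_vec_nth(1) vec_eq_iff)
qed

text \<open>
  A kernel vector \<open>b\<close> gives a Hamiltonian trajectory from \<open>0\<close> to \<open>0\<close>. By duality its cost is zero, so the control
  and all states vanish, and \<open>b\<close> is orthogonal to every reachable direction.
\<close>
lemma block12_invertible:
  assumes reach: "invertible (\<Sum>k<N. desc_prod Ab (Suc k) (N - Suc k) ** Gmat B k
      ** transpose (desc_prod Ab (Suc k) (N - Suc k)))"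
  shows "invertible (block12 (inv_prod ham_mat 0 N))"
  unfolding invertible_iff_ker
proof (intro allI impI)
  fix b assume b: "block12 (inv_prod ham_mat 0 N) *v b = 0"
  obtain x p where h: "hamiltonian x p" and N: "x N = 0" "p N = b" by (rule hamiltonian_exists)
  have x0: "x 0 = 0" using hamiltonian_initial[OF h] by (simp add: N b)
  define w where "w k = - (transpose (B k) *v p (Suc k))" for k
  have cx: "controlled x w" using hamiltonian_controlled[OF h] by (simp add: w_def[abs_def])
  have "(\<Sum>k<N. w k \<bullet> w k + x k \<bullet> (Qb k *v x k)) = 0"
    using hamiltonian_duality[OF h cx, of N] N x0 by (simp add: w_def)
  then have "\<forall>k<N. w k \<bullet> w k + x k \<bullet> (Qb k *v x k) = 0"
    using Qb_psd by (subst (asm) sum_nonneg_eq_0_iff) (auto simp: psd_def)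
  then have w: "w k = 0" if "k < N" for k
    using Qb_psd[OF that] that by (metis add_nonneg_eq_0_iff inner_ge_zero inner_eq_zero_iff psd_def)
  have xz: "x k = 0" if "k \<le> N" for k
    using that by (induction k) (use cx w x0 in \<open>auto simp: controlled_def\<close>)
  have p: "p k = transpose (Ab k) *v p (Suc k)" if "k < N" for k
    using h that xz by (simp add: hamiltonian_def)
  have "(desc_prod Ab (Suc k) (N - Suc k) ** Gmat B k ** transpose (desc_prod Ab (Suc k) (N - Suc k))) *v b = 0"
    if k: "k < N" for k
  proof -
    have "p (Suc k) = transpose (desc_prod Ab (Suc k) (N - Suc k)) *v p (Suc k + (N - Suc k))"
      using p k by (intro desc_prod_adjoint_trajectory) auto
    then have "transpose (desc_prod Ab (Suc k) (N - Suc k)) *v b = p (Suc k)" using k N by simp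
    moreover have "transpose (B k) *v p (Suc k) = 0" using w[OF k] by (simp add: w_def)
    ultimately show ?thesis by (simp add: Gmat_def matrix_vector_mul_assoc[symmetric])
  qed
  moreover have "(\<Sum>k\<in>K. M k) *v b = (\<Sum>k\<in>K. M k *v b)" if "finite K" for K and M :: "nat \<Rightarrow> real^'n^'n"
    using that by (induction K) (simp_all add: matrix_vector_mult_add_rdistrib)
  ultimately have "(\<Sum>k<N. desc_prod Ab (Suc k) (N - Suc k) ** Gmat B k
      ** transpose (desc_prod Ab (Suc k) (N - Suc k))) *v b = 0" by simp
  then show "b = 0" using reach invertible_iff_ker by blast
qed

lemma critical_terminal_phi:
  assumes "invertible (block12 (inv_prod ham_mat 0 N))"
  shows "critical_terminal (- (matrix_inv (block12 (inv_prod ham_mat 0 N)) ** block11 (inv_prod ham_mat 0 N)))"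
  unfolding critical_terminal_def
proof
  fix a
  let ?\<Theta> = "- (matrix_inv (block12 (inv_prod ham_mat 0 N)) ** block11 (inv_prod ham_mat 0 N))"
  obtain x p where h: "hamiltonian x p" and N: "x N = a" "p N = ?\<Theta> *v a" by (rule hamiltonian_exists)
  have "x 0 = 0"
    unfolding hamiltonian_initial[OF h] N
    by (simp add: matrix_uminus_mult matrix_mult_uminus_vec matrix_vector_mul_assoc[symmetric]
        matrix_inv_vector[OF assms])
  then show "\<exists>x p. hamiltonian x p \<and> x N = a \<and> p N = ?\<Theta> *v a \<and> x 0 = 0" using h N by blast
qed

text \<open>
  The relation \<open>p = P x\<close> is propagated by the Hamiltonian flow when \<open>P\<close> solves the Riccati equation.
\<close>
lemma hamiltonian_riccati:
  assumes h: "hamiltonian x p" and pN: "p N = P N *v x N"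
    and step: "\<And>k. k < N \<Longrightarrow> invertible (input_weight (B k) (P (Suc k))) \<and>
        P k = riccati_map (Ab k) (B k) (Qb k) (P (Suc k))"
    and k: "k \<le> N"
  shows "p k = P k *v x k"
  using k
proof (induction k rule: inc_induct)
  case (step n)
  define w where "w = transpose (B n) *v p (Suc n)"
  have n: "n < N" using step by simp
  have V: "invertible (input_weight (B n) (P (Suc n)))"
    and Pn: "P n = riccati_map (Ab n) (B n) (Qb n) (P (Suc n))" using assms(3) n by auto
  have A: "Ab n *v x n = x (Suc n) + B n *v w"
    using h n by (simp add: hamiltonian_def matrix_inv_vector Ab_inv w_def Gmat_def matrix_vector_mul_assoc[symmetric])
  have w: "w = transpose (B n) *v (P (Suc n) *v x (Suc n))" using step by (simp add: w_def)
  have "transpose (B n) *v (P (Suc n) *v (Ab n *v x n)) = input_weight (B n) (P (Suc n)) *v w"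
    by (simp add: A input_weight_def matrix_vector_right_distrib matrix_vector_mult_add_rdistrib
        matrix_vector_mul_assoc[symmetric] w[symmetric])
  then have "P n *v x n = transpose (Ab n) *v (P (Suc n) *v x (Suc n)) + Qb n *v x n"
    unfolding Pn riccati_map_def input_weight_def[symmetric]
    by (simp add: matrix_vector_mult_add_rdistrib matrix_vector_mult_diff_rdistrib
        matrix_vector_mul_assoc[symmetric] matrix_inv_vector[OF V])
       (simp add: A matrix_vector_right_distrib)
  then show ?case using h n step by (simp add: hamiltonian_def)
qed (rule pN)

end

section \<open>Riccati pairs with prescribed boundary covariances\<close>

text \<open>
  Here \<open>\<phi>\<close> is the block that maps the terminal costate to the initial state. With \<open>y = R\<^sup>-\<^sup>1 x\<close> the two weights are
  \<open>T + I/2\<close> and \<open>T - I/2\<close>, whose product is \<open>T\<^sup>2 - I/4 = R \<phi>\<^sup>-\<^sup>1 \<Sigma>0 \<phi>\<^sup>-\<^sup>T R\<close>; this is where the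
  square root in the closed form of the terminal value comes from.
\<close>
lemma boundary_weights:
  fixes \<phi> \<Sigma>0 \<Sigma>N :: "real^'n^'n"
  assumes \<phi>: "invertible \<phi>" and S0: "pos_def \<Sigma>0" and SN: "pos_def \<Sigma>N"
    and R: "R = psd_sqrt \<Sigma>N"
    and T: "T = psd_sqrt ((1/4) *\<^sub>R mat 1 + R ** matrix_inv \<phi> ** \<Sigma>0 ** transpose (matrix_inv \<phi>) ** R)"
    and D1: "D1 = matrix_inv R ** T ** matrix_inv R + (1/2) *\<^sub>R matrix_inv \<Sigma>N"
    and D2: "D2 = matrix_inv R ** T ** matrix_inv R - (1/2) *\<^sub>R matrix_inv \<Sigma>N"
  shows "pos_def D1" "pos_def D2" "D1 ** \<Sigma>N ** D2 = matrix_inv \<phi> ** \<Sigma>0 ** transpose (matrix_inv \<phi>)"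
proof -
  define E where "E = R ** matrix_inv \<phi> ** \<Sigma>0 ** transpose (matrix_inv \<phi>) ** R"
  let ?Ri = "matrix_inv R"
  have Rpd: "pos_def R" unfolding R by (rule pos_def_psd_sqrt[OF SN])
  then have Ri: "invertible R" and Rs: "transpose R = R" by (auto simp: pos_def_invertible pos_def_sym)
  have Ris: "transpose ?Ri = ?Ri" using pos_def_sym pos_def_matrix_inv Rpd by blast
  have RR: "R ** R = \<Sigma>N" unfolding R by (rule psd_sqrt(2)[OF pos_def_psd[OF SN]])
  have SNi: "matrix_inv \<Sigma>N = ?Ri ** ?Ri"
  proof (rule matrix_inv_eqI)
    have "R ** R ** (?Ri ** ?Ri) = R ** (R ** ?Ri) ** ?Ri" by (simp add: matrix_mul_assoc)
    then show "\<Sigma>N ** (?Ri ** ?Ri) = mat 1" by (simp add: RR[symmetric] matrix_inv_mult[OF Ri])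
  qed
  have Epd: "pos_def E"
  proof -
    have "E = transpose (transpose (matrix_inv \<phi>) ** R) ** \<Sigma>0 ** (transpose (matrix_inv \<phi>) ** R)"
      by (simp add: E_def matrix_transpose_mul Rs matrix_mul_assoc)
    moreover have "invertible (transpose (matrix_inv \<phi>) ** R)"
      by (intro invertible_mult transpose_invertible invertible_matrix_inv \<phi> Ri)
    ultimately show ?thesis using pos_def_congruence[OF S0] by metis
  qed
  have "psd ((1/4) *\<^sub>R mat 1 + E)"
    using pos_def_nonneg[OF Epd] pos_def_sym[OF Epd]
    by (simp add: psd_def transpose_add transpose_scalar matrix_vector_mult_add_rdistrib inner_add
        flip: scaleR_matrix_vector_assoc)
  then have Tpsd: "psd T" and TT: "T ** T = (1/4) *\<^sub>R mat 1 + E"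
    unfolding T E_def[symmetric] using psd_sqrt by auto
  have Ts: "transpose T = T" using Tpsd by (simp add: psd_def)
  have half: "1/2 * (y \<bullet> y) < y \<bullet> (T *v y)" if "y \<noteq> 0" for y
    by (rule sqrt_exceeds_half[OF Tpsd Epd TT that])
  have D1v: "D1 *v x = ?Ri *v (T *v (?Ri *v x) + (1/2) *\<^sub>R (?Ri *v x))" for x
    by (simp add: D1 SNi matrix_vector_mult_add_rdistrib matrix_vector_mul_assoc[symmetric]
        matrix_vector_right_distrib matrix_vector_mult_scaleR flip: scaleR_matrix_vector_assoc)
  have D2v: "D2 *v x = ?Ri *v (T *v (?Ri *v x) - (1/2) *\<^sub>R (?Ri *v x))" for x
    by (simp add: D2 SNi matrix_vector_mult_diff_rdistrib matrix_vector_mul_assoc[symmetric]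
        matrix_vector_mult_diff_distrib matrix_vector_mult_scaleR flip: scaleR_matrix_vector_assoc)
  have Ss: "transpose (matrix_inv \<Sigma>N) = matrix_inv \<Sigma>N"
    using pos_def_sym pos_def_matrix_inv SN by blast
  have nz: "?Ri *v x \<noteq> 0" if "x \<noteq> 0" for x
    using that invertible_matrix_inv[OF Ri] invertible_iff_ker by blast
  show "pos_def D1"
    unfolding pos_def_def
  proof (intro conjI allI impI)
    show "transpose D1 = D1"
      by (simp add: D1 transpose_add transpose_scalar Ss matrix_transpose_mul Ris Ts matrix_mul_assoc)
    fix x :: "real^'n" assume "x \<noteq> 0"
    let ?y = "?Ri *v x"
    have "x \<bullet> (D1 *v x) = ?y \<bullet> (T *v ?y) + 1/2 * (?y \<bullet> ?y)"
      unfolding D1v using inner_matrix_left[of ?Ri x, unfolded Ris]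
      by (simp add: inner_add matrix_vector_right_distrib matrix_vector_mult_scaleR)
    moreover have "0 \<le> ?y \<bullet> ?y" by simp
    ultimately show "0 < x \<bullet> (D1 *v x)" using half[OF nz[OF \<open>x \<noteq> 0\<close>]] by linarith
  qed
  show "pos_def D2"
    unfolding pos_def_def
  proof (intro conjI allI impI)
    show "transpose D2 = D2"
      by (simp add: D2 transpose_diff transpose_scalar Ss matrix_transpose_mul Ris Ts matrix_mul_assoc)
    fix x :: "real^'n" assume "x \<noteq> 0"
    let ?y = "?Ri *v x"
    have "x \<bullet> (D2 *v x) = ?y \<bullet> (T *v ?y) - 1/2 * (?y \<bullet> ?y)"
      unfolding D2v using inner_matrix_left[of ?Ri x, unfolded Ris]
      by (simp add: inner_diff matrix_vector_mult_diff_distrib matrix_vector_mult_scaleR)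
    then show "0 < x \<bullet> (D2 *v x)" using half[OF nz[OF \<open>x \<noteq> 0\<close>]] by linarith
  qed
  show "D1 ** \<Sigma>N ** D2 = matrix_inv \<phi> ** \<Sigma>0 ** transpose (matrix_inv \<phi>)"
    unfolding matrix_eq
  proof
    fix x :: "real^'n"
    let ?y = "?Ri *v x"
    have "(D1 ** \<Sigma>N ** D2) *v x
        = ?Ri *v (T *v (T *v ?y - (1/2) *\<^sub>R ?y) + (1/2) *\<^sub>R (T *v ?y - (1/2) *\<^sub>R ?y))"
      by (simp add: matrix_vector_mul_assoc[symmetric] D1v D2v RR[symmetric] matrix_inv_vector[OF Ri])
    also have "T *v (T *v ?y - (1/2) *\<^sub>R ?y) + (1/2) *\<^sub>R (T *v ?y - (1/2) *\<^sub>R ?y)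
        = (T ** T) *v ?y - (1/4) *\<^sub>R ?y"
      by (simp add: matrix_vector_mult_diff_distrib matrix_vector_mult_scaleR scaleR_diff_right
          matrix_vector_mul_assoc matrix_mul_assoc)
    also have "\<dots> = E *v ?y"
      by (simp add: TT matrix_vector_mult_add_rdistrib flip: scaleR_matrix_vector_assoc)
    also have "?Ri *v (E *v ?y) = (matrix_inv \<phi> ** \<Sigma>0 ** transpose (matrix_inv \<phi>)) *v x"
      by (simp add: E_def matrix_vector_mul_assoc[symmetric] matrix_inv_vector[OF Ri])
    finally show "(D1 ** \<Sigma>N ** D2) *v x = (matrix_inv \<phi> ** \<Sigma>0 ** transpose (matrix_inv \<phi>)) *v x" .
  qed
qed

text \<open>
  The matrix facts about \<open>P\<close> and \<open>H\<close> on which the probabilistic part rests. The last two fix the covariance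
  \<open>(P k + H k)\<^sup>-\<^sup>1\<close> at both ends.
\<close>
locale riccati_pair = lq_data N Ab B Qb
  for N :: nat and Ab :: "nat \<Rightarrow> real^'n^'n" and B :: "nat \<Rightarrow> real^'m^'n" and Qb :: "nat \<Rightarrow> real^'n^'n" +
  fixes P H :: "nat \<Rightarrow> real^'n^'n" and \<Sigma>0 \<Sigma>N :: "real^'n^'n"
  assumes S0: "pos_def \<Sigma>0" and SN: "pos_def \<Sigma>N"
    and P_weight: "k < N \<Longrightarrow> pos_def (input_weight (B k) (P (Suc k)))"
    and H_weight: "k < N \<Longrightarrow> pos_def (input_weight (B k) (- H (Suc k)))"
    and P_sym: "k \<le> N \<Longrightarrow> transpose (P k) = P k"
    and H_sym: "k \<le> N \<Longrightarrow> transpose (H k) = H k"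
    and P_step: "k < N \<Longrightarrow> P k = riccati_map (Ab k) (B k) (Qb k) (P (Suc k))"
    and H_step: "k < N \<Longrightarrow> - H k = riccati_map (Ab k) (B k) (Qb k) (- H (Suc k))"
    and sum_pos_def: "k \<le> N \<Longrightarrow> pos_def (P k + H k)"
    and sum_N: "P N + H N = matrix_inv \<Sigma>N"
    and sum_0: "P 0 + H 0 = matrix_inv \<Sigma>0"

text \<open>
  The sum at time \<open>0\<close> is found from the symplectic form of a trajectory with \<open>p = P x\<close> and one with
  \<open>p = - H x\<close>: it equals \<open>x \<bullet> (P + H) y\<close> at every time, and the initial states are \<open>\<phi> D1 a\<close> and \<open>\<phi> D2 b\<close> when the
  terminal ones are \<open>a\<close> and \<open>b\<close>. So \<open>P 0 + H 0\<close> is determined by \<open>D1\<close>, \<open>D2\<close>, \<open>\<phi>\<close> and \<open>\<Sigma>N\<close>.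
\<close>
lemma (in lq_data) riccati_pairI:
  assumes S0: "pos_def \<Sigma>0" and SN: "pos_def \<Sigma>N"
    and \<phi>: "\<phi> = block12 (inv_prod ham_mat 0 N)" "invertible \<phi>"
    and D: "pos_def D1" "pos_def D2" "D1 - D2 = matrix_inv \<Sigma>N"
      "D1 ** \<Sigma>N ** D2 = matrix_inv \<phi> ** \<Sigma>0 ** transpose (matrix_inv \<phi>)"
    and PN: "P N = - (matrix_inv \<phi> ** block11 (inv_prod ham_mat 0 N)) + D1"
    and HN: "- H N = - (matrix_inv \<phi> ** block11 (inv_prod ham_mat 0 N)) + D2"
    and Pst: "\<And>k. k < N \<Longrightarrow> invertible (input_weight (B k) (P (Suc k))) \<Longrightarrow>
       P k = riccati_map (Ab k) (B k) (Qb k) (P (Suc k))"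
    and Hst: "\<And>k. k < N \<Longrightarrow> invertible (input_weight (B k) (- H (Suc k))) \<Longrightarrow>
       - H k = riccati_map (Ab k) (B k) (Qb k) (- H (Suc k))"
  shows "riccati_pair N Ab B Qb P H \<Sigma>0 \<Sigma>N"
proof -
  let ?\<Theta> = "- (matrix_inv \<phi> ** block11 (inv_prod ham_mat 0 N))"
  have crit: "critical_terminal ?\<Theta>" using critical_terminal_phi \<phi> by simp
  note P = riccati_input_weight_pos_def[OF crit D(1), of P, OF PN Pst]
  note H = riccati_input_weight_pos_def[OF crit D(2), of "\<lambda>k. - H k", OF HN Hst]
  have Psym: "transpose (P k) = P k" if "k \<le> N" for k using P[OF _ _ that] by blast
  have Hsym: "transpose (H k) = H k" if "k \<le> N" for k
    using H[OF _ _ that] by (simp add: transpose_uminus)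
  have Pw: "pos_def (input_weight (B k) (P (Suc k)))" if "k < N" for k using P[of 0] that by simp
  have Hw: "pos_def (input_weight (B k) (- H (Suc k)))" if "k < N" for k using H[of 0] that by simp
  have Ps: "P k = riccati_map (Ab k) (B k) (Qb k) (P (Suc k))" if "k < N" for k
    using Pst[OF that] Pw[OF that] pos_def_invertible by blast
  have Hs: "- H k = riccati_map (Ab k) (B k) (Qb k) (- H (Suc k))" if "k < N" for k
    using Hst[OF that] Hw[OF that] pos_def_invertible by blast
  have sumN: "P N + H N = matrix_inv \<Sigma>N"
    using PN HN D(3) by (metis add_diff_cancel_left diff_minus_eq_add)
  have pd: "pos_def (P k + H k)" if "k \<le> N" for k
    using that
  proof (induction k rule: inc_induct)
    case base
    show ?case unfolding sumN by (rule pos_def_matrix_inv[OF SN])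
  next
    case (step k)
    then have k: "k < N" by simp
    show ?case
      by (rule pos_def_riccati_sum[OF _ _ _ Ps[OF k] _ _ Hw[OF k] Hs[OF k] Ab_inv[OF k] step.IH])
        (use k in \<open>simp_all add: Psym Hsym Pw pos_def_invertible\<close>)
  qed
  have initial: "(\<phi> *v (D1 *v a)) \<bullet> ((P 0 + H 0) *v (\<phi> *v (D2 *v b))) = a \<bullet> (matrix_inv \<Sigma>N *v b)" for a b
  proof -
    obtain x p where x: "hamiltonian x p" "x N = a" "p N = P N *v a" by (rule hamiltonian_exists)
    obtain y q where y: "hamiltonian y q" "y N = b" "q N = - H N *v b" by (rule hamiltonian_exists)
    have p0: "p 0 = P 0 *v x 0"
      by (rule hamiltonian_riccati[OF x(1)]) (use x Pw Ps pos_def_invertible in auto)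
    have q0: "q 0 = - H 0 *v y 0"
      by (rule hamiltonian_riccati[OF y(1), of "\<lambda>k. - H k"]) (use y Hw Hs pos_def_invertible in auto)
    have x0: "x 0 = \<phi> *v (D1 *v a)"
      unfolding hamiltonian_initial[OF x(1)] x(2,3) PN \<phi>(1)[symmetric]
      by (simp add: matrix_vector_mult_add_rdistrib matrix_vector_mult_diff_rdistrib
          matrix_vector_mult_diff_distrib matrix_uminus_mult matrix_mult_uminus_vec matrix_vector_mul_assoc[symmetric] matrix_inv_vector[OF \<phi>(2)])
    have y0: "y 0 = \<phi> *v (D2 *v b)"
      unfolding hamiltonian_initial[OF y(1)] y(2,3) HN \<phi>(1)[symmetric]
      by (simp add: matrix_vector_mult_add_rdistrib matrix_vector_mult_diff_rdistrib
          matrix_vector_mult_diff_distrib matrix_uminus_mult matrix_mult_uminus_vec matrix_vector_mul_assoc[symmetric] matrix_inv_vector[OF \<phi>(2)])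
    have "p 0 \<bullet> y 0 - q 0 \<bullet> x 0 = p N \<bullet> y N - q N \<bullet> x N"
      by (rule hamiltonian_symplectic[OF x(1) y(1)])
    moreover have "p 0 \<bullet> y 0 - q 0 \<bullet> x 0 = x 0 \<bullet> ((P 0 + H 0) *v y 0)"
      unfolding p0 q0 using Psym[of 0] inner_matrix_left[of "P 0" "x 0" "y 0"]
      by (simp add: matrix_vector_mult_add_rdistrib inner_add matrix_uminus_mult inner_commute[of "H 0 *v y 0"])
    moreover have "p N \<bullet> y N - q N \<bullet> x N = a \<bullet> ((P N + H N) *v b)"
      unfolding x y using Psym[of N] inner_matrix_left[of "P N" a b]
      by (simp add: matrix_vector_mult_add_rdistrib inner_add matrix_uminus_mult inner_commute[of "H N *v b"])
    ultimately show ?thesis by (simp add: x0 y0 sumN)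
  qed
  have sum0: "P 0 + H 0 = matrix_inv \<Sigma>0"
  proof -
    have D1i: "invertible D1" and D2i: "invertible D2" and SNi: "invertible \<Sigma>N" and S0i: "invertible \<Sigma>0"
      using D S0 SN pos_def_invertible by auto
    have "matrix_inv \<Sigma>0 *v z = (P 0 + H 0) *v z" for z
    proof -
      \<comment> \<open>the terminal state of the trajectory with \<open>p = - H x\<close> that starts at \<open>z\<close>\<close>
      define b where "b = matrix_inv D2 *v (matrix_inv \<phi> *v z)"
      have z: "z = \<phi> *v (D2 *v b)" by (simp add: b_def matrix_inv_vector D2i \<phi>(2))
      have e': "D2 *v (\<Sigma>N *v (D1 *v y)) = matrix_inv \<phi> *v (\<Sigma>0 *v (transpose (matrix_inv \<phi>) *v y))" for y
      proof -
        have "transpose (D1 ** \<Sigma>N ** D2) = D2 ** \<Sigma>N ** D1"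
          using pos_def_sym[OF D(1)] pos_def_sym[OF D(2)] pos_def_sym[OF SN]
          by (simp add: matrix_transpose_mul matrix_mul_assoc)
        moreover have "transpose (matrix_inv \<phi> ** \<Sigma>0 ** transpose (matrix_inv \<phi>))
            = matrix_inv \<phi> ** \<Sigma>0 ** transpose (matrix_inv \<phi>)"
          using S0 by (simp add: matrix_transpose_mul pos_def_sym matrix_mul_assoc)
        ultimately show ?thesis using D(4)
          by (metis matrix_vector_mul_assoc)
      qed
      define y where "y = matrix_inv D1 *v (matrix_inv \<Sigma>N *v b)"
      have "D2 *v b = matrix_inv \<phi> *v (\<Sigma>0 *v (transpose (matrix_inv \<phi>) *v y))"
        using e'[of y] by (simp add: y_def matrix_inv_vector D1i SNi)
      then have zy: "matrix_inv \<Sigma>0 *v z = transpose (matrix_inv \<phi>) *v y"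
        by (simp add: z matrix_inv_vector \<phi>(2) S0i)
      have "w \<bullet> (matrix_inv \<Sigma>0 *v z) = w \<bullet> ((P 0 + H 0) *v z)" for w
      proof -
        define a where "a = matrix_inv D1 *v (matrix_inv \<phi> *v w)"
        have w: "w = \<phi> *v (D1 *v a)" by (simp add: a_def matrix_inv_vector D1i \<phi>(2))
        have "w \<bullet> (matrix_inv \<Sigma>0 *v z) = (D1 *v a) \<bullet> y"
          unfolding zy by (simp add: w matrix_inv_vector \<phi>(2) flip: inner_matrix_left)
        also have "\<dots> = a \<bullet> (matrix_inv \<Sigma>N *v b)"
          using D(1) by (simp add: inner_matrix_left pos_def_sym y_def matrix_inv_vector D1i)
        also have "\<dots> = w \<bullet> ((P 0 + H 0) *v z)" by (simp add: initial w z)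
        finally show ?thesis .
      qed
      then show ?thesis
        using vector_eq_ldot[of "matrix_inv \<Sigma>0 *v z" "(P 0 + H 0) *v z"] by blast
    qed
    then show ?thesis unfolding matrix_eq by metis
  qed
  show ?thesis
  proof (rule riccati_pair.intro[OF lq_data_axioms riccati_pair_axioms.intro])
    show "pos_def \<Sigma>0" "pos_def \<Sigma>N" by (rule S0, rule SN)
    show "P N + H N = matrix_inv \<Sigma>N" by (rule sumN)
    show "P 0 + H 0 = matrix_inv \<Sigma>0" by (rule sum0)
  qed (rule Psym Hsym Pw Hw Ps Hs pd; assumption)+
qed

lemma riccati_pair_of_boundary_data:
  fixes A Q :: "nat \<Rightarrow> real^'n^'n" and B S :: "nat \<Rightarrow> real^'m^'n"
  assumes Qbar_psd: "\<forall>k<N. psd (Qbar N S Q k)"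
    and \<Sigma>0: "pos_def \<Sigma>0" and \<Sigma>N: "pos_def \<Sigma>N"
    and A1: "\<forall>k<N. invertible (Abar A B S k)"
    and reach: "invertible (gramian A B S N 0)"
    and P_N: "P N = Y_plus N A B S Q \<Sigma>0 \<Sigma>N"
    and P_step: "\<forall>k<N. P k =
           transpose (Abar A B S k) ** P (k + 1) ** Abar A B S k
         - transpose (Abar A B S k) ** P (k + 1) ** B k
             ** matrix_inv (mat 1 + transpose (B k) ** P (k + 1) ** B k)
             ** transpose (B k) ** P (k + 1) ** Abar A B S k
         + Qbar N S Q k"
    and H_N: "H N = matrix_inv \<Sigma>N - Y_plus N A B S Q \<Sigma>0 \<Sigma>N"
    and H_step: "\<forall>k<N. H k =
           transpose (Abar A B S k) ** H (k + 1) ** Abar A B S k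
         - transpose (Abar A B S k) ** H (k + 1) ** B k
             ** matrix_inv (- mat 1 + transpose (B k) ** H (k + 1) ** B k)
             ** transpose (B k) ** H (k + 1) ** Abar A B S k
         - Qbar N S Q k"
  shows "riccati_pair N (Abar A B S) B (Qbar N S Q) P H \<Sigma>0 \<Sigma>N"
proof -
  interpret lq_data N "Abar A B S" B "Qbar N S Q"
    by (rule lq_data.intro) (simp_all add: A1 Qbar_psd)
  have M: "transition (Mmat N A B S Q) 0 N = inv_prod ham_mat 0 N"
  proof -
    have "Mmat N A B S Q = ham_mat" by (simp add: fun_eq_iff Mmat_def ham_mat_def Let_def)
    then show ?thesis by (cases N) (simp_all add: transition_def)
  qed
  define \<phi> where "\<phi> = block12 (inv_prod ham_mat 0 N)"
  have \<phi>: "invertible \<phi>"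
    unfolding \<phi>_def
  proof (rule block12_invertible)
    have "gramian A B S N 0 = (\<Sum>k<N. desc_prod (Abar A B S) (Suc k) (N - Suc k) ** Gmat B k
      ** transpose (desc_prod (Abar A B S) (Suc k) (N - Suc k)))"
      by (simp add: gramian_def transition_def atLeast0LessThan)
    then show "invertible (\<Sum>k<N. desc_prod (Abar A B S) (Suc k) (N - Suc k) ** Gmat B k
      ** transpose (desc_prod (Abar A B S) (Suc k) (N - Suc k)))" using reach by simp
  qed
  define R where "R = psd_sqrt \<Sigma>N"
  define T where "T = psd_sqrt ((1/4) *\<^sub>R mat 1 + R ** matrix_inv \<phi> ** \<Sigma>0 ** transpose (matrix_inv \<phi>) ** R)"
  define D1 where "D1 = matrix_inv R ** T ** matrix_inv R + (1/2) *\<^sub>R matrix_inv \<Sigma>N"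
  define D2 where "D2 = matrix_inv R ** T ** matrix_inv R - (1/2) *\<^sub>R matrix_inv \<Sigma>N"
  note D = boundary_weights[OF \<phi> \<Sigma>0 \<Sigma>N R_def T_def D1_def D2_def]
  have D3: "D1 - D2 = matrix_inv \<Sigma>N"
    by (simp add: D1_def D2_def vec_eq_iff)
  have Y: "Y_plus N A B S Q \<Sigma>0 \<Sigma>N = - (matrix_inv \<phi> ** block11 (inv_prod ham_mat 0 N)) + D1"
    by (simp add: Y_plus_def Let_def M D1_def T_def R_def \<phi>_def)
  show ?thesis
  proof (rule riccati_pairI[OF \<Sigma>0 \<Sigma>N \<phi>_def \<phi> D(1,2) D3 D(3)])
    show "P N = - (matrix_inv \<phi> ** block11 (inv_prod ham_mat 0 N)) + D1" by (simp add: P_N Y)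
    show "- H N = - (matrix_inv \<phi> ** block11 (inv_prod ham_mat 0 N)) + D2"
      using D3 by (simp add: H_N Y algebra_simps)
    show "P k = riccati_map (Abar A B S k) (B k) (Qbar N S Q k) (P (Suc k))" if "k < N" for k
      using P_step that by (simp add: riccati_map_def)
    fix k assume k: "k < N" and inv: "invertible (input_weight (B k) (- H (Suc k)))"
    note um = matrix_uminus_mult_left matrix_uminus_mult_right
    have "- mat 1 + transpose (B k) ** H (Suc k) ** B k = - input_weight (B k) (- H (Suc k))"
      by (simp add: input_weight_def um)
    moreover have "matrix_inv (- input_weight (B k) (- H (Suc k))) = - matrix_inv (input_weight (B k) (- H (Suc k)))"
      by (rule matrix_inv_eqI(2)) (simp add: um matrix_inv_mult[OF inv])
    ultimately show "- H k = riccati_map (Abar A B S k) (B k) (Qbar N S Q k) (- H (Suc k))"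
      using H_step[rule_format, OF k] by (simp add: riccati_map_def um input_weight_def)
  qed
qed

section \<open>Linear changes of variables and Gaussian integrals\<close>

lemma borel_measurable_matrix_vector [measurable (raw)]:
  fixes A :: "real^'n^'m"
  shows "f \<in> borel_measurable M \<Longrightarrow> (\<lambda>x. A *v f x) \<in> borel_measurable M"
  by (rule borel_measurable_continuous_on[OF matrix_vector_mult_linear_continuous_on[of UNIV A]])

text \<open>
  Uniqueness of Lebesgue measure up to a factor, by Fubini: integrate \<open>f x * g (y - x)\<close> in both orders, where \<open>g\<close>
  has Lebesgue integral one, and shift variables so that \<open>f\<close> is integrated against Lebesgue measure.
\<close>
lemma translation_invariant_nn_integral:
  fixes \<mu> :: "'a::euclidean_space measure"
  assumes sets [measurable_cong]: "sets \<mu> = sets borel" and "sigma_finite_measure \<mu>"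
    and inv: "\<And>t. distr \<mu> borel (\<lambda>x. t + x) = \<mu>"
  obtains c where "\<And>f. f \<in> borel_measurable borel \<Longrightarrow> (\<integral>\<^sup>+x. f x \<partial>\<mu>) = c * (\<integral>\<^sup>+x. f x \<partial>lborel)"
proof -
  interpret \<mu>: sigma_finite_measure \<mu> by fact
  interpret pair_sigma_finite \<mu> lborel ..
  \<comment> \<open>the unit cube, of Lebesgue measure one\<close>
  define g :: "'a \<Rightarrow> ennreal" where "g = indicator (cbox 0 One)"
  have [measurable]: "g \<in> borel_measurable borel" by (simp add: g_def)
  have g1: "(\<integral>\<^sup>+y. g y \<partial>lborel) = 1"
    by (simp add: g_def emeasure_lborel_cbox_eq inner_Basis)
  have gs: "(\<integral>\<^sup>+y. g (- x + y) \<partial>lborel) = 1" for x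
    using lborel_distr_plus[of "- x"] g1 nn_integral_distr[of "(+) (- x)" lborel borel g] by simp
  have shift_\<mu>: "(\<integral>\<^sup>+x. h x \<partial>\<mu>) = (\<integral>\<^sup>+x. h (t + x) \<partial>\<mu>)" if [measurable]: "h \<in> borel_measurable borel" for h t
    by (subst inv[of t, symmetric]) (simp add: nn_integral_distr)
  have shift: "(\<integral>\<^sup>+x. h x \<partial>lborel) = (\<integral>\<^sup>+x. h (t + x) \<partial>lborel)" if [measurable]: "h \<in> borel_measurable borel"
    for h and t :: 'a
    by (subst lborel_distr_plus[of t, symmetric]) (simp add: nn_integral_distr)
  show ?thesis
  proof (rule that)
    fix f :: "'a \<Rightarrow> ennreal" assume [measurable]: "f \<in> borel_measurable borel"
    have "(\<integral>\<^sup>+x. f x \<partial>\<mu>) = (\<integral>\<^sup>+x. (\<integral>\<^sup>+y. f x * g (- x + y) \<partial>lborel) \<partial>\<mu>)"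
      by (simp add: nn_integral_cmult gs del: uminus_add_conv_diff)
    also have "\<dots> = (\<integral>\<^sup>+y. (\<integral>\<^sup>+x. f x * g (- x + y) \<partial>\<mu>) \<partial>lborel)"
      by (rule Fubini'[symmetric]) measurable
    also have "\<dots> = (\<integral>\<^sup>+y. (\<integral>\<^sup>+x. f (y + x) * g (- x) \<partial>\<mu>) \<partial>lborel)"
    proof (rule nn_integral_cong)
      fix y :: 'a
      have "(\<integral>\<^sup>+x. f x * g (- x + y) \<partial>\<mu>) = (\<integral>\<^sup>+x. f (y + x) * g (- (y + x) + y) \<partial>\<mu>)"
        by (rule shift_\<mu>) measurable
      then show "(\<integral>\<^sup>+x. f x * g (- x + y) \<partial>\<mu>) = (\<integral>\<^sup>+x. f (y + x) * g (- x) \<partial>\<mu>)"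
        by (simp add: algebra_simps)
    qed
    also have "\<dots> = (\<integral>\<^sup>+x. (\<integral>\<^sup>+y. f (x + y) * g (- x) \<partial>lborel) \<partial>\<mu>)"
      by (subst Fubini') (simp_all add: add.commute)
    also have "\<dots> = (\<integral>\<^sup>+x. g (- x) * (\<integral>\<^sup>+y. f y \<partial>lborel) \<partial>\<mu>)"
    proof (rule nn_integral_cong)
      fix x :: 'a
      have "(\<integral>\<^sup>+y. f (x + y) * g (- x) \<partial>lborel) = (\<integral>\<^sup>+y. f (x + y) \<partial>lborel) * g (- x)"
        by (rule nn_integral_multc) measurable
      then show "(\<integral>\<^sup>+y. f (x + y) * g (- x) \<partial>lborel) = g (- x) * (\<integral>\<^sup>+y. f y \<partial>lborel)"
        by (simp add: shift[of f x] mult.commute)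
    qed
    also have "\<dots> = (\<integral>\<^sup>+x. g (- x) \<partial>\<mu>) * (\<integral>\<^sup>+y. f y \<partial>lborel)"
      by (simp add: nn_integral_multc)
    finally show "(\<integral>\<^sup>+x. f x \<partial>\<mu>) = (\<integral>\<^sup>+x. g (- x) \<partial>\<mu>) * (\<integral>\<^sup>+x. f x \<partial>lborel)" .
  qed
qed

text \<open>
  The value of the Jacobian factor is irrelevant: it will be absorbed by the normalization of
  probability densities.
\<close>
lemma nn_integral_lborel_linear:
  fixes T :: "real^'n^'n"
  assumes T: "invertible T"
  obtains c :: real where "c > 0"
    "\<And>f. f \<in> borel_measurable borel \<Longrightarrow> (\<integral>\<^sup>+x. f (T *v x) \<partial>lborel) = ennreal c * (\<integral>\<^sup>+x. f x \<partial>lborel)"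
proof -
  define \<mu> where "\<mu> = distr lborel borel ((*v) T)"
  have int: "(\<integral>\<^sup>+x. f x \<partial>\<mu>) = (\<integral>\<^sup>+x. f (T *v x) \<partial>lborel)" if [measurable]: "f \<in> borel_measurable borel" for f
    by (simp add: \<mu>_def nn_integral_distr)
  have bounded: "emeasure \<mu> (cbox a b) < \<infinity>" for a b
  proof -
    have "(*v) T -` cbox a b = (*v) (matrix_inv T) ` cbox a b"
      using matrix_inv_vector[OF T] by (auto simp: image_iff) metis
    then have "bounded ((*v) T -` cbox a b)"
      by (simp add: bounded_linear_image bounded_cbox matrix_vector_mul_bounded_linear)
    then have "emeasure lborel ((*v) T -` cbox a b) < \<infinity>"
      by (rule emeasure_bounded_finite)
    then show ?thesis by (simp add: \<mu>_def emeasure_distr)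
  qed
  have sf: "sigma_finite_measure \<mu>"
  proof
    show "\<exists>A. countable A \<and> A \<subseteq> sets \<mu> \<and> \<Union> A = space \<mu> \<and> (\<forall>a\<in>A. emeasure \<mu> a \<noteq> \<infinity>)"
    proof (intro exI conjI ballI)
      let ?A = "range (\<lambda>n::nat. cbox (- real n *\<^sub>R One) (real n *\<^sub>R One)) :: (real^'n) set set"
      show "countable ?A" by auto
      show "?A \<subseteq> sets \<mu>" by (auto simp: \<mu>_def)
      show "\<Union> ?A = space \<mu>" using UN_box_eq_UNIV box_subset_cbox by (fastforce simp: \<mu>_def)
      fix a assume "a \<in> ?A"
      then show "emeasure \<mu> a \<noteq> \<infinity>" using bounded by (auto simp: less_top)
    qed
  qed
  have inv: "distr \<mu> borel (\<lambda>x. t + x) = \<mu>" for t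
  proof -
    have "distr \<mu> borel (\<lambda>x. t + x) = distr lborel borel (\<lambda>x. t + T *v x)"
      by (simp add: \<mu>_def distr_distr comp_def)
    also have "(\<lambda>x. t + T *v x) = (*v) T \<circ> (+) (matrix_inv T *v t)"
      by (auto simp: matrix_vector_right_distrib matrix_inv_vector[OF T])
    also have "distr lborel borel \<dots> = distr (distr lborel borel ((+) (matrix_inv T *v t))) borel ((*v) T)"
      by (simp add: distr_distr)
    finally show ?thesis by (simp add: lborel_distr_plus \<mu>_def)
  qed
  have s: "sets \<mu> = sets borel" by (simp add: \<mu>_def)
  obtain c where c: "\<And>f. f \<in> borel_measurable borel \<Longrightarrow> (\<integral>\<^sup>+x. f x \<partial>\<mu>) = c * (\<integral>\<^sup>+x. f x \<partial>lborel)"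
    using translation_invariant_nn_integral[OF s sf inv] by blast
  have "c * emeasure lborel (cbox 0 One :: (real^'n) set) < \<infinity>"
    using c[of "indicator (cbox 0 One)"] bounded[of 0 One] by (simp add: s)
  then have fin: "c < \<infinity>" by (simp add: emeasure_lborel_cbox_eq inner_Basis)
  have "c \<noteq> 0"
  proof
    assume "c = 0"
    then have "(\<integral>\<^sup>+x. 1 \<partial>\<mu>) = 0" using c[of "\<lambda>x. 1"] by simp
    then show False by (simp add: \<mu>_def emeasure_distr)
  qed
  then have "0 < enn2real c" "ennreal (enn2real c) = c" using fin by (auto simp: enn2real_positive_iff zero_less_iff_neq_zero)
  then show ?thesis using that[of "enn2real c"] c int by metis
qed

text \<open>
  The Jacobian factor is one because the unit ball is mapped to itself.
\<close>
lemma nn_integral_lborel_orthogonal: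
  fixes U :: "real^'n^'n"
  assumes U: "orthogonal_matrix U" and f: "f \<in> borel_measurable borel"
  shows "(\<integral>\<^sup>+x. f (U *v x) \<partial>lborel) = (\<integral>\<^sup>+x. f x \<partial>lborel)"
proof -
  have inv: "invertible U" using U by (auto simp: orthogonal_matrix_def invertible_def)
  obtain c :: real where c: "c > 0"
    "\<And>f. f \<in> borel_measurable borel \<Longrightarrow> (\<integral>\<^sup>+x. f (U *v x) \<partial>lborel) = ennreal c * (\<integral>\<^sup>+x. f x \<partial>lborel)"
    using nn_integral_lborel_linear[OF inv] by blast
  have n: "norm (U *v x) = norm x" for x
    using U by (simp add: norm_eq_sqrt_inner inner_matrix_left matrix_vector_mul_assoc orthogonal_matrix_def)
  let ?b = "ball 0 1 :: (real^'n) set"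
  have "indicator ?b (U *v x) = (indicator ?b x :: ennreal)" for x
    by (simp add: indicator_def n)
  then have "emeasure lborel ?b = ennreal c * emeasure lborel ?b"
    using c(2)[OF borel_measurable_indicator, of ?b] by simp
  moreover have "emeasure lborel ?b = ennreal (measure lborel ?b)"
    using emeasure_bounded_finite[of ?b] by (intro emeasure_eq_ennreal_measure) simp
  ultimately have "ennreal (measure lborel ?b) = ennreal (c * measure lborel ?b)"
    using c(1) by (simp add: ennreal_mult)
  then have "c = 1" using content_ball_pos[of 1 "0 :: real^'n"] c(1) by simp
  then show ?thesis using c(2)[OF f] by simp
qed

lemma nn_integral_lborel_prod_cart:
  fixes f :: "'n::finite \<Rightarrow> real \<Rightarrow> ennreal"
  assumes [measurable]: "\<And>i. f i \<in> borel_measurable borel"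
  shows "(\<integral>\<^sup>+(x::real^'n). (\<Prod>i\<in>UNIV. f i (x $ i)) \<partial>lborel) = (\<Prod>i\<in>UNIV. (\<integral>\<^sup>+x. f i x \<partial>lborel))"
proof -
  let ?a = "\<lambda>i::'n. axis i (1::real)"
  have B: "(Basis :: (real^'n) set) = range ?a" by (auto simp: Basis_vec_def)
  have inj: "inj ?a" by (auto simp: inj_on_def axis_eq_axis)
  have P: "(\<Prod>b\<in>Basis. g b) = (\<Prod>i\<in>UNIV. g (?a i))" for g :: "real^'n \<Rightarrow> ennreal"
    unfolding B by (simp add: prod.reindex[OF inj])
  have "(\<integral>\<^sup>+(x::real^'n). (\<Prod>b\<in>Basis. f (the_inv ?a b) (x \<bullet> b)) \<partial>lborel)
      = (\<Prod>b\<in>Basis. (\<integral>\<^sup>+x. f (the_inv ?a b) x \<partial>lborel))"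
    by (rule nn_integral_lborel_prod) auto
  then show ?thesis unfolding P by (simp add: the_inv_f_f[OF inj] inner_axis)
qed


lemma distr_eqI_nn_integral:
  assumes [measurable]: "T \<in> measurable M borel" and N: "sets N = sets borel"
    and eq: "\<And>f. f \<in> borel_measurable borel \<Longrightarrow> (\<integral>\<^sup>+x. f (T x) \<partial>M) = (\<integral>\<^sup>+x. f x \<partial>N)"
  shows "distr M borel T = N"
proof (rule measure_eqI)
  fix A assume "A \<in> sets (distr M borel T)"
  then have A[measurable]: "A \<in> sets borel" by simp
  have "emeasure (distr M borel T) A = (\<integral>\<^sup>+x. indicator A x \<partial>distr M borel T)" by simp
  also have "\<dots> = (\<integral>\<^sup>+x. indicator A (T x) \<partial>M)" by (rule nn_integral_distr) measurable
  also have "\<dots> = (\<integral>\<^sup>+x. indicator A x \<partial>N)" by (rule eq) measurable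
  finally show "emeasure (distr M borel T) A = emeasure N A" using A N by simp
qed (simp add: N)

lemma det_spectral:
  fixes U :: "real^'n^'n"
  assumes "orthogonal_matrix U"
  shows "det (U ** diag d ** transpose U) = prod d UNIV"
proof -
  have "det U * det (transpose U) = 1"
    using assms by (simp add: orthogonal_matrix_def det_mul[symmetric] del: det_transpose)
  moreover have "det (diag d) = prod d UNIV" by (subst det_diagonal) (simp_all add: diag_def)
  ultimately show ?thesis by (simp add: det_mul mult.assoc mult.left_commute)
qed

lemma spectral_pos_def_pos:
  fixes U :: "real^'n^'n"
  assumes U: "orthogonal_matrix U" and "pos_def (U ** diag d ** transpose U)"
  shows "0 < d i"
proof -
  have e: "column i U \<bullet> column i U = 1" by (rule orthogonal_column_inner[OF U])
  then have "column i U \<noteq> 0" by auto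
  from pos_defD[OF assms(2) this] show ?thesis by (simp add: spectral_eigenvector[OF U] e)
qed

lemma matrix_inv_spectral:
  fixes U :: "real^'n^'n"
  assumes U: "orthogonal_matrix U" and d: "\<And>i. d i \<noteq> 0"
  shows "matrix_inv (U ** diag d ** transpose U) = U ** diag (\<lambda>i. 1 / d i) ** transpose U"
proof (rule matrix_inv_eqI)
  have 1: "transpose U *v (U *v x) = x" "U *v (transpose U *v x) = x" for x
    using U by (simp_all add: matrix_vector_mul_assoc orthogonal_matrix_def)
  show "U ** diag d ** transpose U ** (U ** diag (\<lambda>i. 1 / d i) ** transpose U) = mat 1"
    unfolding matrix_eq
  proof
    fix x :: "real^'n"
    have "diag d *v (diag (\<lambda>i. 1 / d i) *v y) = y" for y
      using d by (simp add: diag_mult vec_eq_iff)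
    then show "(U ** diag d ** transpose U ** (U ** diag (\<lambda>i. 1 / d i) ** transpose U)) *v x = mat 1 *v x"
      by (simp add: matrix_vector_mul_assoc[symmetric] 1)
  qed
qed

lemma sqrt_prod: "sqrt (prod f A) = (\<Prod>i\<in>A. sqrt (f i))"
  by (induction A rule: infinite_finite_induct) (simp_all add: real_sqrt_mult)

lemma gaussian_density_spectral:
  fixes U :: "real^'n^'n"
  assumes U: "orthogonal_matrix U" and d: "\<And>i. 0 < d i"
  shows "gaussian_density 0 (U ** diag d ** transpose U) (U *v y)
      = (\<Prod>i\<in>UNIV. normal_density 0 (sqrt (d i)) (y $ i))"
proof -
  have [simp]: "transpose U *v (U *v y) = y"
    using U by (simp add: matrix_vector_mul_assoc orthogonal_matrix_def)
  have "(U *v y) \<bullet> (matrix_inv (U ** diag d ** transpose U) *v (U *v y)) = (\<Sum>i\<in>UNIV. (y $ i)^2 / d i)"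
    using matrix_inv_spectral[OF U, of d] d
    by (simp add: spectral_quadratic less_imp_neq[symmetric])
  then have 1: "exp (- (1/2) * ((U *v y) \<bullet> (matrix_inv (U ** diag d ** transpose U) *v (U *v y))))
      = (\<Prod>i\<in>UNIV. exp (- ((y $ i)^2 / (2 * d i))))"
    by (simp add: exp_sum[symmetric] sum_distrib_left sum_divide_distrib sum_negf)
  have "(2 * pi) ^ CARD('n) * prod d UNIV = (\<Prod>i\<in>UNIV. 2 * pi * d i)"
    by (simp add: prod.distrib)
  then have 2: "sqrt ((2 * pi) ^ CARD('n) * det (U ** diag d ** transpose U)) = (\<Prod>i\<in>UNIV. sqrt (2 * pi * d i))"
    by (simp add: det_spectral[OF U] sqrt_prod)
  show ?thesis
    unfolding gaussian_density_def diff_zero 1 2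
    using d by (simp add: normal_density_def prod_dividef[symmetric] less_imp_le)
qed

lemma gaussian_density_shift: "gaussian_density \<mu> \<Sigma> x = gaussian_density 0 \<Sigma> (x - \<mu>)"
  by (simp add: gaussian_density_def)

lemma borel_measurable_gaussian_density [measurable (raw)]:
  assumes [measurable]: "f \<in> borel_measurable M" "g \<in> borel_measurable M"
  shows "(\<lambda>x. gaussian_density (f x) \<Sigma> (g x)) \<in> borel_measurable M"
  unfolding gaussian_density_def by measurable

lemma pos_def_det_pos:
  fixes \<Sigma> :: "real^'n^'n"
  assumes "pos_def \<Sigma>" shows "0 < det \<Sigma>"
proof -
  obtain U d where U: "orthogonal_matrix U" "\<Sigma> = U ** diag d ** transpose U"
    using spectral_theorem[OF pos_def_sym[OF assms]] by blast
  have "0 < d i" for i using spectral_pos_def_pos[OF U(1)] U(2) assms by simp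
  then show ?thesis by (simp add: U(2) det_spectral[OF U(1)] prod_pos)
qed

lemma gaussian_density_pos: "pos_def \<Sigma> \<Longrightarrow> 0 < gaussian_density \<mu> \<Sigma> x"
  by (simp add: gaussian_density_def pos_def_det_pos)

text \<open>
  Independent centred normal coordinates with variances \<open>d\<close>. An orthogonal map turns this measure into
  the Gaussian law of an arbitrary positive definite covariance, which reduces normalization and second
  moments to dimension one.
\<close>
definition product_normal :: "('n::finite \<Rightarrow> real) \<Rightarrow> (real^'n) measure" where
  "product_normal d = density lborel (\<lambda>y. \<Prod>i\<in>UNIV. ennreal (normal_density 0 (sqrt (d i)) (y $ i)))"

lemma sets_product_normal [measurable_cong, simp]: "sets (product_normal d) = sets borel"
  by (simp add: product_normal_def)

lemma space_product_normal [simp]: "space (product_normal d) = UNIV"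
  by (simp add: product_normal_def)

lemma gaussian_eq_distr_product_normal:
  fixes U :: "real^'n^'n"
  assumes U: "orthogonal_matrix U" and d: "\<And>i. 0 < d i"
  shows "distr (product_normal d) borel ((*v) U)
    = density lborel (\<lambda>x. ennreal (gaussian_density 0 (U ** diag d ** transpose U) x))"
proof (rule distr_eqI_nn_integral)
  fix f :: "real^'n \<Rightarrow> ennreal" assume [measurable]: "f \<in> borel_measurable borel"
  let ?g = "gaussian_density 0 (U ** diag d ** transpose U)"
  have "(\<integral>\<^sup>+x. f (U *v x) \<partial>product_normal d) = (\<integral>\<^sup>+y. ennreal (?g (U *v y)) * f (U *v y) \<partial>lborel)"
    by (simp add: product_normal_def nn_integral_density gaussian_density_spectral[OF U d] prod_ennreal)
  also have "\<dots> = (\<integral>\<^sup>+x. ennreal (?g x) * f x \<partial>lborel)"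
    by (rule nn_integral_lborel_orthogonal[OF U, of "\<lambda>x. ennreal (?g x) * f x"]) measurable
  finally show "(\<integral>\<^sup>+x. f (U *v x) \<partial>product_normal d) = (\<integral>\<^sup>+x. f x \<partial>density lborel (\<lambda>x. ennreal (?g x)))"
    by (simp add: nn_integral_density)
next
  show "(*v) U \<in> measurable (product_normal d) borel" by measurable
qed simp

lemma nn_integral_normal_density: "0 < \<sigma> \<Longrightarrow> (\<integral>\<^sup>+x. ennreal (normal_density 0 \<sigma> x) \<partial>lborel) = 1"
  using prob_space.emeasure_space_1[OF prob_space_normal_density, of \<sigma> 0] by (simp add: emeasure_density)

lemma prob_space_product_normal:
  assumes d: "\<And>i. 0 < d i"
  shows "prob_space (product_normal d)"
proof
  have "(\<integral>\<^sup>+y. (\<Prod>i\<in>UNIV. ennreal (normal_density 0 (sqrt (d i)) (y $ i))) \<partial>lborel) = 1"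
    using d by (subst nn_integral_lborel_prod_cart) (simp_all add: nn_integral_normal_density)
  then show "emeasure (product_normal d) (space (product_normal d)) = 1"
    by (simp add: product_normal_def emeasure_density)
qed

lemma product_normal_square:
  assumes d: "\<And>i. 0 < d i"
  shows "(\<integral>\<^sup>+y. ennreal ((y $ i)^2) \<partial>product_normal d) = ennreal (d i)"
proof -
  let ?n = "\<lambda>k x. ennreal (normal_density 0 (sqrt (d k)) x)"
  let ?f = "\<lambda>k x. if k = i then ?n k x * ennreal (x^2) else ?n k x"
  have *: "(\<Prod>k\<in>UNIV. ?n k (y $ k)) * ennreal ((y $ i)^2) = (\<Prod>k\<in>UNIV. ?f k (y $ k))" for y :: "real^'a"
  proof -
    have "(\<Prod>k\<in>UNIV. ?f k (y $ k)) = ?f i (y $ i) * (\<Prod>k\<in>UNIV - {i}. ?f k (y $ k))"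
      by (rule prod.remove) auto
    also have "(\<Prod>k\<in>UNIV - {i}. ?f k (y $ k)) = (\<Prod>k\<in>UNIV - {i}. ?n k (y $ k))"
      by (rule prod.cong) auto
    finally show ?thesis
      using prod.remove[of UNIV i "\<lambda>k. ?n k (y $ k)"] by (simp add: mult_ac)
  qed
  have sq: "(\<integral>\<^sup>+x. ?n i x * ennreal (x^2) \<partial>lborel) = ennreal (d i)"
  proof -
    have "has_bochner_integral lborel (\<lambda>x. normal_density 0 (sqrt (d i)) x * x^2) (d i)"
      using normal_moment_even[of "sqrt (d i)" 0 1] d[of i] by (simp add: fact_numeral)
    then have "(\<integral>\<^sup>+x. ennreal (normal_density 0 (sqrt (d i)) x * x^2) \<partial>lborel) = ennreal (d i)"
      using has_bochner_integral_iff by (subst nn_integral_eq_integral) auto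
    then show ?thesis by (simp add: ennreal_mult')
  qed
  have "(\<integral>\<^sup>+y. ennreal ((y $ i)^2) \<partial>product_normal d) = (\<integral>\<^sup>+y. (\<Prod>k\<in>UNIV. ?f k (y $ k)) \<partial>lborel)"
    by (simp add: product_normal_def nn_integral_density *)
  also have "\<dots> = (\<Prod>k\<in>UNIV. \<integral>\<^sup>+x. ?f k x \<partial>lborel)"
    by (rule nn_integral_lborel_prod_cart) measurable
  also have "\<dots> = (\<Prod>k\<in>UNIV. if k = i then ennreal (d i) else 1)"
    using d sq by (intro prod.cong) (auto simp: nn_integral_normal_density)
  finally show ?thesis by simp
qed

text \<open>
  Mixed moments vanish because the law is invariant under flipping the sign of one coordinate.
\<close>
lemma product_normal_moments:
  assumes d: "\<And>i. 0 < d i"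
  shows "has_bochner_integral (product_normal d) (\<lambda>y. y $ i * y $ j) (if i = j then d i else 0)"
proof -
  let ?M = "product_normal d"
  have sq: "has_bochner_integral ?M (\<lambda>y. (y $ i)^2) (d i)" for i
    using d by (intro has_bochner_integral_nn_integral product_normal_square) (auto intro: less_imp_le)
  have int: "integrable ?M (\<lambda>y. y $ i * y $ j)"
  proof (rule Bochner_Integration.integrable_bound)
    show "integrable ?M (\<lambda>y. (y $ i)^2 + (y $ j)^2)"
      by (intro Bochner_Integration.integrable_add integrable.intros[OF sq])
    have "\<bar>a * b\<bar> \<le> a^2 + b^2" for a b :: real
      using sum_squares_bound[of "\<bar>a\<bar>" "\<bar>b\<bar>"] mult_nonneg_nonneg[of "\<bar>a\<bar>" "\<bar>b\<bar>"]
      unfolding abs_mult power2_abs by linarith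
    then show "AE y in ?M. norm (y $ i * y $ j) \<le> norm ((y $ i)^2 + (y $ j)^2)" by simp
  qed measurable
  show ?thesis
  proof (cases "i = j")
    case True then show ?thesis using sq[of i] by (simp add: power2_eq_square)
  next
    case False
    \<comment> \<open>the reflection in coordinate \<open>i\<close>\<close>
    define F :: "real^'a^'a" where "F = diag (\<lambda>k. if k = i then - 1 else 1)"
    have F: "(F *v y) $ k = (if k = i then - (y $ k) else y $ k)" for y k
      by (simp add: F_def diag_mult)
    have "F ** F = mat 1" by (simp add: matrix_eq matrix_vector_mul_assoc[symmetric] vec_eq_iff F)
    moreover have "transpose F = F" by (auto simp: F_def diag_def transpose_def vec_eq_iff)
    ultimately have oF: "orthogonal_matrix F" by (simp add: orthogonal_matrix)
    have "distr ?M borel ((*v) F) = ?M"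
    proof (rule distr_eqI_nn_integral)
      fix f :: "real^'a \<Rightarrow> ennreal" assume [measurable]: "f \<in> borel_measurable borel"
      let ?p = "\<lambda>y::real^'a. (\<Prod>k\<in>UNIV. ennreal (normal_density 0 (sqrt (d k)) (y $ k)))"
      have "?p (F *v y) = ?p y" for y
        by (intro prod.cong refl) (simp add: F normal_density_def)
      then have "(\<integral>\<^sup>+y. f (F *v y) \<partial>?M) = (\<integral>\<^sup>+y. ?p (F *v y) * f (F *v y) \<partial>lborel)"
        by (simp add: product_normal_def nn_integral_density)
      also have "\<dots> = (\<integral>\<^sup>+y. ?p y * f y \<partial>lborel)"
        by (rule nn_integral_lborel_orthogonal[OF oF, of "\<lambda>y. ?p y * f y"]) measurable
      finally show "(\<integral>\<^sup>+y. f (F *v y) \<partial>?M) = (\<integral>\<^sup>+y. f y \<partial>?M)"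
        by (simp add: product_normal_def nn_integral_density)
    qed simp_all
    then have "(\<integral>y. y $ i * y $ j \<partial>?M) = (\<integral>y. y $ i * y $ j \<partial>distr ?M borel ((*v) F))" by simp
    also have "\<dots> = (\<integral>y. (F *v y) $ i * (F *v y) $ j \<partial>?M)" by (rule integral_distr) measurable
    also have "\<dots> = - (\<integral>y. y $ i * y $ j \<partial>?M)" using False by (simp add: F)
    finally have "(\<integral>y. y $ i * y $ j \<partial>?M) = 0" by simp
    then show ?thesis using int False by (simp add: has_bochner_integral_iff)
  qed
qed

definition gaussian_measure :: "real^'n^'n \<Rightarrow> (real^'n) measure" where
  "gaussian_measure \<Sigma> = density lborel (\<lambda>x. ennreal (gaussian_density 0 \<Sigma> x))"

lemma gaussian_measure_diagonalize:
  fixes \<Sigma> :: "real^'n^'n"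
  assumes "pos_def \<Sigma>"
  obtains U d where "orthogonal_matrix U" "\<forall>i. 0 < d i" "\<Sigma> = U ** diag d ** transpose U"
    "gaussian_measure \<Sigma> = distr (product_normal d) borel ((*v) U)"
proof -
  obtain U d where U: "orthogonal_matrix U" "\<Sigma> = U ** diag d ** transpose U"
    using spectral_theorem[OF pos_def_sym[OF assms]] by blast
  have d: "0 < d i" for i using spectral_pos_def_pos[OF U(1)] U(2) assms by simp
  show ?thesis
    using that[of U d] U d gaussian_eq_distr_product_normal[OF U(1) d] by (simp add: gaussian_measure_def)
qed

lemma prob_space_gaussian_measure:
  fixes \<Sigma> :: "real^'n^'n"
  assumes "pos_def \<Sigma>" shows "prob_space (gaussian_measure \<Sigma>)"
proof -
  obtain U d where "orthogonal_matrix U" and U: "\<forall>i. 0 < d i" and "\<Sigma> = U ** diag d ** transpose U"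
      and U2: "gaussian_measure \<Sigma> = distr (product_normal d) borel ((*v) U)"
    by (rule gaussian_measure_diagonalize[OF assms])
  show ?thesis unfolding U2
    using U by (intro prob_space.prob_space_distr prob_space_product_normal) auto
qed

lemma gaussian_measure_moments:
  fixes \<Sigma> :: "real^'n^'n"
  assumes "pos_def \<Sigma>"
  shows "has_bochner_integral (gaussian_measure \<Sigma>) (\<lambda>x. x $ a * x $ b) (\<Sigma> $ a $ b)"
proof -
  obtain U d where "orthogonal_matrix U" and U: "\<forall>i. 0 < d i" "\<Sigma> = U ** diag d ** transpose U"
      "gaussian_measure \<Sigma> = distr (product_normal d) borel ((*v) U)"
    by (rule gaussian_measure_diagonalize[OF assms])
  have "has_bochner_integral (product_normal d) (\<lambda>y. \<Sum>i\<in>UNIV. \<Sum>j\<in>UNIV. (U $ a $ i * U $ b $ j) * (y $ i * y $ j))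
      (\<Sum>i\<in>UNIV. \<Sum>j\<in>UNIV. (U $ a $ i * U $ b $ j) * (if i = j then d i else 0))"
    using U(1) by (intro has_bochner_integral_sum has_bochner_integral_mult_right product_normal_moments) auto
  moreover have "(\<Sum>i\<in>UNIV. \<Sum>j\<in>UNIV. (U $ a $ i * U $ b $ j) * (y $ i * y $ j)) = (U *v y) $ a * (U *v y) $ b" for y
    by (simp add: matrix_vector_mult_def sum_product mult_ac)
  moreover have "(\<Sum>i\<in>UNIV. \<Sum>j\<in>UNIV. (U $ a $ i * U $ b $ j) * (if i = j then d i else 0)) = \<Sigma> $ a $ b"
    by (simp add: U(2) matrix_matrix_mult_def diag_def transpose_def if_distrib sum_distrib_left mult_ac cong: if_cong)
  ultimately have "has_bochner_integral (product_normal d) (\<lambda>y. (U *v y) $ a * (U *v y) $ b) (\<Sigma> $ a $ b)" by simp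
  then show ?thesis unfolding U(3) by (subst has_bochner_integral_distr) simp_all
qed

section \<open>Conditional densities and relative entropy\<close>

text \<open>
  The convention for \<open>\<infinity> - \<infinity>\<close> never comes into play when the integrand is bounded below by an
  integrable function; then the expectation is additive even if it is infinite.
\<close>
lemma ext_integral_add_integrable:
  assumes \<beta>[measurable]: "\<beta> \<in> borel_measurable M" and e: "integrable M e"
  shows "ext_integral M (\<lambda>x. enn2ereal (\<beta> x) + ereal (e x)) = enn2ereal (\<integral>\<^sup>+x. \<beta> x \<partial>M) + ereal (\<integral>x. e x \<partial>M)"
proof -
  define p where "p x = e2ennreal (enn2ereal (\<beta> x) + ereal (e x))" for x
  define n where "n x = e2ennreal (- (enn2ereal (\<beta> x) + ereal (e x)))" for x
  have [measurable]: "e \<in> borel_measurable M" using e by simp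
  have [measurable]: "p \<in> borel_measurable M" "n \<in> borel_measurable M"
    unfolding p_def n_def by measurable
  have pn: "p x + ennreal (- e x) = n x + (\<beta> x + ennreal (e x))" and nle: "n x \<le> ennreal (- e x)" for x
  proof -
    consider (inf) "\<beta> x = top" | (fin) b where "0 \<le> b" "\<beta> x = ennreal b"
      by (cases "\<beta> x") auto
    then have "p x + ennreal (- e x) = n x + (\<beta> x + ennreal (e x)) \<and> n x \<le> ennreal (- e x)"
    proof cases
      case inf
      then show ?thesis by (simp add: p_def n_def e2ennreal_neg)
    next
      case fin
      then have *: "p x = ennreal (b + e x)" "n x = ennreal (- (b + e x))"
        by (simp_all add: p_def n_def)
      have "ennreal (b + e x) + ennreal (- e x) = ennreal (- (b + e x)) + (ennreal b + ennreal (e x))"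
        using fin(1) by (cases "0 \<le> e x"; cases "0 \<le> b + e x")
          (auto simp: ennreal_neg ennreal_plus[symmetric] simp del: ennreal_plus)
      then show ?thesis using fin by (auto simp: * intro!: ennreal_leI)
    qed
    then show "p x + ennreal (- e x) = n x + (\<beta> x + ennreal (e x))" "n x \<le> ennreal (- e x)" by auto
  qed
  have em: "(\<integral>\<^sup>+x. ennreal (- e x) \<partial>M) < \<infinity>" and ep: "(\<integral>\<^sup>+x. ennreal (e x) \<partial>M) < \<infinity>"
    using e by (auto simp: real_integrable_def less_top)
  have "(\<integral>\<^sup>+x. p x \<partial>M) + (\<integral>\<^sup>+x. ennreal (- e x) \<partial>M) = (\<integral>\<^sup>+x. n x \<partial>M) + ((\<integral>\<^sup>+x. \<beta> x \<partial>M) + (\<integral>\<^sup>+x. ennreal (e x) \<partial>M))"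
    by (simp add: nn_integral_add[symmetric] pn)
  moreover have "(\<integral>\<^sup>+x. n x \<partial>M) < \<infinity>"
    using nn_integral_mono[of M n "\<lambda>x. ennreal (- e x)"] nle em by (simp add: order.strict_trans1)
  ultimately have "enn2ereal (\<integral>\<^sup>+x. p x \<partial>M) - enn2ereal (\<integral>\<^sup>+x. n x \<partial>M)
      = enn2ereal (\<integral>\<^sup>+x. \<beta> x \<partial>M) + ereal (enn2real (\<integral>\<^sup>+x. ennreal (e x) \<partial>M) - enn2real (\<integral>\<^sup>+x. ennreal (- e x) \<partial>M))"
    using em ep
    by (cases "\<integral>\<^sup>+x. p x \<partial>M"; cases "\<integral>\<^sup>+x. n x \<partial>M"; cases "\<integral>\<^sup>+x. \<beta> x \<partial>M";
        cases "\<integral>\<^sup>+x. ennreal (e x) \<partial>M"; cases "\<integral>\<^sup>+x. ennreal (- e x) \<partial>M")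
       (auto simp: ennreal_plus[symmetric] top_add simp del: ennreal_plus)
  then show ?thesis
    by (simp add: ext_integral_def p_def[symmetric] n_def[symmetric] real_lebesgue_integral_def[OF e])
qed

lemma ext_integral_integrable:
  "integrable M f \<Longrightarrow> ext_integral M (\<lambda>x. ereal (f x)) = ereal (\<integral>x. f x \<partial>M)"
  using ext_integral_add_integrable[of "\<lambda>_. 0" M f] by (simp add: zero_ennreal.rep_eq)

lemma ext_integral_cong_AE:
  assumes "AE x in M. f x = g x" shows "ext_integral M f = ext_integral M g"
proof -
  have "(\<integral>\<^sup>+x. e2ennreal (f x) \<partial>M) = (\<integral>\<^sup>+x. e2ennreal (g x) \<partial>M)"
    by (rule nn_integral_cong_AE) (use assms in eventually_elim, simp)
  moreover have "(\<integral>\<^sup>+x. e2ennreal (- f x) \<partial>M) = (\<integral>\<^sup>+x. e2ennreal (- g x) \<partial>M)"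
    by (rule nn_integral_cong_AE) (use assms in eventually_elim, simp)
  ultimately show ?thesis by (simp add: ext_integral_def)
qed

lemma ext_integral_nonneg_finite_integrable:
  assumes [measurable]: "f \<in> borel_measurable M" and nn: "\<And>x. 0 \<le> f x"
    and fin: "ext_integral M (\<lambda>x. ereal (f x)) \<noteq> \<infinity>"
  shows "integrable M f"
proof (rule integrableI_nonneg)
  have "(\<integral>\<^sup>+x. e2ennreal (- ereal (f x)) \<partial>M) = (\<integral>\<^sup>+x. 0 \<partial>M)"
    by (rule nn_integral_cong) (simp add: nn ennreal_neg)
  then have "ext_integral M (\<lambda>x. ereal (f x)) = enn2ereal (\<integral>\<^sup>+x. ennreal (f x) \<partial>M)"
    by (simp add: ext_integral_def zero_ennreal.rep_eq)
  then show "(\<integral>\<^sup>+x. ennreal (f x) \<partial>M) < \<infinity>" using fin by (simp add: less_top)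
qed (use nn in auto)

text \<open>
  The integrand \<open>p ln (p / q)\<close> of the relative entropy, with \<open>q - p\<close> added. The added part integrates to zero and makes
  the integrand pointwise nonnegative, so that relative entropies are integrals of nonnegative functions.
\<close>
definition kl_term :: "real \<Rightarrow> real \<Rightarrow> real" where
  "kl_term p q = p * ln p - p * ln q - p + q"

lemma kl_term_nonneg_eq_0:
  assumes p: "0 \<le> p" and q: "0 < q"
  shows "0 \<le> kl_term p q" "kl_term p q = 0 \<longleftrightarrow> p = q"
proof -
  have "0 \<le> kl_term p q \<and> (kl_term p q = 0 \<longleftrightarrow> p = q)"
  proof (cases "p = 0")
    case False
    then have p: "0 < p" using p by simp
    have eq: "kl_term p q = p * (q / p - 1 - ln (q / p))"
      using p q by (simp add: kl_term_def ln_div field_simps)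
    have "ln (q / p) \<le> q / p - 1" using p q by (intro ln_le_minus_one) simp
    then have "0 \<le> kl_term p q" unfolding eq using p by simp
    moreover have "p = q" if "kl_term p q = 0"
    proof -
      have "ln (q / p) = q / p - 1" using that p unfolding eq by simp
      then have "q / p = 1" using ln_eq_minus_one[of "q / p"] p q by simp
      then show ?thesis using p by simp
    qed
    moreover have "kl_term q q = 0" by (simp add: kl_term_def)
    ultimately show ?thesis by auto
  qed (use q in \<open>auto simp: kl_term_def\<close>)
  then show "0 \<le> kl_term p q" "kl_term p q = 0 \<longleftrightarrow> p = q" by auto
qed

lemma borel_measurable_kl_term [measurable (raw)]:
  assumes [measurable]: "f \<in> borel_measurable M" "g \<in> borel_measurable M"
  shows "(\<lambda>x. kl_term (f x) (g x)) \<in> borel_measurable M"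
  unfolding kl_term_def by measurable

lemma cond_densityD:
  assumes "cond_density Y p"
  shows "case_prod p \<in> borel_measurable (Y \<Otimes>\<^sub>M borel)" "y \<in> space Y \<Longrightarrow> 0 \<le> p y u"
    "y \<in> space Y \<Longrightarrow> (\<integral>\<^sup>+u. ennreal (p y u) \<partial>lborel) = 1"
    "y \<in> space Y \<Longrightarrow> p y \<in> borel_measurable borel"
    "y \<in> space Y \<Longrightarrow> integrable lborel (p y)" "y \<in> space Y \<Longrightarrow> (\<integral>u. p y u \<partial>lborel) = 1"
proof -
  show m: "case_prod p \<in> borel_measurable (Y \<Otimes>\<^sub>M borel)" using assms by (simp add: cond_density_def)
  show nn: "0 \<le> p y u" if "y \<in> space Y" for u using assms that by (simp add: cond_density_def)
  show one: "(\<integral>\<^sup>+u. ennreal (p y u) \<partial>lborel) = 1" if "y \<in> space Y"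
    using assms that by (simp add: cond_density_def)
  show pm[measurable]: "p y \<in> borel_measurable borel" if "y \<in> space Y"
    using measurable_Pair2[OF m that] by simp
  have "has_bochner_integral lborel (p y) 1" if "y \<in> space Y"
    using nn[OF that] one[OF that] pm[OF that] by (intro has_bochner_integral_nn_integral) auto
  then show "y \<in> space Y \<Longrightarrow> integrable lborel (p y)" "y \<in> space Y \<Longrightarrow> (\<integral>u. p y u \<partial>lborel) = 1"
    by (auto simp: has_bochner_integral_iff)
qed

lemma has_cond_density_measurable:
  assumes "has_cond_density M Y Z U p"
  shows "Z \<in> measurable M Y" "U \<in> borel_measurable M"
proof -
  have m: "(\<lambda>\<omega>. (Z \<omega>, U \<omega>)) \<in> measurable M (distr M Y Z \<Otimes>\<^sub>M lborel)"
    using assms by (simp add: has_cond_density_def distributed_def)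
  show "Z \<in> measurable M Y" using measurable_compose[OF m measurable_fst] by simp
  show "U \<in> borel_measurable M" using measurable_compose[OF m measurable_snd] by simp
qed

lemma pair_distr_measurable_eq:
  "measurable (distr M Y Z \<Otimes>\<^sub>M (lborel :: (real^'m) measure)) N = measurable (Y \<Otimes>\<^sub>M borel) N"
  by (rule measurable_cong_sets) (simp_all cong: sets_pair_measure_cong)

text \<open>
  Conditional densities matter only up to null sets of the law of the condition times Lebesgue measure.
\<close>
lemma has_cond_density_cong_AE:
  assumes c: "has_cond_density M Y Z U p" and p: "cond_density Y p" and q: "cond_density Y q"
    and ae: "AE x in distr M Y Z \<Otimes>\<^sub>M lborel. p (fst x) (snd x) = q (fst x) (snd x)"
  shows "has_cond_density M Y Z U q"
  unfolding has_cond_density_def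
proof (subst distributed_cong_density)
  note [measurable] = cond_densityD(1)[OF p] cond_densityD(1)[OF q]
  let ?N = "distr M Y Z \<Otimes>\<^sub>M (lborel :: (real^_) measure)"
  show "distributed M ?N (\<lambda>\<omega>. (Z \<omega>, U \<omega>)) (\<lambda>(y, u). ennreal (p y u))"
    using c by (simp add: has_cond_density_def)
  show "AE x in ?N. (case x of (y, u) \<Rightarrow> ennreal (q y u)) = (case x of (y, u) \<Rightarrow> ennreal (p y u))"
    using ae by eventually_elim (simp add: split_def)
  show "(\<lambda>(y, u). ennreal (p y u)) \<in> borel_measurable ?N"
    "(\<lambda>(y, u). ennreal (q y u)) \<in> borel_measurable ?N"
    unfolding pair_distr_measurable_eq by measurable
qed

text \<open>
  The control \<open>U\<close> is drawn from \<open>w\<close> given \<open>Z\<close>, and is compared with a positive reference policy \<open>g\<close>.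
\<close>
locale cond_density_pair = prob_space M
  for M :: "'w measure" and Y :: "'y measure" and Z :: "'w \<Rightarrow> 'y" and U :: "'w \<Rightarrow> real^'m"
    and w g :: "'y \<Rightarrow> real^'m \<Rightarrow> real" +
  assumes w: "cond_density Y w" and joint: "has_cond_density M Y Z U w"
    and g: "cond_density Y g" and g_pos: "\<And>y u. 0 < g y u"
begin

definition divergence :: ennreal where
  "divergence = (\<integral>\<^sup>+\<omega>. (\<integral>\<^sup>+u. ennreal (kl_term (w (Z \<omega>) u) (g (Z \<omega>) u)) \<partial>lborel) \<partial>M)"

lemma Z_measurable [measurable]: "Z \<in> measurable M Y"
  by (rule has_cond_density_measurable[OF joint])

lemma w_meas [measurable]: "case_prod w \<in> borel_measurable (Y \<Otimes>\<^sub>M borel)"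
  and g_meas [measurable]: "case_prod g \<in> borel_measurable (Y \<Otimes>\<^sub>M borel)"
  using cond_densityD(1) w g by auto

lemma space_Z: "\<omega> \<in> space M \<Longrightarrow> Z \<omega> \<in> space Y"
  using measurable_space[OF Z_measurable] .

lemma pair_sf: "pair_sigma_finite (distr M Y Z) (lborel :: (real^'m) measure)"
proof -
  interpret Zd: prob_space "distr M Y Z" by (rule prob_space_distr) measurable
  show ?thesis ..
qed

text \<open>
  Pointwise \<open>w ln w = kl_term w g + (w - g + w ln g)\<close>. The second summand is integrable, both in the control and afterwards in
  the condition, so both expectations split.
\<close>
lemma entropy_decomposition:
  assumes int: "integrable M (\<lambda>\<omega>. ln (g (Z \<omega>) (U \<omega>)))"
  shows "ext_integral M (\<lambda>\<omega>. - diff_entropy (w (Z \<omega>)))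
    = enn2ereal divergence + ereal (\<integral>\<omega>. ln (g (Z \<omega>) (U \<omega>)) \<partial>M)"
proof -
  interpret P: pair_sigma_finite "distr M Y Z" "lborel :: (real^'m) measure" by (rule pair_sf)
  let ?N = "distr M Y Z \<Otimes>\<^sub>M (lborel :: (real^'m) measure)"
  define L where "L = (\<lambda>(y, u). w y u * ln (g y u))"
  have lgm: "(\<lambda>(y, u). ln (g y u)) \<in> borel_measurable ?N" unfolding pair_distr_measurable_eq by measurable
  have D: "distributed M ?N (\<lambda>\<omega>. (Z \<omega>, U \<omega>)) (\<lambda>x. ennreal (case_prod w x))"
    using joint by (simp add: has_cond_density_def split_def)
  have wn: "0 \<le> case_prod w x" if "x \<in> space ?N" for x
    using that cond_densityD(2)[OF w] by (auto simp: space_pair_measure)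
  have L: "integrable ?N L"
    using distributed_integrable[OF D lgm wn] int by (simp add: L_def split_def)
  have Lint: "(\<integral>x. L x \<partial>?N) = (\<integral>\<omega>. ln (g (Z \<omega>) (U \<omega>)) \<partial>M)"
    using distributed_integral[OF D lgm wn] by (simp add: L_def split_def)
  define e where "e y = (\<integral>u. L (y, u) \<partial>lborel)" for y
  have eint: "integrable (distr M Y Z) e" unfolding e_def by (rule P.integrable_fst'[OF L])
  have em[measurable]: "e \<in> borel_measurable Y" using borel_measurable_integrable[OF eint] by simp
  have eM: "integrable M (\<lambda>\<omega>. e (Z \<omega>))" using eint by (simp add: integrable_distr_eq)
  have "(\<integral>y. e y \<partial>distr M Y Z) = (\<integral>x. L x \<partial>?N)" unfolding e_def by (rule P.integral_fst'[OF L])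
  then have eI: "(\<integral>\<omega>. e (Z \<omega>) \<partial>M) = (\<integral>\<omega>. ln (g (Z \<omega>) (U \<omega>)) \<partial>M)"
    by (simp add: integral_distr Lint)
  have "AE y in distr M Y Z. integrable lborel (\<lambda>u. L (y, u))" by (rule P.AE_integrable_fst'[OF L])
  then have "AE \<omega> in M. integrable lborel (\<lambda>u. L (Z \<omega>, u))"
    by (rule AE_distrD[OF Z_measurable])
  then have "AE \<omega> in M. - diff_entropy (w (Z \<omega>))
      = enn2ereal (\<integral>\<^sup>+u. ennreal (kl_term (w (Z \<omega>) u) (g (Z \<omega>) u)) \<partial>lborel) + ereal (e (Z \<omega>))"
    using AE_space
  proof eventually_elim
    fix \<omega> assume Li: "integrable lborel (\<lambda>u. L (Z \<omega>, u))" and "\<omega> \<in> space M"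
    then have z: "Z \<omega> \<in> space Y" using space_Z by blast
    note wd = cond_densityD[OF w] and gd = cond_densityD[OF g]
    have [measurable]: "w (Z \<omega>) \<in> borel_measurable borel" "g (Z \<omega>) \<in> borel_measurable borel"
      using wd(4)[OF z] gd(4)[OF z] by auto
    let ?h = "\<lambda>u. w (Z \<omega>) u - g (Z \<omega>) u + L (Z \<omega>, u)"
    have hi: "integrable lborel ?h"
      using wd(5)[OF z] gd(5)[OF z] Li by (intro Bochner_Integration.integrable_add Bochner_Integration.integrable_diff)
    have hI: "(\<integral>u. ?h u \<partial>lborel) = e (Z \<omega>)"
      using wd(5,6)[OF z] gd(5,6)[OF z] Li by (simp add: e_def)
    have "- diff_entropy (w (Z \<omega>)) = ext_integral lborel (\<lambda>u. ereal (w (Z \<omega>) u * ln (w (Z \<omega>) u)))"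
      by (simp add: diff_entropy_def)
    also have "(\<lambda>u. ereal (w (Z \<omega>) u * ln (w (Z \<omega>) u)))
        = (\<lambda>u. enn2ereal (ennreal (kl_term (w (Z \<omega>) u) (g (Z \<omega>) u))) + ereal (?h u))"
      using kl_term_nonneg_eq_0(1)[OF wd(2)[OF z] g_pos] by (simp add: kl_term_def L_def fun_eq_iff)
    also have "ext_integral lborel \<dots> = enn2ereal (\<integral>\<^sup>+u. ennreal (kl_term (w (Z \<omega>) u) (g (Z \<omega>) u)) \<partial>lborel) + ereal (e (Z \<omega>))"
      unfolding hI[symmetric] by (rule ext_integral_add_integrable[OF _ hi]) measurable
    finally show "- diff_entropy (w (Z \<omega>))
      = enn2ereal (\<integral>\<^sup>+u. ennreal (kl_term (w (Z \<omega>) u) (g (Z \<omega>) u)) \<partial>lborel) + ereal (e (Z \<omega>))" .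
  qed
  then have "ext_integral M (\<lambda>\<omega>. - diff_entropy (w (Z \<omega>)))
      = ext_integral M (\<lambda>\<omega>. enn2ereal (\<integral>\<^sup>+u. ennreal (kl_term (w (Z \<omega>) u) (g (Z \<omega>) u)) \<partial>lborel) + ereal (e (Z \<omega>)))"
    by (rule ext_integral_cong_AE)
  also have "\<dots> = enn2ereal divergence + ereal (\<integral>\<omega>. e (Z \<omega>) \<partial>M)"
    unfolding divergence_def by (rule ext_integral_add_integrable[OF _ eM]) measurable
  finally show ?thesis by (simp add: eI)
qed

text \<open>
  A vanishing integral of the nonnegative \<open>kl_term\<close> forces \<open>w = g\<close> almost everywhere.
\<close>
lemma divergence_eq_0D:
  assumes "divergence = 0"
  shows "AE x in distr M Y Z \<Otimes>\<^sub>M lborel. w (fst x) (snd x) = g (fst x) (snd x)"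
    and "AE y in distr M Y Z. AE u in lborel. w y u = g y u"
    and "has_cond_density M Y Z U g"
proof -
  interpret P: pair_sigma_finite "distr M Y Z" "lborel :: (real^'m) measure" by (rule pair_sf)
  let ?N = "distr M Y Z \<Otimes>\<^sub>M (lborel :: (real^'m) measure)"
  have km: "(\<lambda>(y, u). ennreal (kl_term (w y u) (g y u))) \<in> borel_measurable ?N"
    unfolding pair_distr_measurable_eq by measurable
  have "(\<integral>\<^sup>+x. (case x of (y, u) \<Rightarrow> ennreal (kl_term (w y u) (g y u))) \<partial>?N)
      = (\<integral>\<^sup>+y. (\<integral>\<^sup>+u. ennreal (kl_term (w y u) (g y u)) \<partial>lborel) \<partial>distr M Y Z)"
    by (subst lborel.nn_integral_fst[symmetric, OF km]) simp
  also have "\<dots> = divergence" unfolding divergence_def by (subst nn_integral_distr) measurable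
  finally have "AE x in ?N. (case x of (y, u) \<Rightarrow> ennreal (kl_term (w y u) (g y u))) = 0"
    using nn_integral_0_iff_AE[OF km] assms by simp
  then show ae: "AE x in ?N. w (fst x) (snd x) = g (fst x) (snd x)"
    using AE_space
  proof eventually_elim
    fix x assume "(case x of (y, u) \<Rightarrow> ennreal (kl_term (w y u) (g y u))) = 0" "x \<in> space ?N"
    then have "fst x \<in> space Y" "kl_term (w (fst x) (snd x)) (g (fst x) (snd x)) \<le> 0"
      by (auto simp: space_pair_measure ennreal_eq_0_iff split_def)
    then show "w (fst x) (snd x) = g (fst x) (snd x)"
      using kl_term_nonneg_eq_0[of "w (fst x) (snd x)" "g (fst x) (snd x)"] cond_densityD(2)[OF w] g_pos
      by (metis order_antisym)
  qed
  show "AE y in distr M Y Z. AE u in lborel. w y u = g y u"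
    using P.AE_pair[OF ae] by simp
  show "has_cond_density M Y Z U g"
    by (rule has_cond_density_cong_AE[OF joint w g ae])
qed

end

lemma has_cond_density_nn_integral:
  assumes c: "has_cond_density M Y Z U p" and p: "cond_density Y p"
    and f: "f \<in> borel_measurable (Y \<Otimes>\<^sub>M borel)"
  shows "(\<integral>\<^sup>+\<omega>. f (Z \<omega>, U \<omega>) \<partial>M) = (\<integral>\<^sup>+\<omega>. (\<integral>\<^sup>+u. ennreal (p (Z \<omega>) u) * f (Z \<omega>, u) \<partial>lborel) \<partial>M)"
proof -
  have [measurable]: "Z \<in> measurable M Y" by (rule has_cond_density_measurable[OF c])
  note [measurable] = f cond_densityD(1)[OF p]
  let ?N = "distr M Y Z \<Otimes>\<^sub>M (lborel :: (real^_) measure)"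
  have "(\<integral>\<^sup>+\<omega>. f (Z \<omega>, U \<omega>) \<partial>M) = (\<integral>\<^sup>+x. (case x of (y, u) \<Rightarrow> ennreal (p y u)) * f x \<partial>?N)"
    using c f by (intro distributed_nn_integral[symmetric]) (simp_all add: has_cond_density_def pair_distr_measurable_eq)
  also have "\<dots> = (\<integral>\<^sup>+y. (\<integral>\<^sup>+u. ennreal (p y u) * f (y, u) \<partial>lborel) \<partial>distr M Y Z)"
    by (subst lborel.nn_integral_fst[symmetric]) (simp_all add: pair_distr_measurable_eq)
  also have "\<dots> = (\<integral>\<^sup>+\<omega>. (\<integral>\<^sup>+u. ennreal (p (Z \<omega>) u) * f (Z \<omega>, u) \<partial>lborel) \<partial>M)"
    by (rule nn_integral_distr) measurable
  finally show ?thesis .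
qed

lemma has_cond_densityI:
  assumes Z[measurable]: "Z \<in> measurable M Y" and U[measurable]: "U \<in> borel_measurable M" and p: "cond_density Y p"
    and eq: "\<And>f. f \<in> borel_measurable (Y \<Otimes>\<^sub>M borel) \<Longrightarrow>
      (\<integral>\<^sup>+\<omega>. f (Z \<omega>, U \<omega>) \<partial>M) = (\<integral>\<^sup>+\<omega>. (\<integral>\<^sup>+u. ennreal (p (Z \<omega>) u) * f (Z \<omega>, u) \<partial>lborel) \<partial>M)"
  shows "has_cond_density M Y Z U p"
proof -
  note [measurable] = cond_densityD(1)[OF p]
  let ?N = "distr M Y Z \<Otimes>\<^sub>M (lborel :: (real^_) measure)"
  have X: "(\<lambda>\<omega>. (Z \<omega>, U \<omega>)) \<in> measurable M ?N"
    by (subst measurable_cong_sets[OF refl, of _ "Y \<Otimes>\<^sub>M borel"]) (simp_all cong: sets_pair_measure_cong)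
  have pm: "(\<lambda>(y, u). ennreal (p y u)) \<in> borel_measurable ?N" unfolding pair_distr_measurable_eq by measurable
  have "distr M ?N (\<lambda>\<omega>. (Z \<omega>, U \<omega>)) = density ?N (\<lambda>(y, u). ennreal (p y u))"
  proof (rule measure_eqI)
    fix A assume "A \<in> sets (distr M ?N (\<lambda>\<omega>. (Z \<omega>, U \<omega>)))"
    then have AN: "A \<in> sets ?N" and A[measurable]: "A \<in> sets (Y \<Otimes>\<^sub>M borel)" by (auto cong: sets_pair_measure_cong)
    have "emeasure (distr M ?N (\<lambda>\<omega>. (Z \<omega>, U \<omega>))) A = (\<integral>\<^sup>+x. indicator A x \<partial>distr M ?N (\<lambda>\<omega>. (Z \<omega>, U \<omega>)))"
      using AN by simp
    also have "\<dots> = (\<integral>\<^sup>+\<omega>. indicator A (Z \<omega>, U \<omega>) \<partial>M)"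
      using AN by (intro nn_integral_distr X) simp
    also have "\<dots> = (\<integral>\<^sup>+\<omega>. (\<integral>\<^sup>+u. ennreal (p (Z \<omega>) u) * indicator A (Z \<omega>, u) \<partial>lborel) \<partial>M)"
      by (rule eq) measurable
    also have "\<dots> = (\<integral>\<^sup>+y. (\<integral>\<^sup>+u. ennreal (p y u) * indicator A (y, u) \<partial>lborel) \<partial>distr M Y Z)"
      by (rule nn_integral_distr[symmetric]) measurable
    also have "\<dots> = (\<integral>\<^sup>+x. (case x of (y, u) \<Rightarrow> ennreal (p y u)) * indicator A x \<partial>?N)"
      by (subst lborel.nn_integral_fst[symmetric]) (simp_all add: pair_distr_measurable_eq)
    also have "\<dots> = emeasure (density ?N (\<lambda>(y, u). ennreal (p y u))) A"
      by (rule emeasure_density[symmetric, OF pm AN])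
    finally show "emeasure (distr M ?N (\<lambda>\<omega>. (Z \<omega>, U \<omega>))) A = emeasure (density ?N (\<lambda>(y, u). ennreal (p y u))) A" .
  qed simp
  then show ?thesis unfolding has_cond_density_def distributed_def using pm X by simp
qed

section \<open>Linear Gaussian transitions and square-integrable variables\<close>

lemma is_gaussian_iff:
  "is_gaussian M X 0 \<Sigma> \<longleftrightarrow> pos_def \<Sigma> \<and> X \<in> borel_measurable M \<and> distr M borel X = gaussian_measure \<Sigma>"
proof -
  have "distr M lborel X = distr M borel X" by (rule distr_cong) simp_all
  then show ?thesis
    by (auto simp: is_gaussian_def distributed_def gaussian_measure_def)
qed

lemma nn_integral_lborel_shift:
  fixes f :: "'a::euclidean_space \<Rightarrow> ennreal"
  assumes [measurable]: "f \<in> borel_measurable borel"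
  shows "(\<integral>\<^sup>+x. f (t + x) \<partial>lborel) = (\<integral>\<^sup>+x. f x \<partial>lborel)"
  by (subst (2) lborel_distr_plus[of t, symmetric]) (simp add: nn_integral_distr)

lemma nn_integral_gaussian_density:
  assumes "pos_def W"
  shows "(\<integral>\<^sup>+u. ennreal (gaussian_density \<mu> W u) \<partial>lborel) = 1"
proof -
  have "(\<integral>\<^sup>+u. ennreal (gaussian_density \<mu> W u) \<partial>lborel)
      = (\<integral>\<^sup>+u. ennreal (gaussian_density 0 W (- \<mu> + u)) \<partial>lborel)"
    by (subst gaussian_density_shift) simp
  also have "\<dots> = (\<integral>\<^sup>+u. ennreal (gaussian_density 0 W u) \<partial>lborel)"
    by (rule nn_integral_lborel_shift) measurable
  also have "\<dots> = emeasure (gaussian_measure W) (space (gaussian_measure W))"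
    by (simp add: gaussian_measure_def emeasure_density)
  finally show ?thesis using prob_space.emeasure_space_1[OF prob_space_gaussian_measure[OF assms]] by simp
qed

lemma cond_density_gaussian:
  assumes [measurable]: "m \<in> borel_measurable Y" and W: "pos_def W"
  shows "cond_density Y (\<lambda>y. gaussian_density (m y) W)"
proof -
  have "(\<lambda>(y, u). gaussian_density (m y) W u) \<in> borel_measurable (Y \<Otimes>\<^sub>M borel)" by measurable
  then show ?thesis
    using gaussian_density_pos[OF W] by (simp add: cond_density_def nn_integral_gaussian_density[OF W] less_imp_le)
qed

lemma ln_gaussian_density:
  fixes W :: "real^'m^'m"
  assumes "pos_def W"
  shows "ln (gaussian_density \<mu> W u) = - (1/2) * ((u - \<mu>) \<bullet> (matrix_inv W *v (u - \<mu>))) - ln ((2 * pi) ^ CARD('m) * det W) / 2"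
  using pos_def_det_pos[OF assms] by (simp add: gaussian_density_def ln_div ln_sqrt)

text \<open>
  The joint density of \<open>(Z, U + T Z)\<close> is a constant times the exponential of the quadratic form on the left of \<open>quad\<close>. For a fixed
  shifted control \<open>v\<close>, substitute \<open>x = C z + D v\<close>: by \<open>quad\<close> the density becomes a constant times the product of a Gaussian density in \<open>x\<close>
  and a conditional Gaussian density of \<open>v\<close> given \<open>x\<close>, which integrates to one. The constant is one since both sides have total mass one.
\<close>
lemma gaussian_transition:
  fixes C T' :: "real^'n^'n" and D :: "real^'m^'n" and F T F' :: "real^'n^'m" and \<Sigma> \<Sigma>' :: "real^'n^'n" and W W' :: "real^'m^'m"
  assumes "prob_space M" and Z: "is_gaussian M Z 0 \<Sigma>"
    and U: "has_cond_density M borel Z U (\<lambda>z. gaussian_density (F *v z - T *v z) W)"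
    and X[measurable]: "X \<in> borel_measurable M"
    and step: "AE \<omega> in M. X \<omega> = C *v Z \<omega> + D *v (U \<omega> + T *v Z \<omega>)"
    and C: "invertible C" and \<Sigma>: "pos_def \<Sigma>" and W: "pos_def W" and \<Sigma>': "pos_def \<Sigma>'" and W': "pos_def W'"
    and quad: "\<And>z v. z \<bullet> (matrix_inv \<Sigma> *v z) + (v - F *v z) \<bullet> (matrix_inv W *v (v - F *v z))
      = (C *v z + D *v v) \<bullet> (matrix_inv \<Sigma>' *v (C *v z + D *v v))
        + (v - F' *v (C *v z + D *v v)) \<bullet> (matrix_inv W' *v (v - F' *v (C *v z + D *v v)))"
  shows "is_gaussian M X 0 \<Sigma>'"
proof -
  interpret prob_space M by fact
  have [measurable]: "Z \<in> borel_measurable M" and Zd: "distr M borel Z = gaussian_measure \<Sigma>"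
    using Z by (auto simp: is_gaussian_iff)
  have [measurable]: "U \<in> borel_measurable M" by (rule has_cond_density_measurable[OF U])
  let ?w = "\<lambda>z. gaussian_density (F *v z - T *v z) W"
  have cd: "cond_density borel ?w" by (rule cond_density_gaussian[OF _ W]) measurable
  let ?G = "\<lambda>z v. gaussian_density 0 \<Sigma> z * gaussian_density (F *v z) W v"
  let ?G' = "\<lambda>x v. gaussian_density 0 \<Sigma>' x * gaussian_density (F' *v x) W' v"
  \<comment> \<open>ratio of the normalizing constants of the two joint densities\<close>
  define \<kappa> where "\<kappa> = sqrt ((2 * pi) ^ CARD('n) * det \<Sigma>') * sqrt ((2 * pi) ^ CARD('m) * det W')
      / (sqrt ((2 * pi) ^ CARD('n) * det \<Sigma>) * sqrt ((2 * pi) ^ CARD('m) * det W))"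
  have \<kappa>: "0 \<le> \<kappa>" 
    using pos_def_det_pos[OF \<Sigma>] pos_def_det_pos[OF W] pos_def_det_pos[OF \<Sigma>'] pos_def_det_pos[OF W']
    by (simp add: \<kappa>_def)
  have GG: "?G z v = \<kappa> * ?G' (C *v z + D *v v) v" for z v
  proof -
    have n: "sqrt ((2 * pi) ^ CARD('n) * det \<Sigma>') > 0" "sqrt ((2 * pi) ^ CARD('m) * det W') > 0"
      using pos_def_det_pos[OF \<Sigma>'] pos_def_det_pos[OF W'] by simp_all
    have e: "exp (- (1/2) * (z \<bullet> (matrix_inv \<Sigma> *v z))) * exp (- (1/2) * ((v - F *v z) \<bullet> (matrix_inv W *v (v - F *v z))))
      = exp (- (1/2) * ((C *v z + D *v v) \<bullet> (matrix_inv \<Sigma>' *v (C *v z + D *v v))))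
        * exp (- (1/2) * ((v - F' *v (C *v z + D *v v)) \<bullet> (matrix_inv W' *v (v - F' *v (C *v z + D *v v)))))"
      unfolding exp_add[symmetric] distrib_left[symmetric] quad ..
    have "a / s * (b / t) = s' * t' / (s * t) * (a' / s' * (b' / t'))"
      if "a * b = a' * b'" "s' > 0" "t' > 0" for a b a' b' s t s' t' :: real
      using that by simp
    from this[OF e n] show ?thesis
      unfolding gaussian_density_def \<kappa>_def diff_zero .
  qed
  obtain c where c: "c > 0"
    "\<And>f. f \<in> borel_measurable borel \<Longrightarrow> (\<integral>\<^sup>+x. f (C *v x) \<partial>lborel) = ennreal c * (\<integral>\<^sup>+x. f x \<partial>lborel)"
    using nn_integral_lborel_linear[OF C] by blast
  define K where "K = ennreal (c * \<kappa>)"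
  have main: "(\<integral>\<^sup>+\<omega>. f (X \<omega>) \<partial>M) = K * (\<integral>\<^sup>+x. f x \<partial>gaussian_measure \<Sigma>')"
    if [measurable]: "f \<in> borel_measurable borel" for f :: "real^'n \<Rightarrow> ennreal"
  proof -
    have "(\<integral>\<^sup>+\<omega>. f (X \<omega>) \<partial>M) = (\<integral>\<^sup>+\<omega>. f (C *v Z \<omega> + D *v (U \<omega> + T *v Z \<omega>)) \<partial>M)"
      by (rule nn_integral_cong_AE) (use step in eventually_elim, simp)
    also have "\<dots> = (\<integral>\<^sup>+\<omega>. (\<integral>\<^sup>+u. ennreal (?w (Z \<omega>) u) * f (C *v Z \<omega> + D *v (u + T *v Z \<omega>)) \<partial>lborel) \<partial>M)"
      using has_cond_density_nn_integral[OF U cd, of "\<lambda>(z, u). f (C *v z + D *v (u + T *v z))"] by simp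
    also have "\<dots> = (\<integral>\<^sup>+\<omega>. (\<integral>\<^sup>+v. ennreal (gaussian_density (F *v Z \<omega>) W v) * f (C *v Z \<omega> + D *v v) \<partial>lborel) \<partial>M)"
    proof (rule nn_integral_cong)
      fix \<omega>
      have "?w (Z \<omega>) u = gaussian_density (F *v Z \<omega>) W (T *v Z \<omega> + u)" for u
        by (simp add: gaussian_density_def algebra_simps)
      then show "(\<integral>\<^sup>+u. ennreal (?w (Z \<omega>) u) * f (C *v Z \<omega> + D *v (u + T *v Z \<omega>)) \<partial>lborel)
        = (\<integral>\<^sup>+v. ennreal (gaussian_density (F *v Z \<omega>) W v) * f (C *v Z \<omega> + D *v v) \<partial>lborel)"
        using nn_integral_lborel_shift[of "\<lambda>v. ennreal (gaussian_density (F *v Z \<omega>) W v) * f (C *v Z \<omega> + D *v v)" "T *v Z \<omega>"]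
        by (simp add: add.commute)
    qed
    also have "\<dots> = (\<integral>\<^sup>+z. (\<integral>\<^sup>+v. ennreal (gaussian_density (F *v z) W v) * f (C *v z + D *v v) \<partial>lborel) \<partial>gaussian_measure \<Sigma>)"
      unfolding Zd[symmetric] by (rule nn_integral_distr[symmetric]) measurable
    also have "\<dots> = (\<integral>\<^sup>+z. (\<integral>\<^sup>+v. ennreal (?G z v) * f (C *v z + D *v v) \<partial>lborel) \<partial>lborel)"
      using gaussian_density_pos[OF \<Sigma>] unfolding gaussian_measure_def
      by (subst nn_integral_density) (simp_all add: nn_integral_cmult[symmetric] ennreal_mult' less_imp_le mult.assoc)
    also have "\<dots> = (\<integral>\<^sup>+v. (\<integral>\<^sup>+z. ennreal (?G z v) * f (C *v z + D *v v) \<partial>lborel) \<partial>lborel)"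
      by (rule lborel_pair.Fubini'[symmetric]) measurable
    also have "\<dots> = (\<integral>\<^sup>+v. K * (\<integral>\<^sup>+x. ennreal (?G' x v) * f x \<partial>lborel) \<partial>lborel)"
    proof (rule nn_integral_cong)
      fix v :: "real^'m"
      let ?h = "\<lambda>x. ennreal (?G' x v) * f x"
      have "(\<integral>\<^sup>+z. ennreal (?G z v) * f (C *v z + D *v v) \<partial>lborel)
          = (\<integral>\<^sup>+z. ennreal \<kappa> * ?h (D *v v + C *v z) \<partial>lborel)"
        by (simp add: GG ennreal_mult' \<kappa> mult.assoc add.commute)
      also have "\<dots> = ennreal \<kappa> * (\<integral>\<^sup>+z. ?h (D *v v + C *v z) \<partial>lborel)"
        by (rule nn_integral_cmult) measurable
      also have "(\<integral>\<^sup>+z. ?h (D *v v + C *v z) \<partial>lborel) = ennreal c * (\<integral>\<^sup>+x. ?h (D *v v + x) \<partial>lborel)"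
        by (rule c(2)) measurable
      also have "(\<integral>\<^sup>+x. ?h (D *v v + x) \<partial>lborel) = (\<integral>\<^sup>+x. ?h x \<partial>lborel)"
        by (rule nn_integral_lborel_shift) measurable
      finally show "(\<integral>\<^sup>+z. ennreal (?G z v) * f (C *v z + D *v v) \<partial>lborel) = K * (\<integral>\<^sup>+x. ?h x \<partial>lborel)"
        using c(1) \<kappa> by (simp add: K_def ennreal_mult mult_ac)
    qed
    also have "\<dots> = K * (\<integral>\<^sup>+v. (\<integral>\<^sup>+x. ennreal (?G' x v) * f x \<partial>lborel) \<partial>lborel)"
      by (rule nn_integral_cmult) measurable
    also have "(\<integral>\<^sup>+v. (\<integral>\<^sup>+x. ennreal (?G' x v) * f x \<partial>lborel) \<partial>lborel)
        = (\<integral>\<^sup>+x. (\<integral>\<^sup>+v. ennreal (?G' x v) * f x \<partial>lborel) \<partial>lborel)"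
      by (rule lborel_pair.Fubini') measurable
    also have "\<dots> = (\<integral>\<^sup>+x. ennreal (gaussian_density 0 \<Sigma>' x) * f x \<partial>lborel)"
    proof (rule nn_integral_cong)
      fix x :: "real^'n"
      have "(\<integral>\<^sup>+v. ennreal (?G' x v) * f x \<partial>lborel)
          = (\<integral>\<^sup>+v. (ennreal (gaussian_density 0 \<Sigma>' x) * f x) * ennreal (gaussian_density (F' *v x) W' v) \<partial>lborel)"
        using gaussian_density_pos[OF \<Sigma>'] by (simp add: ennreal_mult' less_imp_le mult_ac)
      also have "\<dots> = ennreal (gaussian_density 0 \<Sigma>' x) * f x"
        by (subst nn_integral_cmult) (simp_all add: nn_integral_gaussian_density[OF W'])
      finally show "(\<integral>\<^sup>+v. ennreal (?G' x v) * f x \<partial>lborel) = ennreal (gaussian_density 0 \<Sigma>' x) * f x" .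
    qed
    also have "\<dots> = (\<integral>\<^sup>+x. f x \<partial>gaussian_measure \<Sigma>')"
      by (simp add: gaussian_measure_def nn_integral_density)
    finally show ?thesis .
  qed
  have "K = 1"
    using main[of "\<lambda>_. 1"] emeasure_space_1
      prob_space.emeasure_space_1[OF prob_space_gaussian_measure[OF \<Sigma>']] by simp
  then have "distr M borel X = gaussian_measure \<Sigma>'"
    using main by (intro distr_eqI_nn_integral) (simp_all add: gaussian_measure_def)
  then show ?thesis using \<Sigma>' X by (simp add: is_gaussian_iff)
qed

definition sq_integrable :: "'w measure \<Rightarrow> ('w \<Rightarrow> real^'n) \<Rightarrow> bool" where
  "sq_integrable M X \<longleftrightarrow> X \<in> borel_measurable M \<and> integrable M (\<lambda>\<omega>. (norm (X \<omega>))\<^sup>2)"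

lemma sq_integrable_inner:
  fixes X Y :: "'w \<Rightarrow> real^'n"
  assumes X: "sq_integrable M X" and Y: "sq_integrable M Y"
  shows "integrable M (\<lambda>\<omega>. X \<omega> \<bullet> Y \<omega>)"
proof (rule Bochner_Integration.integrable_bound)
  have [measurable]: "X \<in> borel_measurable M" "Y \<in> borel_measurable M"
    using X Y by (auto simp: sq_integrable_def)
  show "integrable M (\<lambda>\<omega>. (norm (X \<omega>))\<^sup>2 + (norm (Y \<omega>))\<^sup>2)"
    using X Y by (auto simp: sq_integrable_def)
  have "\<bar>x \<bullet> y\<bar> \<le> (norm x)\<^sup>2 + (norm y)\<^sup>2" for x y :: "real^'n"
    using Cauchy_Schwarz_ineq2[of x y] sum_squares_bound[of "norm x" "norm y"]
      mult_nonneg_nonneg[of "norm x" "norm y"] by linarith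
  then show "AE \<omega> in M. norm (X \<omega> \<bullet> Y \<omega>) \<le> norm ((norm (X \<omega>))\<^sup>2 + (norm (Y \<omega>))\<^sup>2)" by simp
  show "(\<lambda>\<omega>. X \<omega> \<bullet> Y \<omega>) \<in> borel_measurable M" by measurable
qed

lemma sq_integrable_add:
  fixes X Y :: "'w \<Rightarrow> real^'n"
  assumes X: "sq_integrable M X" and Y: "sq_integrable M Y"
  shows "sq_integrable M (\<lambda>\<omega>. X \<omega> + Y \<omega>)"
proof -
  have [measurable]: "X \<in> borel_measurable M" "Y \<in> borel_measurable M"
    using X Y by (auto simp: sq_integrable_def)
  have "(norm (x + y))\<^sup>2 = (norm x)\<^sup>2 + 2 * (x \<bullet> y) + (norm y)\<^sup>2" for x y :: "real^'n"
    by (simp add: power2_norm_eq_inner inner_add inner_commute)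
  then show ?thesis
    using X Y sq_integrable_inner[OF X Y] by (auto simp: sq_integrable_def)
qed

lemma sq_integrable_matrix:
  assumes X: "sq_integrable M X"
  shows "sq_integrable M (\<lambda>\<omega>. A *v X \<omega>)"
proof -
  have [measurable]: "X \<in> borel_measurable M" using X by (auto simp: sq_integrable_def)
  obtain K where K: "\<And>x. norm (A *v x) \<le> norm x * K"
    using bounded_linear.bounded[OF matrix_vector_mul_bounded_linear[of A]] by blast
  have "integrable M (\<lambda>\<omega>. (norm (A *v X \<omega>))\<^sup>2)"
  proof (rule Bochner_Integration.integrable_bound)
    show "integrable M (\<lambda>\<omega>. K\<^sup>2 * (norm (X \<omega>))\<^sup>2)" using X by (auto simp: sq_integrable_def)
    have "(norm (A *v x))\<^sup>2 \<le> K\<^sup>2 * (norm x)\<^sup>2" for x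
      using power_mono[OF K[of x], of 2] by (simp add: power_mult_distrib mult.commute)
    then show "AE \<omega> in M. norm ((norm (A *v X \<omega>))\<^sup>2) \<le> norm (K\<^sup>2 * (norm (X \<omega>))\<^sup>2)" by simp
  qed measurable
  then show ?thesis by (simp add: sq_integrable_def)
qed

lemma sq_integrable_diff:
  assumes X: "sq_integrable M X" and Y: "sq_integrable M Y"
  shows "sq_integrable M (\<lambda>\<omega>. X \<omega> - Y \<omega>)"
  using sq_integrable_add[OF X sq_integrable_matrix[OF Y, of "- mat 1"]]
  by (simp add: matrix_uminus_mult)

lemma sq_integrable_cong_AE:
  assumes "X \<in> borel_measurable M" "sq_integrable M Y" "AE \<omega> in M. X \<omega> = Y \<omega>"
  shows "sq_integrable M X"
proof -
  have [measurable]: "X \<in> borel_measurable M" "Y \<in> borel_measurable M"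
    using assms by (auto simp: sq_integrable_def)
  have "AE \<omega> in M. (norm (X \<omega>))\<^sup>2 = (norm (Y \<omega>))\<^sup>2" using assms(3) by eventually_elim simp
  then have "integrable M (\<lambda>\<omega>. (norm (X \<omega>))\<^sup>2) \<longleftrightarrow> integrable M (\<lambda>\<omega>. (norm (Y \<omega>))\<^sup>2)"
    by (intro integrable_cong_AE) measurable
  then show ?thesis using assms by (simp add: sq_integrable_def)
qed

lemma is_gaussian_moments:
  fixes X :: "'w \<Rightarrow> real^'n"
  assumes "is_gaussian M X 0 \<Sigma>"
  shows "sq_integrable M X" "second_moment M X = \<Sigma>"
proof -
  have \<Sigma>: "pos_def \<Sigma>" and [measurable]: "X \<in> borel_measurable M" and d: "distr M borel X = gaussian_measure \<Sigma>"
    using assms by (auto simp: is_gaussian_iff)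
  have *: "has_bochner_integral M (\<lambda>\<omega>. X \<omega> $ a * X \<omega> $ b) (\<Sigma> $ a $ b)" for a b
    using gaussian_measure_moments[OF \<Sigma>, of a b] unfolding d[symmetric]
    by (simp add: has_bochner_integral_iff integrable_distr_eq integral_distr)
  have "integrable M (\<lambda>\<omega>. \<Sum>a\<in>UNIV. X \<omega> $ a * X \<omega> $ a)"
    using * by (intro Bochner_Integration.integrable_sum) (auto simp: has_bochner_integral_iff)
  then show "sq_integrable M X" by (simp add: sq_integrable_def power2_norm_eq_inner inner_vec_def)
  show "second_moment M X = \<Sigma>"
    using * by (simp add: second_moment_def vec_eq_iff has_bochner_integral_iff)
qed

lemma is_gaussian_expectation_cong:
  fixes X :: "'w \<Rightarrow> real^'n" and X' :: "'v \<Rightarrow> real^'n"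
  assumes "is_gaussian M X 0 \<Sigma>" "is_gaussian M' X' 0 \<Sigma>"
  shows "(\<integral>\<omega>. X \<omega> \<bullet> (A *v X \<omega>) \<partial>M) = (\<integral>\<omega>. X' \<omega> \<bullet> (A *v X' \<omega>) \<partial>M')"
proof -
  have [measurable]: "X \<in> borel_measurable M" "X' \<in> borel_measurable M'"
    and d: "distr M borel X = distr M' borel X'"
    using assms by (auto simp: is_gaussian_iff)
  have "(\<integral>\<omega>. X \<omega> \<bullet> (A *v X \<omega>) \<partial>M) = (\<integral>x. x \<bullet> (A *v x) \<partial>distr M borel X)"
    by (subst integral_distr) simp_all
  also have "\<dots> = (\<integral>\<omega>. X' \<omega> \<bullet> (A *v X' \<omega>) \<partial>M')"
    unfolding d by (subst integral_distr) simp_all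
  finally show ?thesis .
qed

section \<open>The optimal processes and their stage costs\<close>

text \<open>
  A policy that depends on the condition only through \<open>\<pi>\<close> is also the conditional density given \<open>\<pi>\<close>.
\<close>
lemma has_cond_density_project:
  fixes \<pi> :: "'y \<Rightarrow> real^'n" and q :: "real^'n \<Rightarrow> real^'m \<Rightarrow> real"
  assumes c: "has_cond_density M Y Z U (\<lambda>y. q (\<pi> y))" and \<pi>[measurable]: "\<pi> \<in> borel_measurable Y"
    and q: "cond_density borel q"
  shows "cond_density Y (\<lambda>y. q (\<pi> y))" "has_cond_density M borel (\<lambda>\<omega>. \<pi> (Z \<omega>)) U q"
proof -
  note [measurable] = cond_densityD(1)[OF q] has_cond_density_measurable[OF c]
  show p: "cond_density Y (\<lambda>y. q (\<pi> y))"
    using q by (auto simp: cond_density_def)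
  show "has_cond_density M borel (\<lambda>\<omega>. \<pi> (Z \<omega>)) U q"
  proof (rule has_cond_densityI[OF _ _ q])
    fix f :: "(real^'n) \<times> (real^'m) \<Rightarrow> ennreal" assume [measurable]: "f \<in> borel_measurable (borel \<Otimes>\<^sub>M borel)"
    show "(\<integral>\<^sup>+\<omega>. f (\<pi> (Z \<omega>), U \<omega>) \<partial>M) = (\<integral>\<^sup>+\<omega>. (\<integral>\<^sup>+u. ennreal (q (\<pi> (Z \<omega>)) u) * f (\<pi> (Z \<omega>), u) \<partial>lborel) \<partial>M)"
      using has_cond_density_nn_integral[OF c p, of "\<lambda>(y, u). f (\<pi> y, u)"] by simp
  qed measurable
qed

lemma sum_extended_costs:
  "(\<Sum>k\<in>K. enn2ereal (D k) + ereal (s k)) = enn2ereal (\<Sum>k\<in>K. D k) + ereal (\<Sum>k\<in>K. s k)"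
proof (induction K rule: infinite_finite_induct)
  case (insert k K)
  have "(a + ereal x) + (b + ereal y) = (a + b) + ereal (x + y)" for a b x y
    by (simp add: ac_simps flip: plus_ereal.simps(1))
  then show ?case using insert by (simp add: plus_ennreal.rep_eq)
qed (simp_all add: zero_ennreal.rep_eq)

text \<open>
  The Riccati pair of the density control problem, with the original matrices \<open>A\<close>, \<open>B\<close>, \<open>S\<close>, \<open>Q\<close> as parameters.
\<close>
locale maxent_pair =
  riccati_pair N "Abar A B S" B "Qbar N S Q" P H \<Sigma>0 \<Sigma>N
  for N :: nat and A Q :: "nat \<Rightarrow> real^'n^'n" and B S :: "nat \<Rightarrow> real^'m^'n"
    and P H :: "nat \<Rightarrow> real^'n^'n" and \<Sigma>0 \<Sigma>N :: "real^'n^'n"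
begin

definition bridge_cov :: "nat \<Rightarrow> real^'n^'n" where "bridge_cov k = matrix_inv (P k + H k)"

definition backward_cov :: "nat \<Rightarrow> real^'m^'m" where "backward_cov k = input_weight (B k) (- H (Suc k))"

definition forward_cov :: "nat \<Rightarrow> real^'m^'m" where "forward_cov k = matrix_inv (input_weight (B k) (P (Suc k)))"

abbreviation "gain k \<equiv> lq_gain (Abar A B S k) (B k) (P (Suc k))"
abbreviation "w_star \<equiv> backward_policy_star B H"
abbreviation "p_star \<equiv> forward_policy_star A B S P"

lemma bridge_cov_pos_def: "k \<le> N \<Longrightarrow> pos_def (bridge_cov k)"
  using pos_def_matrix_inv[OF sum_pos_def] by (simp add: bridge_cov_def)

lemma bridge_cov_inv: "k \<le> N \<Longrightarrow> matrix_inv (bridge_cov k) = P k + H k"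
  using matrix_inv_inv[OF pos_def_invertible[OF sum_pos_def]] by (simp add: bridge_cov_def)

lemma bridge_cov_ends: "bridge_cov 0 = \<Sigma>0" "bridge_cov N = \<Sigma>N"
  using matrix_inv_inv[OF pos_def_invertible] S0 SN by (simp_all add: bridge_cov_def sum_0 sum_N)

lemma backward_cov_pos_def: "k < N \<Longrightarrow> pos_def (backward_cov k)"
  using H_weight by (simp add: backward_cov_def)

lemma forward_cov_pos_def: "k < N \<Longrightarrow> pos_def (forward_cov k)"
  using pos_def_matrix_inv[OF P_weight] by (simp add: forward_cov_def)

lemma forward_cov_inv: "k < N \<Longrightarrow> matrix_inv (forward_cov k) = input_weight (B k) (P (Suc k))"
  using matrix_inv_inv[OF pos_def_invertible[OF P_weight]] by (simp add: forward_cov_def)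

lemma w_star_eq:
  "w_star k y = gaussian_density (transpose (B k) *v (H (Suc k) *v y)) (backward_cov k)"
  by (simp add: backward_policy_star_def backward_cov_def input_weight_def matrix_vector_mul_assoc
      matrix_uminus_mult_left matrix_uminus_mult_right)

lemma p_star_eq:
  assumes k: "k < N"
  shows "p_star k h = gaussian_density (gain k *v fst h k - transpose (S k) *v fst h k) (forward_cov k)"
proof -
  let ?V = "input_weight (B k) (P (Suc k))"
  have V: "invertible ?V" using P_weight[OF k] pos_def_invertible by blast
  have "transpose (B k) *v (P (Suc k) *v (A k *v z)) + transpose (S k) *v z
      = transpose (B k) *v (P (Suc k) *v (Abar A B S k *v z)) + ?V *v (transpose (S k) *v z)" for z
    by (simp add: Abar_def input_weight_def matrix_vector_mult_diff_rdistrib matrix_vector_mult_diff_distrib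
        matrix_vector_mult_add_rdistrib matrix_vector_mul_assoc[symmetric])
  then have "- (matrix_inv ?V ** (transpose (B k) ** P (Suc k) ** A k + transpose (S k)) *v z)
      = gain k *v z - transpose (S k) *v z" for z
    by (simp add: lq_gain_def matrix_uminus_mult matrix_vector_mul_assoc[symmetric]
        matrix_vector_mult_add_rdistrib matrix_vector_right_distrib matrix_inv_vector[OF V])
  then show ?thesis
    by (simp add: forward_policy_star_def Let_def forward_cov_def input_weight_def)
qed

text \<open>
  The time-reversal identity in terms of covariances, in the form required by \<open>gaussian_transition\<close>.
\<close>
lemma exchange_square:
  assumes k: "k < N" and a: "a = Abar A B S k *v x + B k *v v"
  shows "a \<bullet> (matrix_inv (bridge_cov (Suc k)) *v a)
      + (v - transpose (B k) *v (H (Suc k) *v a)) \<bullet> (matrix_inv (backward_cov k) *v (v - transpose (B k) *v (H (Suc k) *v a)))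
    = x \<bullet> (matrix_inv (bridge_cov k) *v x)
      + (v - gain k *v x) \<bullet> (matrix_inv (forward_cov k) *v (v - gain k *v x))"
  using riccati_exchange_square[OF P_sym _ P_step[OF k] H_sym _ H_step[OF k] a refl refl] k
    pos_def_invertible[OF P_weight[OF k]] pos_def_invertible[OF H_weight[OF k]]
  by (simp add: bridge_cov_inv forward_cov_inv backward_cov_def)

text \<open>
  Control energy plus the log-density of the optimal policy is, up to a number, a difference of quadratic forms
  in two consecutive states, so that it telescopes.
\<close>
lemma backward_square:
  assumes k: "k < N" and a: "a = Abar A B S k *v x + B k *v v"
  shows "1/2 * (norm v)\<^sup>2 + ln (w_star k a v)
    = 1/2 * (a \<bullet> (H (Suc k) *v a)) - 1/2 * (x \<bullet> ((H k + Qbar N S Q k) *v x))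
      - ln ((2 * pi) ^ CARD('m) * det (backward_cov k)) / 2"
  using riccati_dual_square[OF H_sym _ H_step[OF k] a refl] k pos_def_invertible[OF H_weight[OF k]]
  by (simp add: w_star_eq ln_gaussian_density[OF backward_cov_pos_def[OF k]] power2_norm_eq_inner)
     (simp add: backward_cov_def)

text \<open>
  The forward counterpart; \<open>v\<close> is the control after removal of the cross term.
\<close>
lemma forward_square:
  assumes k: "k < N" and v: "v = u + transpose (S k) *v fst h k" and a: "a = Abar A B S k *v fst h k + B k *v v"
  shows "1/2 * (fst h k \<bullet> (Qbar N S Q k *v fst h k) + (norm v)\<^sup>2) + ln (p_star k h u)
    = 1/2 * (fst h k \<bullet> (P k *v fst h k)) - 1/2 * (a \<bullet> (P (Suc k) *v a))
      - ln ((2 * pi) ^ CARD('m) * det (forward_cov k)) / 2"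
proof -
  have u: "u - (gain k *v fst h k - transpose (S k) *v fst h k) = v - gain k *v fst h k"
    by (simp add: v)
  have half: "1/2 * (q + n) + (- (1/2) * s - c) = 1/2 * t - 1/2 * y - c" if "n + y + q = t + s"
    for q n s t y c :: real
    using that by (simp add: field_simps)
  have V: "invertible (input_weight (B k) (P (Suc k)))" using pos_def_invertible[OF P_weight[OF k]] .
  have sym: "transpose (P (Suc k)) = P (Suc k)" using P_sym[of "Suc k"] k by simp
  show ?thesis
    unfolding p_star_eq[OF k] ln_gaussian_density[OF forward_cov_pos_def[OF k]] power2_norm_eq_inner u
      forward_cov_inv[OF k] a
    by (rule half) (use riccati_completing_square[OF sym V, of v "Abar A B S k" "fst h k" "Qbar N S Q k"]
        in \<open>simp add: P_step[OF k]\<close>)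
qed

lemma w_star_cond_density: "k < N \<Longrightarrow> cond_density borel (w_star k)"
  using cond_density_gaussian[OF _ backward_cov_pos_def, of "\<lambda>y. transpose (B k) *v (H (Suc k) *v y)" borel k]
  by (simp add: w_star_eq[abs_def])

lemma w_star_pos: "k < N \<Longrightarrow> 0 < w_star k y v"
  by (simp add: w_star_eq gaussian_density_pos[OF backward_cov_pos_def])

text \<open>
  The optimal forward policy as a function of the current state only.
\<close>
definition state_policy :: "nat \<Rightarrow> real^'n \<Rightarrow> real^'m \<Rightarrow> real" where
  "state_policy k x = gaussian_density (gain k *v x - transpose (S k) *v x) (forward_cov k)"

lemma state_policy_cond_density: "k < N \<Longrightarrow> cond_density borel (state_policy k)"
  using cond_density_gaussian[OF _ forward_cov_pos_def, of "\<lambda>x. gain k *v x - transpose (S k) *v x" borel k]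
  by (simp add: state_policy_def[abs_def])

lemma p_star_state: "k < N \<Longrightarrow> p_star k = (\<lambda>h. state_policy k (fst h k))"
  by (simp add: fun_eq_iff p_star_eq state_policy_def)

lemma current_state_measurable [measurable]: "(\<lambda>h. fst h k) \<in> borel_measurable (hist_space k)"
  unfolding hist_space_def by (rule measurable_compose[OF measurable_fst]) (rule measurable_component_singleton, simp)

lemma p_star_cond_density: "k < N \<Longrightarrow> cond_density (hist_space k) (p_star k)"
  using state_policy_cond_density[of k] cond_densityD(1)[OF state_policy_cond_density, of k]
  by (auto simp: p_star_state cond_density_def)

lemma p_star_pos: "k < N \<Longrightarrow> 0 < p_star k h u"
  by (simp add: p_star_eq gaussian_density_pos[OF forward_cov_pos_def])

lemma backward_star_gaussian:
  assumes b: "backward_process N A B S \<Sigma>N w_star M \<xi> v" and k: "k \<le> N"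
  shows "is_gaussian M (\<xi> k) 0 (bridge_cov k)"
  using k
proof (induction k rule: inc_induct)
  case base
  then show ?case using b by (simp add: backward_process_def bridge_cov_ends)
next
  case (step k)
  then have k: "k < N" by simp
  let ?Ai = "matrix_inv (Abar A B S k)"
  have Ai: "invertible (Abar A B S k)" by (rule Ab_inv[OF k])
  show ?case
  proof (rule gaussian_transition[where F = "transpose (B k) ** H (Suc k)" and T = 0
        and C = ?Ai and D = "- (?Ai ** B k)" and F' = "gain k" and W' = "forward_cov k"
        and Z = "\<xi> (Suc k)" and U = "v k" and \<Sigma> = "bridge_cov (Suc k)" and W = "backward_cov k"])
    show "prob_space M" "\<xi> k \<in> borel_measurable M" using b k by (auto simp: backward_process_def)
    show "is_gaussian M (\<xi> (Suc k)) 0 (bridge_cov (Suc k))" by (rule step.IH)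
    show "has_cond_density M borel (\<xi> (Suc k)) (v k)
       (\<lambda>z. gaussian_density ((transpose (B k) ** H (Suc k)) *v z - 0 *v z) (backward_cov k))"
      using b k by (simp add: backward_process_def w_star_eq[abs_def] matrix_vector_mul_assoc)
    have "AE \<omega> in M. \<xi> k \<omega> = ?Ai *v \<xi> (k + 1) \<omega> - (?Ai ** B k) *v v k \<omega>"
      using b k by (simp add: backward_process_def)
    then show "AE \<omega> in M. \<xi> k \<omega> = ?Ai *v \<xi> (Suc k) \<omega> + - (?Ai ** B k) *v (v k \<omega> + 0 *v \<xi> (Suc k) \<omega>)"
      by eventually_elim (simp add: matrix_uminus_mult)
    show "invertible ?Ai" by (rule invertible_matrix_inv[OF Ai])
    show "pos_def (bridge_cov (Suc k))" "pos_def (bridge_cov k)" "pos_def (backward_cov k)" "pos_def (forward_cov k)"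
      using k by (simp_all add: bridge_cov_pos_def backward_cov_pos_def forward_cov_pos_def)
    fix z y
    have "z = Abar A B S k *v (?Ai *v z + - (?Ai ** B k) *v y) + B k *v y"
      by (simp add: matrix_vector_right_distrib matrix_uminus_mult matrix_mult_uminus_vec
          matrix_vector_mult_diff_distrib matrix_vector_mul_assoc[symmetric] matrix_inv_vector[OF Ai])
    from exchange_square[OF k this]
    show "z \<bullet> (matrix_inv (bridge_cov (Suc k)) *v z) + (y - (transpose (B k) ** H (Suc k)) *v z) \<bullet> (matrix_inv (backward_cov k) *v (y - (transpose (B k) ** H (Suc k)) *v z))
      = (?Ai *v z + - (?Ai ** B k) *v y) \<bullet> (matrix_inv (bridge_cov k) *v (?Ai *v z + - (?Ai ** B k) *v y))
        + (y - gain k *v (?Ai *v z + - (?Ai ** B k) *v y)) \<bullet> (matrix_inv (forward_cov k) *v (y - gain k *v (?Ai *v z + - (?Ai ** B k) *v y)))"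
      by (simp only: matrix_vector_mul_assoc)
  qed
qed

lemma hist_current [simp]: "fst (hist x u k \<omega>) k = x k \<omega>"
  by (simp add: hist_def)

lemma forward_star_gaussian:
  assumes b: "forward_process N A B \<Sigma>0 p_star M x u" and k: "k \<le> N"
  shows "is_gaussian M (x k) 0 (bridge_cov k)"
  using k
proof (induction k)
  case 0
  then show ?case using b by (simp add: forward_process_def bridge_cov_ends)
next
  case (Suc k)
  then have k: "k < N" by simp
  show ?case
  proof (rule gaussian_transition[where F = "gain k" and T = "transpose (S k)"
        and C = "Abar A B S k" and D = "B k" and F' = "transpose (B k) ** H (Suc k)" and W' = "backward_cov k"
        and Z = "x k" and U = "u k" and \<Sigma> = "bridge_cov k" and W = "forward_cov k"])
    show "prob_space M" "x (Suc k) \<in> borel_measurable M" using b k by (auto simp: forward_process_def)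
    show "is_gaussian M (x k) 0 (bridge_cov k)" using Suc by simp
    have "has_cond_density M (hist_space k) (hist x u k) (u k) (\<lambda>h. state_policy k (fst h k))"
      using b k by (simp add: forward_process_def p_star_state)
    from has_cond_density_project(2)[OF this current_state_measurable state_policy_cond_density[OF k]]
    show "has_cond_density M borel (x k) (u k)
       (\<lambda>z. gaussian_density (gain k *v z - transpose (S k) *v z) (forward_cov k))"
      by (simp add: state_policy_def[abs_def])
    have "AE \<omega> in M. x (k + 1) \<omega> = A k *v x k \<omega> + B k *v u k \<omega>"
      using b k by (simp add: forward_process_def)
    then show "AE \<omega> in M. x (Suc k) \<omega> = Abar A B S k *v x k \<omega> + B k *v (u k \<omega> + transpose (S k) *v x k \<omega>)"
      by eventually_elim (simp add: Abar_def matrix_vector_mult_diff_rdistrib matrix_vector_right_distrib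
          matrix_vector_mul_assoc[symmetric])
    show "invertible (Abar A B S k)" by (rule Ab_inv[OF k])
    show "pos_def (bridge_cov (Suc k))" "pos_def (bridge_cov k)" "pos_def (backward_cov k)" "pos_def (forward_cov k)"
      using k by (simp_all add: bridge_cov_pos_def backward_cov_pos_def forward_cov_pos_def)
    fix z y
    let ?a = "Abar A B S k *v z + B k *v y"
    show "z \<bullet> (matrix_inv (bridge_cov k) *v z) + (y - gain k *v z) \<bullet> (matrix_inv (forward_cov k) *v (y - gain k *v z))
      = ?a \<bullet> (matrix_inv (bridge_cov (Suc k)) *v ?a)
        + (y - (transpose (B k) ** H (Suc k)) *v ?a) \<bullet> (matrix_inv (backward_cov k) *v (y - (transpose (B k) ** H (Suc k)) *v ?a))"
      using exchange_square[OF k refl, of z y] by (simp only: matrix_vector_mul_assoc)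
  qed
qed


definition backward_divergence where
  "backward_divergence w M \<xi> k = cond_density_pair.divergence M (\<xi> (Suc k)) (w k) (w_star k)"

definition forward_divergence where
  "forward_divergence p M x u k = cond_density_pair.divergence M (hist x u k) (p k) (p_star k)"

lemma backward_pair:
  assumes "backward_process N A B S \<Sigma>N w M \<xi> v" "k < N"
  shows "cond_density_pair M borel (\<xi> (Suc k)) (v k) (w k) (w_star k)"
  using assms w_star_cond_density[OF assms(2)] w_star_pos[OF assms(2)]
  by (simp add: cond_density_pair_def cond_density_pair_axioms_def backward_process_def)

lemma forward_pair:
  assumes "forward_process N A B \<Sigma>0 p M x u" "k < N"
  shows "cond_density_pair M (hist_space k) (hist x u k) (u k) (p k) (p_star k)"
  using assms p_star_cond_density[OF assms(2)] p_star_pos[OF assms(2)]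
  by (simp add: cond_density_pair_def cond_density_pair_axioms_def forward_process_def)

lemma backward_dynamics:
  assumes "backward_process N A B S \<Sigma>N w M \<xi> v" "k < N"
  shows "AE \<omega> in M. \<xi> (Suc k) \<omega> = Abar A B S k *v \<xi> k \<omega> + B k *v v k \<omega>"
proof -
  have "AE \<omega> in M. \<xi> k \<omega> = matrix_inv (Abar A B S k) *v \<xi> (k + 1) \<omega> - (matrix_inv (Abar A B S k) ** B k) *v v k \<omega>"
    using assms by (simp add: backward_process_def)
  then show ?thesis
    by eventually_elim (simp add: matrix_vector_mult_diff_distrib matrix_vector_mul_assoc[symmetric]
        matrix_inv_vector[OF Ab_inv[OF assms(2)]])
qed

lemma forward_dynamics:
  assumes "forward_process N A B \<Sigma>0 p M x u" "k < N"
  shows "AE \<omega> in M. x (Suc k) \<omega> = Abar A B S k *v x k \<omega> + B k *v (u k \<omega> + transpose (S k) *v x k \<omega>)"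
proof -
  have "AE \<omega> in M. x (k + 1) \<omega> = A k *v x k \<omega> + B k *v u k \<omega>"
    using assms by (simp add: forward_process_def)
  then show ?thesis
    by eventually_elim (simp add: Abar_def matrix_vector_mult_diff_rdistrib matrix_vector_right_distrib
        matrix_vector_mul_assoc[symmetric])
qed

text \<open>
  Square-integrability spreads from the Gaussian terminal state to all states through the linear dynamics.
\<close>
lemma backward_sq_integrable:
  assumes b: "backward_process N A B S \<Sigma>N w M \<xi> v" and v: "\<And>k. k < N \<Longrightarrow> sq_integrable M (v k)" and k: "k \<le> N"
  shows "sq_integrable M (\<xi> k)"
  using k
proof (induction k rule: inc_induct)
  case base
  show ?case using b by (auto simp: backward_process_def intro: is_gaussian_moments(1))
next
  case (step k)
  then have k: "k < N" by simp
  have "AE \<omega> in M. \<xi> k \<omega> = matrix_inv (Abar A B S k) *v \<xi> (Suc k) \<omega> - (matrix_inv (Abar A B S k) ** B k) *v v k \<omega>"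
    using b k by (simp add: backward_process_def)
  moreover have "\<xi> k \<in> borel_measurable M" using b k by (simp add: backward_process_def)
  ultimately show ?case
    by (rule sq_integrable_cong_AE[OF _ sq_integrable_diff[OF sq_integrable_matrix[OF step.IH] sq_integrable_matrix[OF v[OF k]]], rotated])
qed

lemma forward_sq_integrable:
  assumes b: "forward_process N A B \<Sigma>0 p M x u"
    and v: "\<And>k. k < N \<Longrightarrow> sq_integrable M (\<lambda>\<omega>. u k \<omega> + transpose (S k) *v x k \<omega>)" and k: "k \<le> N"
  shows "sq_integrable M (x k)"
  using k
proof (induction k)
  case 0
  show ?case using b by (auto simp: forward_process_def intro: is_gaussian_moments(1))
next
  case (Suc k)
  then have k: "k < N" and IH: "sq_integrable M (x k)" by simp_all
  have "x (Suc k) \<in> borel_measurable M" using b Suc by (simp add: forward_process_def)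
  then show ?case
    by (rule sq_integrable_cong_AE[OF _ sq_integrable_add[OF sq_integrable_matrix[OF IH] sq_integrable_matrix[OF v[OF k]]]
          forward_dynamics[OF b k]])
qed

definition backward_potential where
  "backward_potential M \<xi> k = (\<integral>\<omega>. \<xi> k \<omega> \<bullet> (((1/2) *\<^sub>R (H k + Qbar N S Q k)) *v \<xi> k \<omega>) \<partial>M)"

definition forward_potential where
  "forward_potential M x k = (\<integral>\<omega>. x k \<omega> \<bullet> (((1/2) *\<^sub>R P k) *v x k \<omega>) \<partial>M)"

definition backward_log_norm where
  "backward_log_norm k = ln ((2 * pi) ^ CARD('m) * det (backward_cov k)) / 2"

definition forward_log_norm where
  "forward_log_norm k = ln ((2 * pi) ^ CARD('m) * det (forward_cov k)) / 2"

text \<open>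
  Take expectations in \<open>backward_square\<close> and insert them into the decomposition of the entropy. The state cost at \<open>k + 1\<close> completes
  \<open>H (k + 1)\<close> to the potential at \<open>k + 1\<close>.
\<close>
lemma backward_stage_cost:
  assumes b: "backward_process N A B S \<Sigma>N w M \<xi> v" and v: "\<And>k. k < N \<Longrightarrow> sq_integrable M (v k)" and k: "k < N"
  shows "ext_integral M (\<lambda>\<omega>. ereal (1/2 * (\<xi> (Suc k) \<omega> \<bullet> (Qbar N S Q (Suc k) *v \<xi> (Suc k) \<omega>))))
     + ext_integral M (\<lambda>\<omega>. ereal (1/2 * (norm (v k \<omega>))\<^sup>2))
     + ext_integral M (\<lambda>\<omega>. - diff_entropy (w k (\<xi> (Suc k) \<omega>)))
    = enn2ereal (backward_divergence w M \<xi> k)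
      + ereal (backward_potential M \<xi> (Suc k) - backward_potential M \<xi> k - backward_log_norm k)"
proof -
  interpret cond_density_pair M borel "\<xi> (Suc k)" "v k" "w k" "w_star k" by (rule backward_pair[OF b k])
  let ?X = "\<xi> (Suc k)" and ?Y = "\<xi> k" and ?V = "v k" and ?Q = "Qbar N S Q"
  have sX: "sq_integrable M ?X" and sY: "sq_integrable M ?Y" and sV: "sq_integrable M ?V"
    using backward_sq_integrable[OF b v] v k by auto
  have iq: "integrable M (\<lambda>\<omega>. X \<omega> \<bullet> (C *v X \<omega>))" if "sq_integrable M X" for X :: "_ \<Rightarrow> real^'n" and C
    by (rule sq_integrable_inner[OF that sq_integrable_matrix[OF that]])
  have iV: "integrable M (\<lambda>\<omega>. (norm (?V \<omega>))\<^sup>2)" using sV by (simp add: sq_integrable_def)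
  have "AE \<omega> in M. ln (w_star k (?X \<omega>) (?V \<omega>))
      = 1/2 * (?X \<omega> \<bullet> (H (Suc k) *v ?X \<omega>)) - ?Y \<omega> \<bullet> (((1/2) *\<^sub>R (H k + ?Q k)) *v ?Y \<omega>)
        - backward_log_norm k - 1/2 * (norm (?V \<omega>))\<^sup>2"
    using backward_dynamics[OF b k]
  proof eventually_elim
    case (elim \<omega>)
    show ?case using backward_square[OF k elim]
      by (simp add: backward_log_norm_def flip: scaleR_matrix_vector_assoc)
  qed
  note ln_eq = this
  let ?R = "\<lambda>\<omega>. 1/2 * (?X \<omega> \<bullet> (H (Suc k) *v ?X \<omega>)) - ?Y \<omega> \<bullet> (((1/2) *\<^sub>R (H k + ?Q k)) *v ?Y \<omega>)
        - backward_log_norm k - 1/2 * (norm (?V \<omega>))\<^sup>2"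
  have iR: "integrable M ?R" using iq[OF sX] iq[OF sY] iV by auto
  have mV[measurable]: "?V \<in> borel_measurable M" using sV by (simp add: sq_integrable_def)
  have m: "(\<lambda>\<omega>. ln (w_star k (?X \<omega>) (?V \<omega>))) \<in> borel_measurable M" by measurable
  have iL: "integrable M (\<lambda>\<omega>. ln (w_star k (?X \<omega>) (?V \<omega>)))"
    using integrable_cong_AE[OF m borel_measurable_integrable[OF iR] ln_eq] iR by simp
  have "(\<integral>\<omega>. ln (w_star k (?X \<omega>) (?V \<omega>)) \<partial>M) = (\<integral>\<omega>. ?R \<omega> \<partial>M)"
    by (rule integral_cong_AE[OF m borel_measurable_integrable[OF iR] ln_eq])
  also have "\<dots> = 1/2 * (\<integral>\<omega>. ?X \<omega> \<bullet> (H (Suc k) *v ?X \<omega>) \<partial>M) - backward_potential M \<xi> k - backward_log_norm k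
      - (\<integral>\<omega>. 1/2 * (norm (?V \<omega>))\<^sup>2 \<partial>M)"
    using iq[OF sX] iq[OF sY] iV by (simp add: backward_potential_def prob_space)
  finally have L: "(\<integral>\<omega>. ln (w_star k (?X \<omega>) (?V \<omega>)) \<partial>M) = 1/2 * (\<integral>\<omega>. ?X \<omega> \<bullet> (H (Suc k) *v ?X \<omega>) \<partial>M)
      - backward_potential M \<xi> k - backward_log_norm k - (\<integral>\<omega>. 1/2 * (norm (?V \<omega>))\<^sup>2 \<partial>M)" .
  have pot: "backward_potential M \<xi> (Suc k) = 1/2 * (\<integral>\<omega>. ?X \<omega> \<bullet> (H (Suc k) *v ?X \<omega>) \<partial>M)
      + (\<integral>\<omega>. 1/2 * (?X \<omega> \<bullet> (?Q (Suc k) *v ?X \<omega>)) \<partial>M)"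
    using iq[OF sX]
    by (simp add: backward_potential_def matrix_vector_mult_add_rdistrib inner_add add_divide_distrib
        flip: scaleR_matrix_vector_assoc)
  have e1: "ext_integral M (\<lambda>\<omega>. ereal (1/2 * (?X \<omega> \<bullet> (?Q (Suc k) *v ?X \<omega>))))
      = ereal (\<integral>\<omega>. 1/2 * (?X \<omega> \<bullet> (?Q (Suc k) *v ?X \<omega>)) \<partial>M)"
    by (rule ext_integral_integrable) (use iq[OF sX] in auto)
  have e2: "ext_integral M (\<lambda>\<omega>. ereal (1/2 * (norm (?V \<omega>))\<^sup>2)) = ereal (\<integral>\<omega>. 1/2 * (norm (?V \<omega>))\<^sup>2 \<partial>M)"
    by (rule ext_integral_integrable) (use iV in auto)
  show ?thesis
    unfolding e1 e2 entropy_decomposition[OF iL] L pot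
    by (simp add: backward_divergence_def ac_simps flip: plus_ereal.simps(1))
       (simp add: algebra_simps)
qed

lemma forward_stage_cost:
  assumes b: "forward_process N A B \<Sigma>0 p M x u"
    and v: "\<And>k. k < N \<Longrightarrow> sq_integrable M (\<lambda>\<omega>. u k \<omega> + transpose (S k) *v x k \<omega>)" and k: "k < N"
  shows "ext_integral M (\<lambda>\<omega>. ereal (1/2 * (x k \<omega> \<bullet> (Qbar N S Q k *v x k \<omega>) + (norm (u k \<omega> + transpose (S k) *v x k \<omega>))\<^sup>2)))
     + ext_integral M (\<lambda>\<omega>. - diff_entropy (p k (hist x u k \<omega>)))
    = enn2ereal (forward_divergence p M x u k)
      + ereal (forward_potential M x k - forward_potential M x (Suc k) - forward_log_norm k)"
proof -
  interpret cond_density_pair M "hist_space k" "hist x u k" "u k" "p k" "p_star k" by (rule forward_pair[OF b k])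
  let ?X = "x k" and ?Y = "x (Suc k)" and ?V = "\<lambda>\<omega>. u k \<omega> + transpose (S k) *v x k \<omega>" and ?Q = "Qbar N S Q"
  have sX: "sq_integrable M ?X" and sY: "sq_integrable M ?Y" and sV: "sq_integrable M ?V"
    using forward_sq_integrable[OF b v] v k by auto
  have iq: "integrable M (\<lambda>\<omega>. X \<omega> \<bullet> (C *v X \<omega>))" if "sq_integrable M X" for X :: "_ \<Rightarrow> real^'n" and C
    by (rule sq_integrable_inner[OF that sq_integrable_matrix[OF that]])
  have iV: "integrable M (\<lambda>\<omega>. (norm (?V \<omega>))\<^sup>2)" using sV by (simp add: sq_integrable_def)
  let ?c = "\<lambda>\<omega>. 1/2 * (?X \<omega> \<bullet> (?Q k *v ?X \<omega>) + (norm (?V \<omega>))\<^sup>2)"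
  have ic: "integrable M ?c" using iq[OF sX] iV by auto
  let ?R = "\<lambda>\<omega>. ?X \<omega> \<bullet> (((1/2) *\<^sub>R P k) *v ?X \<omega>) - ?Y \<omega> \<bullet> (((1/2) *\<^sub>R P (Suc k)) *v ?Y \<omega>)
        - forward_log_norm k - ?c \<omega>"
  have ln_eq: "AE \<omega> in M. ln (p_star k (hist x u k \<omega>) (u k \<omega>)) = ?R \<omega>"
    using forward_dynamics[OF b k]
  proof eventually_elim
    case (elim \<omega>)
    show ?case using forward_square[where u = "u k \<omega>" and h = "hist x u k \<omega>" and a = "?Y \<omega>", OF k refl] elim
      by (simp add: forward_log_norm_def flip: scaleR_matrix_vector_assoc)
  qed
  have iR: "integrable M ?R" using iq[OF sX] iq[OF sY] ic by auto
  have mu[measurable]: "u k \<in> borel_measurable M" using b k by (simp add: forward_process_def)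
  have m: "(\<lambda>\<omega>. ln (p_star k (hist x u k \<omega>) (u k \<omega>))) \<in> borel_measurable M" by measurable
  have iL: "integrable M (\<lambda>\<omega>. ln (p_star k (hist x u k \<omega>) (u k \<omega>)))"
    using integrable_cong_AE[OF m borel_measurable_integrable[OF iR] ln_eq] iR by simp
  have "(\<integral>\<omega>. ln (p_star k (hist x u k \<omega>) (u k \<omega>)) \<partial>M) = (\<integral>\<omega>. ?R \<omega> \<partial>M)"
    by (rule integral_cong_AE[OF m borel_measurable_integrable[OF iR] ln_eq])
  also have "\<dots> = forward_potential M x k - forward_potential M x (Suc k) - forward_log_norm k - (\<integral>\<omega>. ?c \<omega> \<partial>M)"
    using iq[OF sX] iq[OF sY] ic by (simp add: forward_potential_def prob_space del: integral_mult_right_zero)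
  finally have L: "(\<integral>\<omega>. ln (p_star k (hist x u k \<omega>) (u k \<omega>)) \<partial>M)
      = forward_potential M x k - forward_potential M x (Suc k) - forward_log_norm k - (\<integral>\<omega>. ?c \<omega> \<partial>M)" .
  show ?thesis
    unfolding ext_integral_integrable[OF ic] entropy_decomposition[OF iL] L
    by (simp add: forward_divergence_def ac_simps flip: plus_ereal.simps(1))
       (simp add: algebra_simps)
qed

end

section \<open>Realizations by independent noise and laws of histories\<close>

text \<open>
  In a product measure one coordinate may be replaced by an independent copy.
\<close>
lemma nn_integral_resample_coordinate:
  fixes D :: "'i \<Rightarrow> 'a measure"
  assumes D: "\<And>i. prob_space (D i)"
    and F[measurable]: "F \<in> borel_measurable (PiM UNIV D)" and G[measurable]: "G \<in> borel_measurable (PiM UNIV D)"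
    and FG: "\<And>b. b \<in> space (PiM UNIV D) \<Longrightarrow> G b = (\<integral>\<^sup>+x. F (b(k := x)) \<partial>D k)"
  shows "(\<integral>\<^sup>+b. F b \<partial>PiM UNIV D) = (\<integral>\<^sup>+b. G b \<partial>PiM UNIV D)"
proof -
  let ?I = "UNIV - {k}"
  interpret K: prob_space "D k" by (rule D)
  interpret R: prob_space "PiM ?I D" by (rule prob_space_PiM) (rule D)
  interpret pair_sigma_finite "D k" "PiM ?I D" ..
  have U: "insert k ?I = UNIV" by auto
  have d: "PiM UNIV D = distr (D k \<Otimes>\<^sub>M PiM ?I D) (PiM UNIV D) (\<lambda>(x, X). X(k := x))"
    using distr_pair_PiM_eq_PiM[of ?I D k] D unfolding U by simp
  have m[measurable]: "(\<lambda>(x, X). X(k := x)) \<in> measurable (D k \<Otimes>\<^sub>M PiM ?I D) (PiM UNIV D)"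
    using measurable_add_dim[of k ?I D] measurable_pair_swap_iff[of "\<lambda>(f, y). f(k := y)" "PiM ?I D" "D k" "PiM (insert k ?I) D"]
    unfolding U by (simp add: split_def)
  have split: "(\<integral>\<^sup>+b. h b \<partial>PiM UNIV D) = (\<integral>\<^sup>+X. (\<integral>\<^sup>+x. h (X(k := x)) \<partial>D k) \<partial>PiM ?I D)"
    if [measurable]: "h \<in> borel_measurable (PiM UNIV D)" for h
  proof -
    have "(\<integral>\<^sup>+b. h b \<partial>PiM UNIV D) = (\<integral>\<^sup>+y. h ((\<lambda>(x, X). X(k := x)) y) \<partial>(D k \<Otimes>\<^sub>M PiM ?I D))"
      by (subst d, rule nn_integral_distr) measurable
    also have "\<dots> = (\<integral>\<^sup>+X. (\<integral>\<^sup>+x. h (X(k := x)) \<partial>D k) \<partial>PiM ?I D)"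
      using nn_integral_snd[of "\<lambda>y. h ((\<lambda>(x, X). X(k := x)) y)"] measurable_compose[OF m that] by simp
    finally show ?thesis .
  qed
  have "(\<integral>\<^sup>+b. G b \<partial>PiM UNIV D) = (\<integral>\<^sup>+X. (\<integral>\<^sup>+x. G (X(k := x)) \<partial>D k) \<partial>PiM ?I D)" by (rule split) measurable
  also have "\<dots> = (\<integral>\<^sup>+X. (\<integral>\<^sup>+x. (\<integral>\<^sup>+y. F (X(k := y)) \<partial>D k) \<partial>D k) \<partial>PiM ?I D)"
  proof (intro nn_integral_cong)
    fix X x assume "X \<in> space (PiM ?I D)" "x \<in> space (D k)"
    then have "X(k := x) \<in> space (PiM UNIV D)" by (auto simp: space_PiM PiE_def Pi_def extensional_def)
    from FG[OF this] show "G (X(k := x)) = (\<integral>\<^sup>+y. F (X(k := y)) \<partial>D k)" by simp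
  qed
  also have "\<dots> = (\<integral>\<^sup>+X. (\<integral>\<^sup>+x. F (X(k := x)) \<partial>D k) \<partial>PiM ?I D)" by (simp add: K.emeasure_space_1)
  also have "\<dots> = (\<integral>\<^sup>+b. F b \<partial>PiM UNIV D)" by (rule split[symmetric]) measurable
  finally show ?thesis ..
qed

text \<open>
  If \<open>Z\<close> does not look at the \<open>k\<close>-th noise variable, then adding that variable to a function of \<open>Z\<close> produces a Gaussian
  conditional density with this function as mean.
\<close>
lemma noise_cond_density:
  fixes D :: "nat \<Rightarrow> (real^'m) measure" and Y :: "'y measure"
  assumes MA: "prob_space MA" and D: "\<And>i. prob_space (D i)" and Dk: "D k = gaussian_measure W" and W: "pos_def W"
    and Z[measurable]: "Z \<in> measurable (MA \<Otimes>\<^sub>M PiM UNIV D) Y"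
    and inv: "\<And>a b x. Z (a, b(k := x)) = Z (a, b)"
    and m[measurable]: "m \<in> borel_measurable Y"
  shows "has_cond_density (MA \<Otimes>\<^sub>M PiM UNIV D) Y Z (\<lambda>\<omega>. m (Z \<omega>) + snd \<omega> k) (\<lambda>y. gaussian_density (m y) W)"
proof -
  interpret A: prob_space MA by fact
  interpret P: prob_space "PiM UNIV D" by (rule prob_space_PiM) (rule D)
  let ?M = "MA \<Otimes>\<^sub>M PiM UNIV D"
  have sDk[measurable_cong]: "sets (D k) = sets borel" by (simp add: Dk gaussian_measure_def)
  have "(\<lambda>b. b k) \<in> measurable (PiM UNIV D) (D k)" by (rule measurable_component_singleton) simp
  then have [measurable]: "(\<lambda>b. b k) \<in> borel_measurable (PiM UNIV D)"
    by (simp add: measurable_cong_sets[OF refl sDk])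
  have cd: "cond_density Y (\<lambda>y. gaussian_density (m y) W)" by (rule cond_density_gaussian[OF m W])
  show ?thesis
  proof (rule has_cond_densityI[OF Z _ cd])
    show "(\<lambda>\<omega>. m (Z \<omega>) + snd \<omega> k) \<in> borel_measurable ?M" by measurable
    fix f :: "'y \<times> (real^'m) \<Rightarrow> ennreal" assume [measurable]: "f \<in> borel_measurable (Y \<Otimes>\<^sub>M borel)"
    let ?F = "\<lambda>\<omega>. f (Z \<omega>, m (Z \<omega>) + snd \<omega> k)"
    let ?G = "\<lambda>\<omega>. (\<integral>\<^sup>+u. ennreal (gaussian_density (m (Z \<omega>)) W u) * f (Z \<omega>, u) \<partial>lborel)"
    have mF[measurable]: "?F \<in> borel_measurable ?M" by measurable
    have mG[measurable]: "?G \<in> borel_measurable ?M" by measurable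
    have "(\<integral>\<^sup>+\<omega>. ?F \<omega> \<partial>?M) = (\<integral>\<^sup>+a. (\<integral>\<^sup>+b. ?F (a, b) \<partial>PiM UNIV D) \<partial>MA)"
      by (rule P.nn_integral_fst[symmetric, OF mF])
    also have "\<dots> = (\<integral>\<^sup>+a. (\<integral>\<^sup>+b. ?G (a, b) \<partial>PiM UNIV D) \<partial>MA)"
    proof (rule nn_integral_cong)
      fix a assume a: "a \<in> space MA"
      show "(\<integral>\<^sup>+b. ?F (a, b) \<partial>PiM UNIV D) = (\<integral>\<^sup>+b. ?G (a, b) \<partial>PiM UNIV D)"
      proof (rule nn_integral_resample_coordinate[OF D])
        show "(\<lambda>b. ?F (a, b)) \<in> borel_measurable (PiM UNIV D)" by (rule measurable_Pair2[OF mF a])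
        show "(\<lambda>b. ?G (a, b)) \<in> borel_measurable (PiM UNIV D)" by (rule measurable_Pair2[OF mG a])
        fix b assume b: "b \<in> space (PiM UNIV D)"
        have z: "Z (a, b) \<in> space Y" using measurable_space[OF Z] a b by (simp add: space_pair_measure)
        let ?g = "\<lambda>u. ennreal (gaussian_density (m (Z (a, b))) W u) * f (Z (a, b), u)"
        have fz[measurable]: "(\<lambda>u. f (Z (a, b), u)) \<in> borel_measurable borel"
          by (rule measurable_Pair2[OF _ z]) measurable
        have fz': "(\<lambda>u. f (Z (a, b), m (Z (a, b)) + u)) \<in> borel_measurable lborel"
          by (rule measurable_compose[OF _ fz]) simp
        have "?G (a, b) = (\<integral>\<^sup>+u. ?g (m (Z (a, b)) + u) \<partial>lborel)"
          using nn_integral_lborel_shift[of ?g "m (Z (a, b))"] by simp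
        also have "\<dots> = (\<integral>\<^sup>+u. ennreal (gaussian_density 0 W u) * f (Z (a, b), m (Z (a, b)) + u) \<partial>lborel)"
          by (simp add: gaussian_density_def)
        also have "\<dots> = (\<integral>\<^sup>+u. f (Z (a, b), m (Z (a, b)) + u) \<partial>D k)"
          unfolding Dk gaussian_measure_def by (rule nn_integral_density[symmetric, OF _ fz']) simp
        also have "\<dots> = (\<integral>\<^sup>+x. ?F (a, b(k := x)) \<partial>D k)" by (simp add: inv)
        finally show "?G (a, b) = (\<integral>\<^sup>+x. ?F (a, b(k := x)) \<partial>D k)" .
      qed
    qed
    also have "\<dots> = (\<integral>\<^sup>+\<omega>. ?G \<omega> \<partial>?M)" by (rule P.nn_integral_fst[OF mG])
    finally show "(\<integral>\<^sup>+\<omega>. ?F \<omega> \<partial>?M) = (\<integral>\<^sup>+\<omega>. ?G \<omega> \<partial>?M)" .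
  qed
qed

text \<open>
  Independent Gaussian variables, arranged on the path type: the coordinate \<open>0\<close> of the first component serves as the
  boundary state, the second component is the control noise. Beyond the horizon any covariance would do.
\<close>
definition noise_space :: "real^'n^'n \<Rightarrow> (nat \<Rightarrow> real^'m^'m) \<Rightarrow> nat \<Rightarrow> ('n, 'm) path measure" where
  "noise_space \<Sigma> W N = PiM UNIV (\<lambda>_. gaussian_measure \<Sigma>)
     \<Otimes>\<^sub>M PiM UNIV (\<lambda>i. if i < N then gaussian_measure (W i) else gaussian_measure (mat 1))"

lemma pos_def_mat_1: "pos_def (mat 1)"
  by (simp add: pos_def_def)

context
  fixes \<Sigma> :: "real^'n^'n" and W :: "nat \<Rightarrow> real^'m^'m" and N :: nat
  assumes \<Sigma>: "pos_def \<Sigma>" and W: "\<And>i. i < N \<Longrightarrow> pos_def (W i)"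
begin

lemma noise_factors_prob_space:
  "prob_space (PiM UNIV (\<lambda>_::nat. gaussian_measure \<Sigma>))"
  "prob_space (if i < N then gaussian_measure (W i) else gaussian_measure (mat 1))"
  using \<Sigma> W pos_def_mat_1 by (auto intro!: prob_space_PiM prob_space_gaussian_measure)

lemma noise_space_prob: "prob_space (noise_space \<Sigma> W N)"
  unfolding noise_space_def
  by (intro prob_space_pair prob_space_PiM noise_factors_prob_space) (rule prob_space_gaussian_measure[OF \<Sigma>])

lemma noise_space_measurable [measurable]:
  "(\<lambda>\<omega>. fst \<omega> i) \<in> borel_measurable (noise_space \<Sigma> W N)" "(\<lambda>\<omega>. snd \<omega> i) \<in> borel_measurable (noise_space \<Sigma> W N)"
proof -
  let ?D = "\<lambda>i. if i < N then gaussian_measure (W i) else gaussian_measure (mat 1)"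
  have "(\<lambda>a. a i) \<in> measurable (PiM UNIV (\<lambda>_::nat. gaussian_measure \<Sigma>)) (gaussian_measure \<Sigma>)"
    by (rule measurable_component_singleton) simp
  then have "(\<lambda>a. a i) \<in> borel_measurable (PiM UNIV (\<lambda>_::nat. gaussian_measure \<Sigma>))"
    by (subst measurable_cong_sets[OF refl, of _ "gaussian_measure \<Sigma>"]) (simp_all add: gaussian_measure_def)
  then show "(\<lambda>\<omega>. fst \<omega> i) \<in> borel_measurable (noise_space \<Sigma> W N)"
    unfolding noise_space_def by (rule measurable_compose[OF measurable_fst])
  have "(\<lambda>a. a i) \<in> measurable (PiM UNIV ?D) (?D i)"
    by (rule measurable_component_singleton) simp
  then have "(\<lambda>a. a i) \<in> borel_measurable (PiM UNIV ?D)"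
    by (subst measurable_cong_sets[OF refl, of _ "?D i"]) (simp_all add: gaussian_measure_def)
  then show "(\<lambda>\<omega>. snd \<omega> i) \<in> borel_measurable (noise_space \<Sigma> W N)"
    unfolding noise_space_def by (rule measurable_compose[OF measurable_snd])
qed

lemma noise_space_gaussian:
  "is_gaussian (noise_space \<Sigma> W N) (\<lambda>\<omega>. fst \<omega> i) 0 \<Sigma>"
  "k < N \<Longrightarrow> is_gaussian (noise_space \<Sigma> W N) (\<lambda>\<omega>. snd \<omega> k) 0 (W k)"
proof -
  let ?D = "\<lambda>i. if i < N then gaussian_measure (W i) else gaussian_measure (mat 1)"
  let ?A = "PiM UNIV (\<lambda>_::nat. gaussian_measure \<Sigma>)" and ?P = "PiM UNIV ?D"
  interpret A: prob_space ?A by (rule noise_factors_prob_space)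
  interpret P: prob_space ?P by (rule prob_space_PiM) (rule noise_factors_prob_space)
  have ma: "(\<lambda>a. a i) \<in> measurable ?A (gaussian_measure \<Sigma>)" for i by (rule measurable_component_singleton) simp
  have mp: "(\<lambda>a. a i) \<in> measurable ?P (?D i)" for i by (rule measurable_component_singleton) simp
  have "distr (noise_space \<Sigma> W N) (gaussian_measure \<Sigma>) (\<lambda>\<omega>. fst \<omega> i) = distr (distr (?A \<Otimes>\<^sub>M ?P) ?A fst) (gaussian_measure \<Sigma>) (\<lambda>a. a i)"
    unfolding noise_space_def by (subst distr_distr[OF ma measurable_fst]) (simp add: comp_def)
  also have "\<dots> = gaussian_measure \<Sigma>"
    unfolding P.distr_pair_fst by (rule distr_PiM_component) (simp_all add: prob_space_gaussian_measure[OF \<Sigma>])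
  finally have 1: "distr (noise_space \<Sigma> W N) (gaussian_measure \<Sigma>) (\<lambda>\<omega>. fst \<omega> i) = gaussian_measure \<Sigma>" .
  have "distr (noise_space \<Sigma> W N) borel (\<lambda>\<omega>. fst \<omega> i) = distr (noise_space \<Sigma> W N) (gaussian_measure \<Sigma>) (\<lambda>\<omega>. fst \<omega> i)"
    by (rule distr_cong) (simp_all add: gaussian_measure_def)
  then show "is_gaussian (noise_space \<Sigma> W N) (\<lambda>\<omega>. fst \<omega> i) 0 \<Sigma>"
    using 1 \<Sigma> by (simp add: is_gaussian_iff)
  assume k: "k < N"
  have snd_distr: "distr (?A \<Otimes>\<^sub>M ?P) ?P snd = ?P"
  proof (rule measure_eqI)
    fix X assume X: "X \<in> sets (distr (?A \<Otimes>\<^sub>M ?P) ?P snd)"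
    then have "snd -` X \<inter> space (?A \<Otimes>\<^sub>M ?P) = space ?A \<times> X"
      using sets.sets_into_space[of X ?P] by (auto simp: space_pair_measure)
    then show "emeasure (distr (?A \<Otimes>\<^sub>M ?P) ?P snd) X = emeasure ?P X"
      using X by (simp add: emeasure_distr P.emeasure_pair_measure_Times A.emeasure_space_1)
  qed simp
  have "distr (noise_space \<Sigma> W N) (?D k) (\<lambda>\<omega>. snd \<omega> k) = distr (distr (?A \<Otimes>\<^sub>M ?P) ?P snd) (?D k) (\<lambda>a. a k)"
    unfolding noise_space_def by (subst distr_distr[OF mp measurable_snd]) (simp add: comp_def)
  also have "\<dots> = ?D k"
    unfolding snd_distr by (rule distr_PiM_component) (simp_all only: noise_factors_prob_space UNIV_I)
  finally have 2: "distr (noise_space \<Sigma> W N) (gaussian_measure (W k)) (\<lambda>\<omega>. snd \<omega> k) = gaussian_measure (W k)"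
    using k by simp
  have "distr (noise_space \<Sigma> W N) borel (\<lambda>\<omega>. snd \<omega> k) = distr (noise_space \<Sigma> W N) (gaussian_measure (W k)) (\<lambda>\<omega>. snd \<omega> k)"
    by (rule distr_cong) (simp_all add: gaussian_measure_def)
  then show "is_gaussian (noise_space \<Sigma> W N) (\<lambda>\<omega>. snd \<omega> k) 0 (W k)"
    using 2 W[OF k] by (simp add: is_gaussian_iff)
qed

lemma noise_space_cond_density:
  assumes k: "k < N" and Z: "Z \<in> measurable (noise_space \<Sigma> W N) Y"
    and inv: "\<And>a b x. Z (a, b(k := x)) = Z (a, b)" and m: "m \<in> borel_measurable Y"
  shows "has_cond_density (noise_space \<Sigma> W N) Y Z (\<lambda>\<omega>. m (Z \<omega>) + snd \<omega> k) (\<lambda>y. gaussian_density (m y) (W k))"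
  using Z unfolding noise_space_def
  by (intro noise_cond_density noise_factors_prob_space W[OF k] inv m) (use k in simp_all)

end

lemma hist_measurable:
  assumes "\<And>i. i \<le> k \<Longrightarrow> x i \<in> borel_measurable M" "\<And>i. i < k \<Longrightarrow> u i \<in> borel_measurable M"
  shows "hist x u k \<in> measurable M (hist_space k)"
  unfolding hist_def[abs_def] hist_space_def
  by (intro measurable_Pair measurable_restrict) (use assms in auto)

definition extend_hist :: "real^'n^'n \<Rightarrow> real^'m^'n \<Rightarrow> nat \<Rightarrow> ('n, 'm) path \<times> (real^'m) \<Rightarrow> ('n, 'm) path" where
  "extend_hist A B k = (\<lambda>(h, u).
     (\<lambda>i\<in>{..Suc k}. if i = Suc k then A *v fst h k + B *v u else fst h i,
      \<lambda>i\<in>{..<Suc k}. if i = k then u else snd h i))"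

lemma extend_hist_measurable:
  "extend_hist A B k \<in> measurable (hist_space k \<Otimes>\<^sub>M borel) (hist_space (Suc k))"
proof -
  have 1: "(\<lambda>h. fst h i) \<in> borel_measurable (hist_space k)" if "i \<le> k" for i
    unfolding hist_space_def
    by (rule measurable_compose[OF measurable_fst]) (rule measurable_component_singleton, use that in simp)
  have 2: "(\<lambda>h. snd h i) \<in> borel_measurable (hist_space k)" if "i < k" for i
    unfolding hist_space_def
    by (rule measurable_compose[OF measurable_snd]) (rule measurable_component_singleton, use that in simp)
  note [measurable] = 1[OF order_refl]
  have 3: "(\<lambda>y. if i = Suc k then A *v fst (fst y) k + B *v snd y else fst (fst y) i)
      \<in> borel_measurable (hist_space k \<Otimes>\<^sub>M borel)" if "i \<le> Suc k" for i
  proof (cases "i = Suc k")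
    case False
    then show ?thesis using measurable_compose[OF measurable_fst 1[of i]] that by simp
  qed simp
  have 4: "(\<lambda>y. if i = k then snd y else snd (fst y) i) \<in> borel_measurable (hist_space k \<Otimes>\<^sub>M borel)" if "i < Suc k" for i
  proof (cases "i = k")
    case False
    then show ?thesis using measurable_compose[OF measurable_fst 2[of i]] that by simp
  qed simp
  show ?thesis
    unfolding extend_hist_def split_def hist_space_def[of "Suc k"]
    by (intro measurable_Pair measurable_restrict) (use 3 4 in auto)
qed

lemma hist_Suc:
  assumes "x (Suc k) \<omega> = A *v x k \<omega> + B *v u k \<omega>"
  shows "hist x u (Suc k) \<omega> = extend_hist A B k (hist x u k \<omega>, u k \<omega>)"
  using assms by (auto simp: hist_def extend_hist_def fun_eq_iff less_Suc_eq)

lemma cond_density_joint_distr: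
  assumes c: "has_cond_density M Y Z U p" and c': "has_cond_density M' Y Z' U' p"
    and d: "distr M Y Z = distr M' Y Z'"
  shows "distr M (Y \<Otimes>\<^sub>M borel) (\<lambda>\<omega>. (Z \<omega>, U \<omega>)) = distr M' (Y \<Otimes>\<^sub>M borel) (\<lambda>\<omega>. (Z' \<omega>, U' \<omega>))"
proof -
  have "distr M (Y \<Otimes>\<^sub>M borel) (\<lambda>\<omega>. (Z \<omega>, U \<omega>)) = distr M (distr M Y Z \<Otimes>\<^sub>M lborel) (\<lambda>\<omega>. (Z \<omega>, U \<omega>))"
    by (rule distr_cong) (simp_all cong: sets_pair_measure_cong)
  also have "\<dots> = distr M' (distr M' Y Z' \<Otimes>\<^sub>M lborel) (\<lambda>\<omega>. (Z' \<omega>, U' \<omega>))"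
    using c c' by (simp add: has_cond_density_def distributed_def d)
  also have "\<dots> = distr M' (Y \<Otimes>\<^sub>M borel) (\<lambda>\<omega>. (Z' \<omega>, U' \<omega>))"
    by (rule distr_cong) (simp_all cong: sets_pair_measure_cong)
  finally show ?thesis .
qed

definition initial_hist :: "real^'n \<Rightarrow> ('n, 'm) path" where
  "initial_hist y = (\<lambda>i\<in>{..0}. y, \<lambda>i\<in>{..<0}. undefined)"

lemma initial_hist_measurable: "initial_hist \<in> measurable borel (hist_space 0)"
  unfolding initial_hist_def[abs_def] hist_space_def by (intro measurable_Pair measurable_restrict) auto

lemma hist_0: "hist x u 0 = (\<lambda>\<omega>. initial_hist (x 0 \<omega>))"
  by (auto simp: hist_def initial_hist_def fun_eq_iff)

lemma forward_hist_distr_Suc: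
  fixes A :: "nat \<Rightarrow> real^'n^'n" and B :: "nat \<Rightarrow> real^'m^'n"
  assumes f: "forward_process N A B \<Sigma>0 p M x u" and k: "k < N"
  shows "distr M (hist_space (Suc k)) (hist x u (Suc k))
     = distr (distr M (hist_space k \<Otimes>\<^sub>M borel) (\<lambda>\<omega>. (hist x u k \<omega>, u k \<omega>))) (hist_space (Suc k)) (extend_hist (A k) (B k) k)"
proof -
  have c: "has_cond_density M (hist_space k) (hist x u k) (u k) (p k)" using f k by (simp add: forward_process_def)
  have m: "(\<lambda>\<omega>. (hist x u k \<omega>, u k \<omega>)) \<in> measurable M (hist_space k \<Otimes>\<^sub>M borel)"
    using has_cond_density_measurable[OF c] by (rule measurable_Pair)
  have "AE \<omega> in M. x (k + 1) \<omega> = A k *v x k \<omega> + B k *v u k \<omega>" using f k by (simp add: forward_process_def)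
  then have ae: "AE \<omega> in M. hist x u (Suc k) \<omega> = extend_hist (A k) (B k) k (hist x u k \<omega>, u k \<omega>)"
    by eventually_elim (rule hist_Suc, simp)
  have "distr M (hist_space (Suc k)) (hist x u (Suc k))
      = distr M (hist_space (Suc k)) (\<lambda>\<omega>. extend_hist (A k) (B k) k (hist x u k \<omega>, u k \<omega>))"
  proof (rule distr_cong_AE[OF refl refl ae])
    show "hist x u (Suc k) \<in> measurable M (hist_space (Suc k))"
      by (rule hist_measurable) (use f k in \<open>auto simp: forward_process_def\<close>)
    show "(\<lambda>\<omega>. extend_hist (A k) (B k) k (hist x u k \<omega>, u k \<omega>)) \<in> measurable M (hist_space (Suc k))"
      by (rule measurable_compose[OF m extend_hist_measurable])
  qed
  then show ?thesis by (simp add: distr_distr[OF extend_hist_measurable m] comp_def)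
qed

text \<open>
  Policy, dynamics and initial law determine the law of the history, on whatever probability space the process lives.
\<close>
lemma forward_hist_distr_unique:
  fixes A :: "nat \<Rightarrow> real^'n^'n" and B :: "nat \<Rightarrow> real^'m^'n"
  assumes f: "forward_process N A B \<Sigma>0 p M x u" and f': "forward_process N A B \<Sigma>0 p M' x' u'" and k: "k \<le> N"
  shows "distr M (hist_space k) (hist x u k) = distr M' (hist_space k) (hist x' u' k)"
  using k
proof (induction k)
  case 0
  have x: "x 0 \<in> borel_measurable M" "x' 0 \<in> borel_measurable M'" "distr M borel (x 0) = distr M' borel (x' 0)"
    using f f' by (auto simp: forward_process_def is_gaussian_iff)
  have "distr M (hist_space 0) (hist x u 0) = distr (distr M borel (x 0)) (hist_space 0) initial_hist"
    by (simp add: hist_0 distr_distr[OF initial_hist_measurable x(1)] comp_def)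
  also have "\<dots> = distr M' (hist_space 0) (hist x' u' 0)"
    by (simp add: x(3) hist_0 distr_distr[OF initial_hist_measurable x(2)] comp_def)
  finally show ?case .
next
  case (Suc k)
  then have k: "k < N" and IH: "distr M (hist_space k) (hist x u k) = distr M' (hist_space k) (hist x' u' k)" by auto
  have c: "has_cond_density M (hist_space k) (hist x u k) (u k) (p k)"
    "has_cond_density M' (hist_space k) (hist x' u' k) (u' k) (p k)"
    using f f' k by (auto simp: forward_process_def)
  show ?case
    unfolding forward_hist_distr_Suc[OF f k] forward_hist_distr_Suc[OF f' k] cond_density_joint_distr[OF c IH] ..
qed

section \<open>Optimality, uniqueness and equality of the state laws\<close>

context maxent_pair
begin

text \<open>
  The state with index \<open>N - j\<close> of the backward process under \<open>w_star\<close>, so that the recursion runs in the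
  direction of decreasing time.
\<close>
primrec bwd_state :: "nat \<Rightarrow> ('n, 'm) path \<Rightarrow> real^'n" where
  "bwd_state 0 \<omega> = fst \<omega> 0"
| "bwd_state (Suc j) \<omega> = (let k = N - Suc j; y = bwd_state j \<omega> in
     matrix_inv (Abar A B S k) *v y
     - (matrix_inv (Abar A B S k) ** B k) *v (transpose (B k) *v (H (Suc k) *v y) + snd \<omega> k))"

definition bwd_control :: "nat \<Rightarrow> ('n, 'm) path \<Rightarrow> real^'m" where
  "bwd_control k \<omega> = transpose (B k) *v (H (Suc k) *v bwd_state (N - Suc k) \<omega>) + snd \<omega> k"

text \<open>
  The state with index \<open>N - j\<close> uses only noise variables with index at least \<open>N - j\<close>.
\<close>
lemma bwd_state_future: "i + j < N \<Longrightarrow> bwd_state j (a, b(i := e)) = bwd_state j (a, b)"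
  by (induction j) (auto simp: Let_def)

lemma backward_star_process:
  "backward_process N A B S \<Sigma>N w_star (noise_space \<Sigma>N backward_cov N) (\<lambda>k. bwd_state (N - k)) bwd_control"
proof -
  let ?M = "noise_space \<Sigma>N backward_cov N"
  note noise = SN backward_cov_pos_def
  have mf[measurable]: "(\<lambda>\<omega>. fst \<omega> i) \<in> borel_measurable ?M" and ms[measurable]: "(\<lambda>\<omega>. snd \<omega> i) \<in> borel_measurable ?M" for i
    by (rule noise_space_measurable[OF noise]; assumption)+
  have st[measurable]: "bwd_state j \<in> borel_measurable ?M" for j
    by (induction j) (simp_all add: Let_def)
  have "has_cond_density ?M borel (bwd_state (N - Suc k)) (bwd_control k) (w_star k)" if k: "k < N" for k
  proof -
    have "has_cond_density ?M borel (bwd_state (N - Suc k))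
        (\<lambda>\<omega>. transpose (B k) *v (H (Suc k) *v bwd_state (N - Suc k) \<omega>) + snd \<omega> k)
        (\<lambda>y. gaussian_density (transpose (B k) *v (H (Suc k) *v y)) (backward_cov k))"
      by (rule noise_space_cond_density[OF noise k st]) (use k in \<open>simp_all add: bwd_state_future\<close>)
    then show ?thesis by (simp add: bwd_control_def[abs_def] w_star_eq[abs_def])
  qed
  moreover have "bwd_state (N - k) \<omega> = matrix_inv (Abar A B S k) *v bwd_state (N - Suc k) \<omega>
      - (matrix_inv (Abar A B S k) ** B k) *v bwd_control k \<omega>" if k: "k < N" for k \<omega>
  proof -
    have "N - k = Suc (N - Suc k)" "N - Suc (N - Suc k) = k" using k by auto
    then show ?thesis by (simp add: bwd_control_def Let_def)
  qed
  moreover have "bwd_control k \<in> borel_measurable ?M" for k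
    unfolding bwd_control_def[abs_def] by measurable
  moreover have "is_gaussian ?M (bwd_state 0) 0 \<Sigma>N"
    using noise_space_gaussian(1)[where N = N and W = backward_cov, OF noise, of 0] by (simp add: bwd_state.simps(1)[abs_def])
  ultimately show ?thesis
    using noise_space_prob[OF noise] w_star_cond_density st by (simp add: backward_process_def)
qed

lemma bwd_control_sq_integrable:
  assumes k: "k < N" shows "sq_integrable (noise_space \<Sigma>N backward_cov N) (bwd_control k)"
proof -
  have "sq_integrable (noise_space \<Sigma>N backward_cov N) (bwd_state (N - Suc k))"
    using is_gaussian_moments(1)[OF backward_star_gaussian[OF backward_star_process, of "Suc k"]] k by simp
  moreover have "sq_integrable (noise_space \<Sigma>N backward_cov N) (\<lambda>\<omega>. snd \<omega> k)"
    by (rule is_gaussian_moments(1)[OF noise_space_gaussian(2)[OF SN backward_cov_pos_def k]])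
  ultimately show ?thesis
    unfolding bwd_control_def[abs_def] by (intro sq_integrable_add sq_integrable_matrix)
qed

primrec fwd_state :: "nat \<Rightarrow> ('n, 'm) path \<Rightarrow> real^'n" where
  "fwd_state 0 \<omega> = fst \<omega> 0"
| "fwd_state (Suc k) \<omega> = (let y = fwd_state k \<omega> in
     A k *v y + B k *v ((gain k *v y - transpose (S k) *v y) + snd \<omega> k))"

definition fwd_control :: "nat \<Rightarrow> ('n, 'm) path \<Rightarrow> real^'m" where
  "fwd_control k \<omega> = (gain k *v fwd_state k \<omega> - transpose (S k) *v fwd_state k \<omega>) + snd \<omega> k"

lemma fwd_state_future: "j \<le> i \<Longrightarrow> fwd_state j (a, b(i := e)) = fwd_state j (a, b)"
  by (induction j) (auto simp: Let_def)

lemma forward_star_process: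
  "forward_process N A B \<Sigma>0 p_star (noise_space \<Sigma>0 forward_cov N) fwd_state fwd_control"
proof -
  let ?M = "noise_space \<Sigma>0 forward_cov N"
  note noise = S0 forward_cov_pos_def
  have mf[measurable]: "(\<lambda>\<omega>. fst \<omega> i) \<in> borel_measurable ?M" and ms[measurable]: "(\<lambda>\<omega>. snd \<omega> i) \<in> borel_measurable ?M" for i
    by (rule noise_space_measurable[OF noise]; assumption)+
  have st[measurable]: "fwd_state j \<in> borel_measurable ?M" for j
    by (induction j) (simp_all add: Let_def)
  have ct[measurable]: "fwd_control k \<in> borel_measurable ?M" for k
    unfolding fwd_control_def[abs_def] by measurable
  have "has_cond_density ?M (hist_space k) (hist fwd_state fwd_control k) (fwd_control k) (p_star k)" if k: "k < N" for k
  proof -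
    have "has_cond_density ?M (hist_space k) (hist fwd_state fwd_control k)
        (\<lambda>\<omega>. (gain k *v fst (hist fwd_state fwd_control k \<omega>) k
            - transpose (S k) *v fst (hist fwd_state fwd_control k \<omega>) k) + snd \<omega> k)
        (\<lambda>h. gaussian_density (gain k *v fst h k - transpose (S k) *v fst h k) (forward_cov k))"
    proof (rule noise_space_cond_density[OF noise k])
      show "hist fwd_state fwd_control k \<in> measurable ?M (hist_space k)" by (rule hist_measurable) measurable
      show "(\<lambda>h. gain k *v fst h k - transpose (S k) *v fst h k) \<in> borel_measurable (hist_space k)" by measurable
      show "hist fwd_state fwd_control k (a, b(k := e)) = hist fwd_state fwd_control k (a, b)" for a b e
        by (auto simp: hist_def fwd_control_def fwd_state_future fun_eq_iff)
    qed
    moreover have "p_star k = (\<lambda>h. gaussian_density (gain k *v fst h k - transpose (S k) *v fst h k) (forward_cov k))"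
      using p_star_eq[OF k] by (simp add: fun_eq_iff)
    ultimately show ?thesis by (simp add: fwd_control_def[abs_def])
  qed
  moreover have "is_gaussian ?M (fwd_state 0) 0 \<Sigma>0"
    using noise_space_gaussian(1)[where N = N and W = forward_cov, OF noise, of 0] by (simp add: fwd_state.simps(1)[abs_def])
  ultimately show ?thesis
    using noise_space_prob[OF noise] p_star_cond_density st ct
    by (simp add: forward_process_def Let_def fwd_control_def[symmetric])
qed

lemma fwd_control_sq_integrable:
  assumes k: "k < N"
  shows "sq_integrable (noise_space \<Sigma>0 forward_cov N) (\<lambda>\<omega>. fwd_control k \<omega> + transpose (S k) *v fwd_state k \<omega>)"
proof -
  have "sq_integrable (noise_space \<Sigma>0 forward_cov N) (fwd_state k)"
    using is_gaussian_moments(1)[OF forward_star_gaussian[OF forward_star_process, of k]] k by simp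
  moreover have "sq_integrable (noise_space \<Sigma>0 forward_cov N) (\<lambda>\<omega>. snd \<omega> k)"
    by (rule is_gaussian_moments(1)[OF noise_space_gaussian(2)[OF S0 forward_cov_pos_def k]])
  ultimately show ?thesis
    unfolding fwd_control_def[abs_def] by (intro sq_integrable_add sq_integrable_diff sq_integrable_matrix)
qed

lemma backward_total_cost:
  assumes b: "backward_process N A B S \<Sigma>N w M \<xi> v" and v: "\<And>k. k < N \<Longrightarrow> sq_integrable M (v k)"
  shows "backward_cost N S Q w M \<xi> v = enn2ereal (\<Sum>k<N. backward_divergence w M \<xi> k)
    + ereal (backward_potential M \<xi> N - backward_potential M \<xi> 0 - (\<Sum>k<N. backward_log_norm k))"
proof -
  have "backward_cost N S Q w M \<xi> v = (\<Sum>k<N. enn2ereal (backward_divergence w M \<xi> k)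
      + ereal (backward_potential M \<xi> (Suc k) - backward_potential M \<xi> k - backward_log_norm k))"
    unfolding backward_cost_def One_nat_def sum.atLeast1_atMost_eq
    by (rule sum.cong[OF refl]) (use backward_stage_cost[OF b v] in simp)
  also have "\<dots> = enn2ereal (\<Sum>k<N. backward_divergence w M \<xi> k)
    + ereal (\<Sum>k<N. backward_potential M \<xi> (Suc k) - backward_potential M \<xi> k - backward_log_norm k)"
    by (rule sum_extended_costs)
  finally show ?thesis by (simp add: sum_subtractf[of _ backward_log_norm] sum_lessThan_telescope)
qed

lemma forward_block_cost:
  assumes k: "k < N"
  shows "block_vec x u \<bullet> (block_mat (Q k) (S k) (transpose (S k)) (mat 1) *v block_vec x u)
    = x \<bullet> (Qbar N S Q k *v x) + (norm (u + transpose (S k) *v x))\<^sup>2"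
proof -
  define y where "y = transpose (S k) *v x"
  have "x \<bullet> (Q k *v x) = x \<bullet> (Qbar N S Q k *v x) + y \<bullet> y"
    using k by (simp add: Qbar_def matrix_vector_mult_diff_rdistrib inner_diff y_def
        matrix_vector_mul_assoc[symmetric] inner_transpose)
  moreover have "x \<bullet> (S k *v u) = u \<bullet> y"
    by (simp add: y_def inner_commute[of u] inner_transpose)
  ultimately show ?thesis
    by (simp add: block_mat_mult_block_vec inner_block_vec power2_norm_eq_inner inner_add
        inner_commute[of y u] flip: y_def)
qed

lemma forward_cost_eq:
  "forward_cost N S Q p M x u = (\<Sum>k<N.
     ext_integral M (\<lambda>\<omega>. ereal (1/2 * (x k \<omega> \<bullet> (Qbar N S Q k *v x k \<omega>) + (norm (u k \<omega> + transpose (S k) *v x k \<omega>))\<^sup>2)))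
     + ext_integral M (\<lambda>\<omega>. - diff_entropy (p k (hist x u k \<omega>))))"
  unfolding forward_cost_def by (rule sum.cong[OF refl]) (simp add: forward_block_cost)

lemma forward_total_cost:
  assumes b: "forward_process N A B \<Sigma>0 p M x u"
    and v: "\<And>k. k < N \<Longrightarrow> sq_integrable M (\<lambda>\<omega>. u k \<omega> + transpose (S k) *v x k \<omega>)"
  shows "forward_cost N S Q p M x u = enn2ereal (\<Sum>k<N. forward_divergence p M x u k)
    + ereal (forward_potential M x 0 - forward_potential M x N - (\<Sum>k<N. forward_log_norm k))"
proof -
  have "forward_cost N S Q p M x u = (\<Sum>k<N. enn2ereal (forward_divergence p M x u k)
      + ereal (forward_potential M x k - forward_potential M x (Suc k) - forward_log_norm k))"
    unfolding forward_cost_eq by (rule sum.cong[OF refl]) (use forward_stage_cost[OF b v] in simp)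
  also have "\<dots> = enn2ereal (\<Sum>k<N. forward_divergence p M x u k)
    + ereal (\<Sum>k<N. forward_potential M x k - forward_potential M x (Suc k) - forward_log_norm k)"
    by (rule sum_extended_costs)
  finally show ?thesis by (simp add: sum_subtractf[of _ forward_log_norm] sum_lessThan_telescope')
qed

text \<open>
  An infinite control energy cannot be compensated by an entropy term, since each expectation in the cost is formed separately.
\<close>
lemma backward_finite_cost:
  assumes b: "backward_process N A B S \<Sigma>N w M \<xi> v" and fin: "backward_cost N S Q w M \<xi> v \<noteq> \<infinity>" and k: "k < N"
  shows "sq_integrable M (v k)"
proof -
  have m[measurable]: "v k \<in> borel_measurable M" using b k by (simp add: backward_process_def)
  have "ext_integral M (\<lambda>\<omega>. ereal (1/2 * (norm (v k \<omega>))\<^sup>2)) \<noteq> \<infinity>"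
    using fin k unfolding backward_cost_def One_nat_def sum.atLeast1_atMost_eq sum_Pinfty by auto
  then have "integrable M (\<lambda>\<omega>. 1/2 * (norm (v k \<omega>))\<^sup>2)"
    by (intro ext_integral_nonneg_finite_integrable) auto
  from integrable_mult_right[OF this, of 2] show ?thesis using m by (simp add: sq_integrable_def)
qed

lemma forward_finite_cost:
  assumes b: "forward_process N A B \<Sigma>0 p M x u" and fin: "forward_cost N S Q p M x u \<noteq> \<infinity>" and k: "k < N"
  shows "sq_integrable M (\<lambda>\<omega>. u k \<omega> + transpose (S k) *v x k \<omega>)"
proof -
  let ?v = "\<lambda>\<omega>. u k \<omega> + transpose (S k) *v x k \<omega>"
  have m[measurable]: "u k \<in> borel_measurable M" "x k \<in> borel_measurable M" using b k by (auto simp: forward_process_def)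
  have q: "0 \<le> y \<bullet> (Qbar N S Q k *v y)" for y using Qb_psd[OF k] by (simp add: psd_def)
  have "ext_integral M (\<lambda>\<omega>. ereal (1/2 * (x k \<omega> \<bullet> (Qbar N S Q k *v x k \<omega>) + (norm (?v \<omega>))\<^sup>2))) \<noteq> \<infinity>"
    using fin k unfolding forward_cost_eq sum_Pinfty by auto
  then have i: "integrable M (\<lambda>\<omega>. 1/2 * (x k \<omega> \<bullet> (Qbar N S Q k *v x k \<omega>) + (norm (?v \<omega>))\<^sup>2))"
    by (intro ext_integral_nonneg_finite_integrable) (use q in auto)
  have "integrable M (\<lambda>\<omega>. (norm (?v \<omega>))\<^sup>2)"
  proof (rule Bochner_Integration.integrable_bound[OF integrable_mult_right[OF i, of 2]])
    show "AE \<omega> in M. norm ((norm (?v \<omega>))\<^sup>2) \<le> norm (2 * (1/2 * (x k \<omega> \<bullet> (Qbar N S Q k *v x k \<omega>) + (norm (?v \<omega>))\<^sup>2)))"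
      using q by simp
  qed measurable
  then show ?thesis by (simp add: sq_integrable_def)
qed

lemma divergence_self: "cond_density_pair.divergence M Z w w = 0" if "cond_density_pair M Y Z U w w"
  using cond_density_pair.divergence_def[OF that] by (simp add: kl_term_def)

text \<open>
  The constant \<open>c\<close> is the cost of the optimal policy; every competitor pays in addition its relative entropies.
\<close>
lemma backward_unique_optimal_star: "backward_unique_optimal N A B S Q \<Sigma>0 \<Sigma>N w_star"
proof -
  let ?M = "noise_space \<Sigma>N backward_cov N" and ?\<xi> = "\<lambda>k. bwd_state (N - k)" and ?v = bwd_control
  let ?L = "\<Sum>k<N. backward_log_norm k"
  define c where "c = backward_potential ?M ?\<xi> N - backward_potential ?M ?\<xi> 0 - ?L"
  have star: "backward_feasible N A B S \<Sigma>0 \<Sigma>N w_star ?M ?\<xi> ?v"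
    using backward_star_process backward_star_gaussian[OF backward_star_process, of 0]
    by (simp add: backward_feasible_def bridge_cov_ends)
  have pot: "backward_potential M \<xi> N - backward_potential M \<xi> 0 - ?L = c"
    if "backward_feasible N A B S \<Sigma>0 \<Sigma>N w M \<xi> v" for w and M :: "('n, 'm) path measure" and \<xi> v
  proof -
    have "is_gaussian M (\<xi> N) 0 \<Sigma>N" "is_gaussian M (\<xi> 0) 0 \<Sigma>0"
      "is_gaussian ?M (?\<xi> N) 0 \<Sigma>N" "is_gaussian ?M (?\<xi> 0) 0 \<Sigma>0"
      using that star by (auto simp: backward_feasible_def backward_process_def)
    then show ?thesis
      unfolding c_def backward_potential_def
      using is_gaussian_expectation_cong[of M "\<xi> N" \<Sigma>N ?M "?\<xi> N"] is_gaussian_expectation_cong[of M "\<xi> 0" \<Sigma>0 ?M "?\<xi> 0"]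
      by simp
  qed
  have cost: "backward_cost N S Q w M \<xi> v = enn2ereal (\<Sum>k<N. backward_divergence w M \<xi> k) + ereal c"
    if f: "backward_feasible N A B S \<Sigma>0 \<Sigma>N w M \<xi> v" and fin: "backward_cost N S Q w M \<xi> v \<noteq> \<infinity>"
    for w and M :: "('n, 'm) path measure" and \<xi> v
  proof -
    have b: "backward_process N A B S \<Sigma>N w M \<xi> v" using f by (simp add: backward_feasible_def)
    show ?thesis using backward_total_cost[OF b backward_finite_cost[OF b fin]] pot[OF f] by simp
  qed
  have "backward_divergence w_star ?M ?\<xi> k = 0" if "k < N" for k
    unfolding backward_divergence_def by (rule divergence_self[OF backward_pair[OF backward_star_process that]])
  then have star_cost: "backward_cost N S Q w_star ?M ?\<xi> ?v = ereal c"
    using backward_total_cost[OF backward_star_process bwd_control_sq_integrable]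
    by (simp add: c_def zero_ennreal.rep_eq)
  have ge: "ereal c \<le> backward_cost N S Q w M \<xi> v"
    if "backward_feasible N A B S \<Sigma>0 \<Sigma>N w M \<xi> v" for w and M :: "('n, 'm) path measure" and \<xi> v
  proof (cases "backward_cost N S Q w M \<xi> v = \<infinity>")
    case False
    have "0 + ereal c \<le> enn2ereal (\<Sum>k<N. backward_divergence w M \<xi> k) + ereal c"
      by (intro add_right_mono enn2ereal_nonneg)
    then show ?thesis using cost[OF that False] by simp
  qed simp
  have opt: "backward_optimal N A B S Q \<Sigma>0 \<Sigma>N w_star"
    unfolding backward_optimal_def using star ge star_cost by metis
  have "AE y in lborel. AE u in lborel. w k y u = w_star k y u"
    if wopt: "backward_optimal N A B S Q \<Sigma>0 \<Sigma>N w" and k: "k < N" for w k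
  proof -
    obtain M :: "('n, 'm) path measure" and \<xi> v where f: "backward_feasible N A B S \<Sigma>0 \<Sigma>N w M \<xi> v"
      and le: "backward_cost N S Q w M \<xi> v \<le> ereal c"
      using wopt star star_cost unfolding backward_optimal_def by metis
    have b: "backward_process N A B S \<Sigma>N w M \<xi> v" using f by (simp add: backward_feasible_def)
    have fin: "backward_cost N S Q w M \<xi> v \<noteq> \<infinity>" using le by auto
    have "(\<Sum>k<N. backward_divergence w M \<xi> k) = 0"
      using le unfolding cost[OF f fin] by (cases "\<Sum>k<N. backward_divergence w M \<xi> k") (auto simp: ennreal_eq_0_iff)
    then have div: "cond_density_pair.divergence M (\<xi> (Suc k)) (w k) (w_star k) = 0" if "k < N" for k
      using that by (simp add: backward_divergence_def)
    have "has_cond_density M borel (\<xi> (Suc k)) (v k) (w_star k)" if "k < N" for k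
      by (rule cond_density_pair.divergence_eq_0D(3)[OF backward_pair[OF b that] div[OF that]])
    then have b': "backward_process N A B S \<Sigma>N w_star M \<xi> v"
      using b w_star_cond_density by (simp add: backward_process_def)
    have g: "is_gaussian M (\<xi> (Suc k)) 0 (bridge_cov (Suc k))"
      using backward_star_gaussian[OF b', of "Suc k"] k by simp
    have law: "distr M borel (\<xi> (Suc k)) = density lborel (\<lambda>x. ennreal (gaussian_density 0 (bridge_cov (Suc k)) x))"
      and pd: "pos_def (bridge_cov (Suc k))"
      using g by (simp_all add: is_gaussian_iff gaussian_measure_def)
    show ?thesis
      using cond_density_pair.divergence_eq_0D(2)[OF backward_pair[OF b k] div[OF k]]
      unfolding law by (simp add: AE_density gaussian_density_pos[OF pd])
  qed
  then show ?thesis using opt by (simp add: backward_unique_optimal_def)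
qed

text \<open>
  The relative entropies vanish on the realization \<open>M\<close> that witnesses optimality. As \<open>M'\<close> has the same history laws, the
  policy agrees with the closed form almost everywhere for \<open>M'\<close> too.
\<close>
lemma forward_optimal_process:
  assumes opt: "forward_optimal N A B S Q \<Sigma>0 \<Sigma>N p" and f': "forward_process N A B \<Sigma>0 p M' x' u'"
  shows "forward_process N A B \<Sigma>0 p_star M' x' u'"
proof -
  let ?M = "noise_space \<Sigma>0 forward_cov N" and ?x = fwd_state and ?u = fwd_control
  let ?L = "\<Sum>k<N. forward_log_norm k"
  define c where "c = forward_potential ?M ?x 0 - forward_potential ?M ?x N - ?L"
  have star: "forward_feasible N A B \<Sigma>0 \<Sigma>N p_star ?M ?x ?u"
    using forward_star_process forward_star_gaussian[OF forward_star_process, of N]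
    by (simp add: forward_feasible_def bridge_cov_ends)
  have "forward_divergence p_star ?M ?x ?u k = 0" if "k < N" for k
    unfolding forward_divergence_def by (rule divergence_self[OF forward_pair[OF forward_star_process that]])
  then have star_cost: "forward_cost N S Q p_star ?M ?x ?u = ereal c"
    using forward_total_cost[OF forward_star_process fwd_control_sq_integrable]
    by (simp add: c_def zero_ennreal.rep_eq)
  obtain M :: "('n, 'm) path measure" and x u where f: "forward_feasible N A B \<Sigma>0 \<Sigma>N p M x u"
    and le: "forward_cost N S Q p M x u \<le> ereal c"
    using opt star star_cost unfolding forward_optimal_def by metis
  have b: "forward_process N A B \<Sigma>0 p M x u" using f by (simp add: forward_feasible_def)
  have fin: "forward_cost N S Q p M x u \<noteq> \<infinity>" using le by auto
  have "is_gaussian M (x N) 0 \<Sigma>N" "is_gaussian M (x 0) 0 \<Sigma>0"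
    "is_gaussian ?M (?x N) 0 \<Sigma>N" "is_gaussian ?M (?x 0) 0 \<Sigma>0"
    using f star by (auto simp: forward_feasible_def forward_process_def)
  then have "forward_potential M x 0 - forward_potential M x N - ?L = c"
    unfolding c_def forward_potential_def
    using is_gaussian_expectation_cong[of M "x N" \<Sigma>N ?M "?x N"] is_gaussian_expectation_cong[of M "x 0" \<Sigma>0 ?M "?x 0"]
    by simp
  then have "forward_cost N S Q p M x u = enn2ereal (\<Sum>k<N. forward_divergence p M x u k) + ereal c"
    using forward_total_cost[OF b forward_finite_cost[OF b fin]] by simp
  then have "(\<Sum>k<N. forward_divergence p M x u k) = 0"
    using le by (cases "\<Sum>k<N. forward_divergence p M x u k") (auto simp: ennreal_eq_0_iff)
  then have div: "cond_density_pair.divergence M (hist x u k) (p k) (p_star k) = 0" if "k < N" for k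
    using that by (simp add: forward_divergence_def)
  have "has_cond_density M' (hist_space k) (hist x' u' k) (u' k) (p_star k)" if k: "k < N" for k
  proof (rule has_cond_density_cong_AE)
    show "has_cond_density M' (hist_space k) (hist x' u' k) (u' k) (p k)" "cond_density (hist_space k) (p k)"
      using f' k by (auto simp: forward_process_def)
    show "cond_density (hist_space k) (p_star k)" by (rule p_star_cond_density[OF k])
    show "AE y in distr M' (hist_space k) (hist x' u' k) \<Otimes>\<^sub>M lborel. p k (fst y) (snd y) = p_star k (fst y) (snd y)"
      using cond_density_pair.divergence_eq_0D(1)[OF forward_pair[OF b k] div[OF k]]
      unfolding forward_hist_distr_unique[OF b f' less_imp_le[OF k]] .
  qed
  then show ?thesis using f' p_star_cond_density by (simp add: forward_process_def)
qed

end

theorem corollary3: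
  fixes N :: nat
    and A Q :: "nat \<Rightarrow> real^'n^'n"
    and B S :: "nat \<Rightarrow> real^'m^'n"
    and \<Sigma>0 \<Sigma>N :: "real^'n^'n"
    and P H :: "nat \<Rightarrow> real^'n^'n"
  assumes N: "1 \<le> N"
    and Q_sym: "\<forall>k<N. transpose (Q k) = Q k"
    and Qbar_psd: "\<forall>k<N. psd (Qbar N S Q k)"
    and \<Sigma>0: "pos_def \<Sigma>0" and \<Sigma>N: "pos_def \<Sigma>N"
    and A1: "\<forall>k<N. invertible (Abar A B S k)"
    and A2: "\<exists>r\<in>{1..N}. (\<forall>k\<in>{r..N}. invertible (gramian A B S k 0)) \<and>
                        (\<forall>k\<in>{0..r}. invertible (gramian A B S N k))"
    and P_N: "P N = Y_plus N A B S Q \<Sigma>0 \<Sigma>N"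
    and P_step: "\<forall>k<N. P k =
           transpose (Abar A B S k) ** P (k + 1) ** Abar A B S k
         - transpose (Abar A B S k) ** P (k + 1) ** B k
             ** matrix_inv (mat 1 + transpose (B k) ** P (k + 1) ** B k)
             ** transpose (B k) ** P (k + 1) ** Abar A B S k
         + Qbar N S Q k"
    and H_N: "H N = matrix_inv \<Sigma>N - Y_plus N A B S Q \<Sigma>0 \<Sigma>N"
    and H_step: "\<forall>k<N. H k =
           transpose (Abar A B S k) ** H (k + 1) ** Abar A B S k
         - transpose (Abar A B S k) ** H (k + 1) ** B k
             ** matrix_inv (- mat 1 + transpose (B k) ** H (k + 1) ** B k)
             ** transpose (B k) ** H (k + 1) ** Abar A B S k
         - Qbar N S Q k"
  shows "(\<forall>k<N. pos_def (mat 1 - transpose (B k) ** H (k + 1) ** B k)) \<and>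
    backward_unique_optimal N A B S Q \<Sigma>0 \<Sigma>N (backward_policy_star B H) \<and>
    (\<forall>(M :: 'w measure) \<xi> v (M' :: 'z measure) x u p.
       backward_process N A B S \<Sigma>N (backward_policy_star B H) M \<xi> v \<longrightarrow>
       (p = forward_policy_star A B S P \<or> forward_optimal N A B S Q \<Sigma>0 \<Sigma>N p) \<longrightarrow>
       forward_process N A B \<Sigma>0 p M' x u \<longrightarrow>
       (\<forall>k\<le>N. is_gaussian M (\<xi> k) 0 (second_moment M' (x k)) \<and>
              distr M borel (\<xi> k) = distr M' borel (x k)))"
proof -
  have reach: "invertible (gramian A B S N 0)" using A2 by force
  interpret riccati_pair N "Abar A B S" B "Qbar N S Q" P H \<Sigma>0 \<Sigma>N
    by (rule riccati_pair_of_boundary_data[OF Qbar_psd \<Sigma>0 \<Sigma>N A1 reach P_N P_step H_N H_step])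
  interpret maxent_pair N A Q B S P H \<Sigma>0 \<Sigma>N ..
  have "pos_def (mat 1 - transpose (B k) ** H (k + 1) ** B k)" if "k < N" for k
    using backward_cov_pos_def[OF that]
    by (simp add: backward_cov_def input_weight_def matrix_uminus_mult_left matrix_uminus_mult_right)
  moreover have "is_gaussian M (\<xi> k) 0 (second_moment M' (x k)) \<and> distr M borel (\<xi> k) = distr M' borel (x k)"
    if b: "backward_process N A B S \<Sigma>N (backward_policy_star B H) M \<xi> v"
      and p: "p = forward_policy_star A B S P \<or> forward_optimal N A B S Q \<Sigma>0 \<Sigma>N p"
      and f: "forward_process N A B \<Sigma>0 p M' x u" and k: "k \<le> N"
    for M :: "'w measure" and \<xi> v and M' :: "'z measure" and x u p k
  proof -
    have "forward_process N A B \<Sigma>0 (forward_policy_star A B S P) M' x u"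
      using p f forward_optimal_process by blast
    from forward_star_gaussian[OF this k] have g: "is_gaussian M' (x k) 0 (bridge_cov k)" .
    show ?thesis
      using backward_star_gaussian[OF b k] g is_gaussian_moments(2)[OF g] by (simp add: is_gaussian_iff)
  qed
  ultimately show ?thesis using backward_unique_optimal_star by blast
qed

end
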